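(* (Composition-Diamond lemma for Lie $\Omega$-algebras) Let $S\subseteq Lie(\Omega;X)$ be a non-empty monic set and let $Id_{Lie}(S)$ be the ideal of $Lie(\Omega;X)$ generated by $S$. Then the following statements are equivalent: (i) $S$ is a Gröbner-Shirshov basis in $Lie(\Omega;X)$. (ii) If $0\neq f\in Id_{Lie}(S)$, then $\bar f=\pi|_{\bar s}\in ALSW(\Omega;X)$ for some $s\in S$ and $\pi\in\langle\Omega;X\rangle^\star$. (iii) The set $$Irr(S)=\{[w] : w\in ALSW(\Omega;X),\ w\neq\pi|_{\bar s}\ \text{for all } s\in S,\ \pi\in\langle\Omega;X\rangle^\star\}$$ is a linear basis of the Lie $\Omega$-algebra $Lie(\Omega;X|S):=Lie(\Omega;X)/Id_{Lie}(S)$.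
   Context: **Words.** $k$ is a field, $X$ a set, $\Omega=\bigcup_{m\ge1}\Omega_m$ where $\Omega_m$ is a set of $m$-ary operator symbols; $X$ and $\Omega$ carry well orders. For a set $Y$: $S(Y)$ is the set of nonempty associative words on $Y$, $Y^*=S(Y)\cup\{1\}$ ($1$ the empty word), and $\Omega(Y)=\bigcup_m\{\omega(y_1,\dots,y_m): y_i\in Y,\ \omega\in\Omega_m\}$ (formal expressions). Put $\langle\Omega;X\rangle_0=S(X)$, $\langle\Omega;X\rangle_n=S(X\cup\Omega(\langle\Omega;X\rangle_{n-1}))$, $\langle\Omega;X\rangle=\bigcup_n\langle\Omega;X\rangle_n$ (associative $\Omega$-words). **Order.** Elements of $X\cup\Omega(\langle\Omega;X\rangle)$ are called prime; each $u\in\langle\Omega;X\rangle$ is uniquely $u=u_1\cdots u_n$ with $u_i$ prime, and $bre(u)=n$; $deg(u)$ is the total number of occurrences of elements of $X$ and $\Omega$ in $u$. Put $wt(u)=(deg(u),bre(u),u_1,\dots,u_n)$. The order $>_{Dl}$ on $\langle\Omega;X\rangle$: $u>_{Dl}v$ iff $wt(u)>wt(v)$ lexicographically, where primes are compared first by degree; primes of degree $1$ are elements of $X$, compared by the order of $X$; primes $\omega(a_1,\dots,a_t)$, $\theta(b_1,\dots,b_l)$ of equal degree are compared by comparing $(\omega,a_1,\dots,a_t)$ and $(\theta,b_1,\dots,b_l)$ lexicographically (operators by the order of $\Omega$, arguments recursively by $>_{Dl}$). Let $\succ$ be the restriction of $>_{Dl}$ to prime elements. **Lyndon-Shirshov words.**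 For an ordered set $Z$, the lex order on $Z^*$: $1>_{lex}u$ for every nonempty $u$, and $zu'>_{lex}z'v'$ ($z,z'\in Z$) iff $z>z'$, or $z=z'$ and $u'>_{lex}v'$. $ALSW(Z)$ is the set of nonempty words $w$ with $uv>_{lex}vu$ for every factorization $w=uv$ with $u,v\ne1$. $NLSW(Z)$ is the set of non-associative (fully bracketed) words $(u)$ such that: the underlying associative word $u$ is in $ALSW(Z)$; if $(u)=((v)(w))$ then $(v),(w)\in NLSW(Z)$; and if moreover $(v)=((v_1)(v_2))$ then $v_2\le_{lex}w$. Each $u\in ALSW(Z)$ has exactly one bracketing $[u]\in NLSW(Z)$ (the Shirshov standard bracketing). **Lyndon-Shirshov $\Omega$-words.** $ALSW(\Omega;X)_0=ALSW(X)$, $ALSW(\Omega;X)_n=ALSW(X\cup\Omega(ALSW(\Omega;X)_{n-1}))$ with respect to $\succ_{lex}$, and $ALSW(\Omega;X)=\bigcup_nALSW(\Omega;X)_n$. The bracketing $[u]$ of $u\in ALSW(\Omega;X)$: $[x]=x$ for $x\in X$; $[\omega(u_1,\dots,u_m)]=\omega([u_1],\dots,[u_m])$; for $u=u_1\cdots u_m$ with $u_i$ prime, $[u]$ is the Shirshov standard bracketing of the word $[u_1][u_2]\cdots[u_m]$ in the letters $[u_1],\dots,[u_m]$, ordered by $[p]\succ[q]$ iff $p\succ q$. $NLSW(\Omega;X)=\{[u]:u\in ALSW(\Omega;X)\}$. **Algebras.** A Lie $\Omega$-algebra is a Lie $k$-algebra with, for each $\omega\in\Omega_m$, an $m$-ary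 multilinear operation; an ideal of it is a Lie ideal $I$ such that $\omega(a_1,\dots,a_m)\in I$ whenever some $a_i\in I$. $k\langle\Omega;X\rangle$ is the $k$-space with basis $\langle\Omega;X\rangle$, with concatenation as product and operators extended multilinearly. $Lie(\Omega;X)$ is the Lie $\Omega$-subalgebra of $k\langle\Omega;X\rangle$ generated by $X$ under $(uv)=uv-vu$ (and all operators); the elements $[u]$ are regarded as elements of $Lie(\Omega;X)$ by reading brackets as commutators. For $0\ne f\in k\langle\Omega;X\rangle$, $\bar f$ is the leading (largest) $\Omega$-word of $f$ with respect to $>_{Dl}$; $f$ is monic if the coefficient of $\bar f$ is $1$; a set is monic if all its elements are. (For $0\neq f\in Lie(\Omega;X)$ one has $\bar f\in ALSW(\Omega;X)$.) **Special normal words.** $\langle\Omega;X\rangle^\star$ is the set of $\star$-$\Omega$-words: associative $\Omega$-words on $X\cup\{\star\}$ with exactly one occurrence of $\star\notin X$; $\pi|_s$ is the result of substituting $s$ for $\star$ in $\pi$ (expanded multilinearly). If $v,\pi|_v\in ALSW(\Omega;X)$, there are $\pi_1\in\langle\Omega;X\rangle^\star$ and a possibly empty $\Omega$-word $c$ with $[\pi|_v]=[\pi_1|_{[vc]}]$, i.e. $\pi=\pi_1|_{\star c}$, $vc\in ALSW(\Omega;X)$, and the bracketed word $[\pi|_v]$ has $[vc]$ as a bracketed subword at the place of $\star$ in $\pi_1$. Write (uniquely) $c=c_1\cdots c_m$ with $c_i\in ALSW(\Omega;X)$, $c_t\preceq_{lex}c_{t+1}$, and let $[\pi|_v]_v$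 be obtained from $[\pi|_v]$ by replacing this subword $[vc]$ by $[\cdots[[[v][c_1]][c_2]]\cdots[c_m]]$; a choice of $(\pi_1,c)$ is fixed for each $(\pi,v)$. For monic $f\in Lie(\Omega;X)$ with $\pi|_{\bar f}\in ALSW(\Omega;X)$, the special normal $f$-word $[\pi|_f]_{\bar f}\in Lie(\Omega;X)$ is obtained from $[\pi|_{\bar f}]_{\bar f}$ by replacing the distinguished factor $[\bar f]$ by $f$. **Compositions.** Let $f,g\in Lie(\Omega;X)$ be monic. (a) If $w=\bar fa=b\bar g$ with $a,b\in\langle\Omega;X\rangle$ and $bre(w)<bre(\bar f)+bre(\bar g)$, then $\langle f,g\rangle_w=[fa]_{\bar f}-[bg]_{\bar g}$ (intersection composition; $\pi=\star a$ and $\pi=b\star$ respectively). (b) If $w=\bar f=\pi|_{\bar g}$ with $\pi\in\langle\Omega;X\rangle^\star$, then $\langle f,g\rangle_w=f-[\pi|_g]_{\bar g}$ (inclusion composition). A composition is trivial modulo $(S,w)$ if it equals a finite sum $\sum\alpha_i[\pi_i|_{s_i}]_{\overline{s_i}}$ with $\alpha_i\in k$, $s_i\in S$, $[\pi_i|_{s_i}]_{\overline{s_i}}$ special normal $s_i$-words and $\pi_i|_{\overline{s_i}}<_{Dl}w$. A monic set $S\subseteq Lie(\Omega;X)$ is a Gröbner-Shirshov basis in $Lie(\Omega;X)$ if every composition $\langle f,g\rangle_w$ of $f,g\in S$ is trivial modulo $(S,w)$. *)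

theory Defs
  imports Complex_Main "HOL-Library.Poly_Mapping"
begin

section \<open>Associative words with operators\<close>

text \<open>
  The datatypes below are raw: they contain all finite expressions over all letters and operator
  symbols of a type. Which of them are words over the given set of letters \<open>X\<close>, set of operator
  symbols \<open>Om\<close> and arity function \<open>ar\<close> is decided by \<open>owords\<close>. A word is the list of its prime
  factors, so concatenation is \<open>@\<close>, the breadth is \<open>length\<close> and the empty word is \<open>[]\<close>.
\<close>

datatype ('x, 'o) oprime = Var 'x | Op 'o "('x, 'o) oprime list list"

type_synonym ('x, 'o) oword = "('x, 'o) oprime list"

definition words_on :: "'a set \<Rightarrow> 'a list set" where
  "words_on Y = {w. w \<noteq> [] \<and> set w \<subseteq> Y}"

definition op_exprs :: "'o set \<Rightarrow> ('o \<Rightarrow> nat) \<Rightarrow> ('x, 'o) oword set \<Rightarrow> ('x, 'o) oprime set" where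
  "op_exprs Om ar Y = {Op \<omega> us | \<omega> us. \<omega> \<in> Om \<and> length us = ar \<omega> \<and> set us \<subseteq> Y}"

primrec owords_level ::
  "'x set \<Rightarrow> 'o set \<Rightarrow> ('o \<Rightarrow> nat) \<Rightarrow> nat \<Rightarrow> ('x, 'o) oword set" where
  "owords_level X Om ar 0 = words_on (Var ` X)"
| "owords_level X Om ar (Suc n) = words_on (Var ` X \<union> op_exprs Om ar (owords_level X Om ar n))"

definition owords :: "'x set \<Rightarrow> 'o set \<Rightarrow> ('o \<Rightarrow> nat) \<Rightarrow> ('x, 'o) oword set" where
  "owords X Om ar = (\<Union>n. owords_level X Om ar n)"

section \<open>The degree-lexicographic order\<close>

primrec deg_prime :: "('x, 'o) oprime \<Rightarrow> nat" where
  "deg_prime (Var x) = 1"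
| "deg_prime (Op \<omega> us) = Suc (sum_list (map sum_list (map (map deg_prime) us)))"

definition deg :: "('x, 'o) oword \<Rightarrow> nat" where
  "deg u = sum_list (map deg_prime u)"

text \<open>
  \<open>prime_gt\<close> is the order \<open>\<succ>\<close> on primes and \<open>dl_gt\<close> is \<open>>\<^sub>D\<^sub>l\<close>. In the rules with an index \<open>i\<close>,
  \<open>i\<close> is the first position at which the two sequences differ.
\<close>

inductive prime_gt :: "('x::wellorder, 'o::wellorder) oprime \<Rightarrow> ('x, 'o) oprime \<Rightarrow> bool"
  and dl_gt :: "('x, 'o) oword \<Rightarrow> ('x, 'o) oword \<Rightarrow> bool" where
  prime_deg: "deg_prime p > deg_prime q \<Longrightarrow> prime_gt p q"
| prime_var: "x > y \<Longrightarrow> prime_gt (Var x) (Var y)"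
| prime_sym: "deg_prime (Op \<omega> us) = deg_prime (Op \<theta> vs) \<Longrightarrow> \<omega> > \<theta> \<Longrightarrow>
    prime_gt (Op \<omega> us) (Op \<theta> vs)"
| prime_arg: "deg_prime (Op \<omega> us) = deg_prime (Op \<omega> vs) \<Longrightarrow> i < length us \<Longrightarrow> i < length vs \<Longrightarrow>
    take i us = take i vs \<Longrightarrow> dl_gt (us ! i) (vs ! i) \<Longrightarrow> prime_gt (Op \<omega> us) (Op \<omega> vs)"
| word_deg: "deg u > deg v \<Longrightarrow> dl_gt u v"
| word_bre: "deg u = deg v \<Longrightarrow> length u > length v \<Longrightarrow> dl_gt u v"
| word_lex: "deg u = deg v \<Longrightarrow> length u = length v \<Longrightarrow> i < length u \<Longrightarrow> take i u = take i v \<Longrightarrow>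
    prime_gt (u ! i) (v ! i) \<Longrightarrow> dl_gt u v"

section \<open>Lyndon-Shirshov words over an ordered alphabet\<close>

text \<open>Unlike in the usual lexicographic order, a proper prefix is greater than the longer word.\<close>

fun lex_gt :: "('a \<Rightarrow> 'a \<Rightarrow> bool) \<Rightarrow> 'a list \<Rightarrow> 'a list \<Rightarrow> bool" where
  "lex_gt gt [] [] = False"
| "lex_gt gt [] (b # v) = True"
| "lex_gt gt (a # u) [] = False"
| "lex_gt gt (a # u) (b # v) = (gt a b \<or> a = b \<and> lex_gt gt u v)"

definition lex_ge :: "('a \<Rightarrow> 'a \<Rightarrow> bool) \<Rightarrow> 'a list \<Rightarrow> 'a list \<Rightarrow> bool" where
  "lex_ge gt u v \<longleftrightarrow> u = v \<or> lex_gt gt u v"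

definition is_alsw :: "('a \<Rightarrow> 'a \<Rightarrow> bool) \<Rightarrow> 'a list \<Rightarrow> bool" where
  "is_alsw gt w \<longleftrightarrow>
     w \<noteq> [] \<and> (\<forall>u v. w = u @ v \<and> u \<noteq> [] \<and> v \<noteq> [] \<longrightarrow> lex_gt gt (u @ v) (v @ u))"

datatype 'a btree = Leaf 'a | Branch "'a btree" "'a btree"

primrec leaves :: "'a btree \<Rightarrow> 'a list" where
  "leaves (Leaf a) = [a]"
| "leaves (Branch s t) = leaves s @ leaves t"

fun is_nlsw :: "('a \<Rightarrow> 'a \<Rightarrow> bool) \<Rightarrow> 'a btree \<Rightarrow> bool" where
  "is_nlsw gt (Leaf a) \<longleftrightarrow> is_alsw gt [a]"
| "is_nlsw gt (Branch v w) \<longleftrightarrow>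
     is_alsw gt (leaves (Branch v w)) \<and> is_nlsw gt v \<and> is_nlsw gt w \<and>
     (\<forall>v1 v2. v = Branch v1 v2 \<longrightarrow> lex_ge gt (leaves w) (leaves v2))"

definition shirshov :: "('a \<Rightarrow> 'a \<Rightarrow> bool) \<Rightarrow> 'a list \<Rightarrow> 'a btree" where
  "shirshov gt u = (THE t. is_nlsw gt t \<and> leaves t = u)"

section \<open>Lyndon-Shirshov words with operators\<close>

primrec oalsw_level :: "'x::wellorder set \<Rightarrow> 'o::wellorder set \<Rightarrow> ('o \<Rightarrow> nat) \<Rightarrow> nat \<Rightarrow>
    ('x, 'o) oword set" where
  "oalsw_level X Om ar 0 = {w \<in> words_on (Var ` X). is_alsw prime_gt w}"
| "oalsw_level X Om ar (Suc n) =
     {w \<in> words_on (Var ` X \<union> op_exprs Om ar (oalsw_level X Om ar n)). is_alsw prime_gt w}"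

definition oalsw :: "'x::wellorder set \<Rightarrow> 'o::wellorder set \<Rightarrow> ('o \<Rightarrow> nat) \<Rightarrow> ('x, 'o) oword set" where
  "oalsw X Om ar = (\<Union>n. oalsw_level X Om ar n)"

datatype ('x, 'o) naword =
  NVar 'x | NOp 'o "('x, 'o) naword list" | NBr "('x, 'o) naword" "('x, 'o) naword"

primrec assoc_word :: "('x, 'o) naword \<Rightarrow> ('x, 'o) oword" where
  "assoc_word (NVar x) = [Var x]"
| "assoc_word (NOp \<omega> ts) = [Op \<omega> (map assoc_word ts)]"
| "assoc_word (NBr s t) = assoc_word s @ assoc_word t"

primrec graft :: "('a \<Rightarrow> ('x, 'o) naword) \<Rightarrow> 'a btree \<Rightarrow> ('x, 'o) naword" where
  "graft h (Leaf a) = h a"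
| "graft h (Branch s t) = NBr (graft h s) (graft h t)"

text \<open>
  The letters \<open>[u\<^sub>1], \<dots>, [u\<^sub>m]\<close> are represented by the pairs \<open>(u\<^sub>i, [u\<^sub>i])\<close>, so that they can be
  ordered by \<open>prime_gt\<close> on the first components.
\<close>

definition bracket_letters ::
  "(('x::wellorder, 'o::wellorder) oprime \<times> ('x, 'o) naword) list \<Rightarrow> ('x, 'o) naword" where
  "bracket_letters l = graft snd (shirshov (\<lambda>a b. prime_gt (fst a) (fst b)) l)"

primrec bracket_prime :: "('x::wellorder, 'o::wellorder) oprime \<Rightarrow> ('x, 'o) naword" where
  "bracket_prime (Var x) = NVar x"
| "bracket_prime (Op \<omega> us) =
     NOp \<omega> (map bracket_letters (map (map (\<lambda>p. (p, bracket_prime p))) us))"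

definition bracket :: "('x::wellorder, 'o::wellorder) oword \<Rightarrow> ('x, 'o) naword" where
  "bracket u = bracket_letters (map (\<lambda>p. (p, bracket_prime p)) u)"

section \<open>The algebra with basis the associative words, and its Lie subalgebra\<close>

type_synonym ('x, 'o, 'k) oalg = "('x, 'o) oword \<Rightarrow>\<^sub>0 'k"

definition scl :: "'k::field \<Rightarrow> ('a \<Rightarrow>\<^sub>0 'k) \<Rightarrow> ('a \<Rightarrow>\<^sub>0 'k)" where
  "scl c f = Poly_Mapping.map ((*) c) f"

lemma lookup_scl [simp]: "Poly_Mapping.lookup (scl c f) u = c * Poly_Mapping.lookup f u"
  by (simp add: scl_def Poly_Mapping.map.rep_eq when_def)

lemma vector_space_scl: "vector_space scl"
  by unfold_locales (auto intro!: poly_mapping_eqI simp: lookup_add algebra_simps)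

lemma module_scl: "module scl"
  using vector_space_scl by (simp add: module_iff_vector_space)

definition mon :: "('x, 'o) oword \<Rightarrow> ('x, 'o, 'k::field) oalg" where
  "mon u = Poly_Mapping.single u 1"

definition mul ::
  "('x, 'o, 'k::field) oalg \<Rightarrow> ('x, 'o, 'k) oalg \<Rightarrow> ('x, 'o, 'k) oalg" where
  "mul f g = (\<Sum>u\<in>Poly_Mapping.keys f. \<Sum>v\<in>Poly_Mapping.keys g.
     scl (Poly_Mapping.lookup f u * Poly_Mapping.lookup g v) (mon (u @ v)))"

definition comm ::
  "('x, 'o, 'k::field) oalg \<Rightarrow> ('x, 'o, 'k) oalg \<Rightarrow> ('x, 'o, 'k) oalg" where
  "comm f g = mul f g - mul g f"

text \<open>The multilinear extension of \<open>us \<mapsto> Op \<omega> us\<close>; \<open>listset\<close> is the cartesian product of the supports.\<close>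

definition oper :: "'o \<Rightarrow> ('x, 'o, 'k::field) oalg list \<Rightarrow> ('x, 'o, 'k) oalg" where
  "oper \<omega> fs = (\<Sum>us\<in>listset (map Poly_Mapping.keys fs).
     scl (\<Prod>i<length fs. Poly_Mapping.lookup (fs ! i) (us ! i)) (mon [Op \<omega> us]))"

definition free_alg :: "'x set \<Rightarrow> 'o set \<Rightarrow> ('o \<Rightarrow> nat) \<Rightarrow> ('x, 'o, 'k::field) oalg set" where
  "free_alg X Om ar = {f. Poly_Mapping.keys f \<subseteq> owords X Om ar}"

definition lie_subalg ::
  "'x set \<Rightarrow> 'o set \<Rightarrow> ('o \<Rightarrow> nat) \<Rightarrow> ('x, 'o, 'k::field) oalg set \<Rightarrow> bool" where
  "lie_subalg X Om ar A \<longleftrightarrow>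
     A \<subseteq> free_alg X Om ar \<and> module.subspace scl A \<and>
     (\<forall>f\<in>A. \<forall>g\<in>A. comm f g \<in> A) \<and>
     (\<forall>\<omega>\<in>Om. \<forall>fs. length fs = ar \<omega> \<and> set fs \<subseteq> A \<longrightarrow> oper \<omega> fs \<in> A)"

definition Lie :: "'x set \<Rightarrow> 'o set \<Rightarrow> ('o \<Rightarrow> nat) \<Rightarrow> ('x, 'o, 'k::field) oalg set" where
  "Lie X Om ar = lie_subalg X Om ar hull ((\<lambda>x. mon [Var x]) ` X)"

definition lie_ideal ::
  "'x set \<Rightarrow> 'o set \<Rightarrow> ('o \<Rightarrow> nat) \<Rightarrow> ('x, 'o, 'k::field) oalg set \<Rightarrow> bool" where
  "lie_ideal X Om ar I \<longleftrightarrow>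
     I \<subseteq> Lie X Om ar \<and> module.subspace scl I \<and>
     (\<forall>f\<in>I. \<forall>g\<in>Lie X Om ar. comm f g \<in> I \<and> comm g f \<in> I) \<and>
     (\<forall>\<omega>\<in>Om. \<forall>fs. length fs = ar \<omega> \<and> set fs \<subseteq> Lie X Om ar \<and> set fs \<inter> I \<noteq> {} \<longrightarrow>
        oper \<omega> fs \<in> I)"

definition Id_Lie :: "'x set \<Rightarrow> 'o set \<Rightarrow> ('o \<Rightarrow> nat) \<Rightarrow> ('x, 'o, 'k::field) oalg set \<Rightarrow>
    ('x, 'o, 'k) oalg set" where
  "Id_Lie X Om ar S = lie_ideal X Om ar hull S"

primrec eval_na ::
  "('x \<Rightarrow> ('y, 'o, 'k::field) oalg) \<Rightarrow> ('x, 'o) naword \<Rightarrow> ('y, 'o, 'k) oalg" where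
  "eval_na \<rho> (NVar x) = \<rho> x"
| "eval_na \<rho> (NOp \<omega> ts) = oper \<omega> (map (eval_na \<rho>) ts)"
| "eval_na \<rho> (NBr s t) = comm (eval_na \<rho> s) (eval_na \<rho> t)"

definition lie_elem :: "('x, 'o) naword \<Rightarrow> ('x, 'o, 'k::field) oalg" where
  "lie_elem t = eval_na (\<lambda>x. mon [Var x]) t"

definition lead :: "('x::wellorder, 'o::wellorder, 'k::field) oalg \<Rightarrow> ('x, 'o) oword" where
  "lead f = (THE u. u \<in> Poly_Mapping.keys f \<and> (\<forall>v\<in>Poly_Mapping.keys f. v \<noteq> u \<longrightarrow> dl_gt u v))"

definition monic :: "('x::wellorder, 'o::wellorder, 'k::field) oalg \<Rightarrow> bool" where
  "monic f \<longleftrightarrow> f \<noteq> 0 \<and> Poly_Mapping.lookup f (lead f) = 1"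

section \<open>Words with a hole\<close>

text \<open>The letters are \<open>None\<close>, which is the hole \<open>\<star>\<close>, and \<open>Some x\<close> for \<open>x \<in> X\<close>.\<close>

primrec holes_prime :: "('x option, 'o) oprime \<Rightarrow> nat" where
  "holes_prime (Var z) = (if z = None then 1 else 0)"
| "holes_prime (Op \<omega> us) = sum_list (map sum_list (map (map holes_prime) us))"

definition star_words :: "'x set \<Rightarrow> 'o set \<Rightarrow> ('o \<Rightarrow> nat) \<Rightarrow> ('x option, 'o) oword set" where
  "star_words X Om ar =
     {\<pi> \<in> owords (insert None (Some ` X)) Om ar. sum_list (map holes_prime \<pi>) = 1}"

primrec bind_prime :: "('x \<Rightarrow> ('y, 'o) oword) \<Rightarrow> ('x, 'o) oprime \<Rightarrow> ('y, 'o) oword" where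
  "bind_prime h (Var x) = h x"
| "bind_prime h (Op \<omega> us) = [Op \<omega> (map concat (map (map (bind_prime h)) us))]"

definition bind_word :: "('x \<Rightarrow> ('y, 'o) oword) \<Rightarrow> ('x, 'o) oword \<Rightarrow> ('y, 'o) oword" where
  "bind_word h u = concat (map (bind_prime h) u)"

definition plug :: "('x option, 'o) oword \<Rightarrow> ('x, 'o) oword \<Rightarrow> ('x, 'o) oword" where
  "plug \<pi> s = bind_word (case_option s (\<lambda>x. [Var x])) \<pi>"

definition plug_star ::
  "('x option, 'o) oword \<Rightarrow> ('x option, 'o) oword \<Rightarrow> ('x option, 'o) oword" where
  "plug_star \<pi> \<sigma> = bind_word (case_option \<sigma> (\<lambda>x. [Var (Some x)])) \<pi>"

abbreviation star :: "('x option, 'o) oword" where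
  "star \<equiv> [Var None]"

definition lift_word :: "('x, 'o) oword \<Rightarrow> ('x option, 'o) oword" where
  "lift_word u = map (map_oprime Some id) u"

primrec bind_na :: "('x \<Rightarrow> ('y, 'o) naword) \<Rightarrow> ('x, 'o) naword \<Rightarrow> ('y, 'o) naword" where
  "bind_na h (NVar x) = h x"
| "bind_na h (NOp \<omega> ts) = NOp \<omega> (map (bind_na h) ts)"
| "bind_na h (NBr s t) = NBr (bind_na h s) (bind_na h t)"

definition plug_na :: "('x option, 'o) naword \<Rightarrow> ('x, 'o) naword \<Rightarrow> ('x, 'o) naword" where
  "plug_na C t = bind_na (case_option t NVar) C"

definition plug_star_na ::
  "('x option, 'o) naword \<Rightarrow> ('x option, 'o) naword \<Rightarrow> ('x option, 'o) naword" where
  "plug_star_na C D = bind_na (case_option D (\<lambda>x. NVar (Some x))) C"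

section \<open>Special normal words\<close>

text \<open>
  \<open>star_bracketing v \<pi>\<^sub>1 c w C\<close> says that \<open>C\<close> is a bracketing of the \<open>\<star>\<close>-word \<open>\<pi>\<^sub>1\<close> and that \<open>[w]\<close> is
  obtained from it by putting \<open>[vc]\<close> in place of \<open>\<star>\<close>; that is, \<open>[vc]\<close> is a bracketed subword of
  \<open>[w]\<close> at the place of \<open>\<star>\<close> in \<open>\<pi>\<^sub>1\<close>. At most one \<open>C\<close> has this property.
\<close>

definition star_bracketing :: "('x::wellorder, 'o::wellorder) oword \<Rightarrow> ('x option, 'o) oword \<Rightarrow>
    ('x, 'o) oword \<Rightarrow> ('x, 'o) oword \<Rightarrow> ('x option, 'o) naword \<Rightarrow> bool" where
  "star_bracketing v \<pi>1 c w C \<longleftrightarrow> assoc_word C = \<pi>1 \<and> plug_na C (bracket (v @ c)) = bracket w"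

definition admissible :: "'x::wellorder set \<Rightarrow> 'o::wellorder set \<Rightarrow> ('o \<Rightarrow> nat) \<Rightarrow>
    ('x option, 'o) oword \<Rightarrow> ('x, 'o) oword \<Rightarrow> ('x option, 'o) oword \<Rightarrow> ('x, 'o) oword \<Rightarrow> bool" where
  "admissible X Om ar \<pi> v \<pi>1 c \<longleftrightarrow>
     \<pi>1 \<in> star_words X Om ar \<and> (c = [] \<or> c \<in> owords X Om ar) \<and>
     \<pi> = plug_star \<pi>1 (star @ lift_word c) \<and> v @ c \<in> oalsw X Om ar \<and>
     (\<exists>C. star_bracketing v \<pi>1 c (plug \<pi> v) C)"

text \<open>\<open>ch \<pi> v\<close> is the pair \<open>(\<pi>\<^sub>1, c)\<close> fixed for \<open>(\<pi>, v)\<close>.\<close>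

definition valid_choice :: "'x::wellorder set \<Rightarrow> 'o::wellorder set \<Rightarrow> ('o \<Rightarrow> nat) \<Rightarrow>
    (('x option, 'o) oword \<Rightarrow> ('x, 'o) oword \<Rightarrow> ('x option, 'o) oword \<times> ('x, 'o) oword) \<Rightarrow> bool"
  where
  "valid_choice X Om ar ch \<longleftrightarrow>
     (\<forall>\<pi>\<in>star_words X Om ar. \<forall>v\<in>oalsw X Om ar. plug \<pi> v \<in> oalsw X Om ar \<longrightarrow>
        admissible X Om ar \<pi> v (fst (ch \<pi> v)) (snd (ch \<pi> v)))"

definition alsw_factors :: "'x::wellorder set \<Rightarrow> 'o::wellorder set \<Rightarrow> ('o \<Rightarrow> nat) \<Rightarrow>
    ('x, 'o) oword \<Rightarrow> ('x, 'o) oword list" where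
  "alsw_factors X Om ar c = (THE cs. concat cs = c \<and> set cs \<subseteq> oalsw X Om ar \<and>
     (\<forall>t. Suc t < length cs \<longrightarrow> lex_ge prime_gt (cs ! Suc t) (cs ! t)))"

text \<open>
  The bracketed \<open>\<star>\<close>-word \<open>D\<close> for which \<open>[\<pi>|\<^sub>v]\<^sub>v\<close> is \<open>D\<close> with \<open>[v]\<close> in place of \<open>\<star>\<close>: the
  factor \<open>[vc]\<close> of \<open>[\<pi>|\<^sub>v]\<close> is replaced by \<open>[\<cdots>[[\<star>[c\<^sub>1]][c\<^sub>2]]\<cdots>[c\<^sub>m]]\<close>.
\<close>

definition special_bracketing :: "'x::wellorder set \<Rightarrow> 'o::wellorder set \<Rightarrow> ('o \<Rightarrow> nat) \<Rightarrow>
    (('x option, 'o) oword \<Rightarrow> ('x, 'o) oword \<Rightarrow> ('x option, 'o) oword \<times> ('x, 'o) oword) \<Rightarrow>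
    ('x option, 'o) oword \<Rightarrow> ('x, 'o) oword \<Rightarrow> ('x option, 'o) naword" where
  "special_bracketing X Om ar ch \<pi> v =
     (let (\<pi>1, c) = ch \<pi> v;
          C = (THE C. star_bracketing v \<pi>1 c (plug \<pi> v) C)
      in plug_star_na C
           (foldl NBr (NVar None)
             (map (\<lambda>d. map_naword Some id (bracket d)) (alsw_factors X Om ar c))))"

definition special_normal :: "'x::wellorder set \<Rightarrow> 'o::wellorder set \<Rightarrow> ('o \<Rightarrow> nat) \<Rightarrow>
    (('x option, 'o) oword \<Rightarrow> ('x, 'o) oword \<Rightarrow> ('x option, 'o) oword \<times> ('x, 'o) oword) \<Rightarrow>
    ('x option, 'o) oword \<Rightarrow> ('x, 'o, 'k::field) oalg \<Rightarrow> ('x, 'o, 'k) oalg" where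
  "special_normal X Om ar ch \<pi> f =
     eval_na (case_option f (\<lambda>x. mon [Var x])) (special_bracketing X Om ar ch \<pi> (lead f))"

section \<open>Compositions and Groebner-Shirshov bases\<close>

inductive composition :: "'x::wellorder set \<Rightarrow> 'o::wellorder set \<Rightarrow> ('o \<Rightarrow> nat) \<Rightarrow>
    (('x option, 'o) oword \<Rightarrow> ('x, 'o) oword \<Rightarrow> ('x option, 'o) oword \<times> ('x, 'o) oword) \<Rightarrow>
    ('x, 'o, 'k::field) oalg \<Rightarrow> ('x, 'o, 'k) oalg \<Rightarrow> ('x, 'o) oword \<Rightarrow> ('x, 'o, 'k) oalg \<Rightarrow> bool"
  for X Om ar ch f g where
  intersection: "a \<in> owords X Om ar \<Longrightarrow> b \<in> owords X Om ar \<Longrightarrow>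
    w = lead f @ a \<Longrightarrow> w = b @ lead g \<Longrightarrow> length w < length (lead f) + length (lead g) \<Longrightarrow>
    composition X Om ar ch f g w
      (special_normal X Om ar ch (star @ lift_word a) f
       - special_normal X Om ar ch (lift_word b @ star) g)"
| inclusion: "\<pi> \<in> star_words X Om ar \<Longrightarrow> w = lead f \<Longrightarrow> w = plug \<pi> (lead g) \<Longrightarrow>
    composition X Om ar ch f g w (f - special_normal X Om ar ch \<pi> g)"

definition trivial_mod :: "'x::wellorder set \<Rightarrow> 'o::wellorder set \<Rightarrow> ('o \<Rightarrow> nat) \<Rightarrow>
    (('x option, 'o) oword \<Rightarrow> ('x, 'o) oword \<Rightarrow> ('x option, 'o) oword \<times> ('x, 'o) oword) \<Rightarrow>
    ('x, 'o, 'k::field) oalg set \<Rightarrow> ('x, 'o) oword \<Rightarrow> ('x, 'o, 'k) oalg \<Rightarrow> bool" where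
  "trivial_mod X Om ar ch S w h \<longleftrightarrow>
     (\<exists>ts. (\<forall>(\<alpha>, \<pi>, s)\<in>set ts. s \<in> S \<and> \<pi> \<in> star_words X Om ar \<and>
              plug \<pi> (lead s) \<in> oalsw X Om ar \<and> dl_gt w (plug \<pi> (lead s))) \<and>
           h = (\<Sum>(\<alpha>, \<pi>, s)\<leftarrow>ts. scl \<alpha> (special_normal X Om ar ch \<pi> s)))"

definition groebner_shirshov :: "'x::wellorder set \<Rightarrow> 'o::wellorder set \<Rightarrow> ('o \<Rightarrow> nat) \<Rightarrow>
    (('x option, 'o) oword \<Rightarrow> ('x, 'o) oword \<Rightarrow> ('x option, 'o) oword \<times> ('x, 'o) oword) \<Rightarrow>
    ('x, 'o, 'k::field) oalg set \<Rightarrow> bool" where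
  "groebner_shirshov X Om ar ch S \<longleftrightarrow>
     S \<subseteq> Lie X Om ar \<and> (\<forall>s\<in>S. monic s) \<and>
     (\<forall>f\<in>S. \<forall>g\<in>S. \<forall>w h. composition X Om ar ch f g w h \<longrightarrow> trivial_mod X Om ar ch S w h)"

section \<open>Irreducible words and bases of quotients\<close>

definition Irr :: "'x::wellorder set \<Rightarrow> 'o::wellorder set \<Rightarrow> ('o \<Rightarrow> nat) \<Rightarrow>
    ('x, 'o, 'k::field) oalg set \<Rightarrow> ('x, 'o, 'k) oalg set" where
  "Irr X Om ar S = {lie_elem (bracket w) | w. w \<in> oalsw X Om ar \<and>
     (\<forall>s\<in>S. \<forall>\<pi>\<in>star_words X Om ar. w \<noteq> plug \<pi> (lead s))}"

definition quot_rel :: "('a \<Rightarrow>\<^sub>0 'k::field) set \<Rightarrow> ('a \<Rightarrow>\<^sub>0 'k) set \<Rightarrow> (('a \<Rightarrow>\<^sub>0 'k) \<times> ('a \<Rightarrow>\<^sub>0 'k)) set"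
  where
  "quot_rel A I = {(f, g). f \<in> A \<and> g \<in> A \<and> f - g \<in> I}"

text \<open>
  The quotient space \<open>A / I\<close> is \<open>A // quot_rel A I\<close>. A linear combination of the classes of elements
  of \<open>B\<close> is the class of the linear combination of these elements. The classes are indexed by \<open>B\<close>, so
  distinct elements of \<open>B\<close> must have distinct classes in a basis.
\<close>

definition linear_basis_quot ::
  "('a \<Rightarrow>\<^sub>0 'k::field) set \<Rightarrow> ('a \<Rightarrow>\<^sub>0 'k) set \<Rightarrow> ('a \<Rightarrow>\<^sub>0 'k) set \<Rightarrow> bool" where
  "linear_basis_quot A I B \<longleftrightarrow>
     B \<subseteq> A \<and>
     (\<forall>Q \<in> A // quot_rel A I. \<exists>F c. finite F \<and> F \<subseteq> B \<and>
        Q = quot_rel A I `` {\<Sum>b\<in>F. scl (c b) b}) \<and>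
     (\<forall>F c. finite F \<and> F \<subseteq> B \<and>
        quot_rel A I `` {\<Sum>b\<in>F. scl (c b) b} = quot_rel A I `` {0} \<longrightarrow> (\<forall>b\<in>F. c b = 0))"

end

theory Submission
  imports Defs
begin

text \<open>
  The associative algebra \<open>k\<langle>\<Omega>;X\<rangle>\<close> carries its own, simpler notion of Groebner--Shirshov basis, in which
  the special normal words are replaced by the associative words \<open>\<pi>|\<^sub>s\<close>. A special normal word
  differs from \<open>\<pi>|\<^sub>s\<close> only by associative \<open>s\<close>-words with a smaller leading word, because every
  bracket \<open>[u][v]\<close> occurring in it satisfies \<open>uv > vu\<close>. Hence if all Lie compositions of \<open>S\<close> are
  trivial, then so are the associative ones, and since \<open>Id\<^sub>L\<^sub>i\<^sub>e(S)\<close> lies in the associative ideal of \<open>S\<close>,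
  (ii) follows from the associative Composition-Diamond lemma together with the fact that leading
  words of Lie elements are Lyndon--Shirshov. The remaining implications come from dividing an
  element of \<open>Lie(\<Omega>;X)\<close> by special normal words and irreducible bracketed words.
\<close>

section \<open>Lyndon--Shirshov words\<close>

text \<open>The obstacle is that special normal words are hard to compare with each other: two of
  them with the same leading word come from unrelated bracketings and also depend on the choice
  \<open>ch\<close>. For associative words only the relative position of the two leading words
  matters, and each position is settled by a composition or by bilinear expansion. Little is needed
  about Lyndon words: uniqueness of the standard bracketing and of the factorization of
  \<open>c\<close>, so that the descriptions in the definitions denote something; the inequality uv
  > vu also for the brackets with the factors of \<open>c\<close>; and that the word of an
  intersection composition is Lyndon. Estimates up to smaller words are kept as memberships in spans
  of labelled elements, which survive cancellation. The way back from (ii) is a division with a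
  bound: the irreducible part of an element of the ideal vanishes, since bracketings of distinct
  words have distinct leading words, and what remains is a sum of special normal words bounded by
  the leading word, as triviality modulo \<open>(S, w)\<close> demands.\<close>

lemma append_eq_appendE:
  assumes "u @ v = x @ y"
  obtains (left) z where "u = x @ z" "y = z @ v" "z \<noteq> []" | (right) z where "x = u @ z" "v = z @ y"
proof -
  obtain z where z: "u = x @ z \<and> z @ v = y \<or> u @ z = x \<and> v = z @ y"
    using assms unfolding append_eq_append_conv2 by blast
  show ?thesis
  proof (cases "z = []")
    case True
    then show ?thesis using z right[of "[]"] by auto
  next
    case False
    then show ?thesis using z left[of z] right[of z] by auto
  qed
qed

text \<open>Totality is confined to \<open>A\<close> because raw primes can be incomparable: a
  letter and an operator symbol without arguments both have degree 1, and no rule of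
  \<open>prime_gt\<close> relates them.\<close>

locale order_on =
  fixes gt :: "'a \<Rightarrow> 'a \<Rightarrow> bool" and A :: "'a set"
  assumes gt_irrefl: "\<not> gt a a"
    and gt_trans: "gt a b \<Longrightarrow> gt b c \<Longrightarrow> gt a c"
    and gt_total: "a \<in> A \<Longrightarrow> b \<in> A \<Longrightarrow> a \<noteq> b \<Longrightarrow> gt a b \<or> gt b a"
begin

text \<open>Read as "smaller", \<open>\<sqsubset>\<close> is the usual lexicographic order for the reversed order of letters, and
  \<open>is_alsw\<close> is the usual notion of a Lyndon word.\<close>

abbreviation lexless (infix "\<sqsubset>" 50) where "u \<sqsubset> v \<equiv> lex_gt gt u v"
abbreviation lexleq (infix "\<sqsubseteq>" 50) where "u \<sqsubseteq> v \<equiv> lex_ge gt u v"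

text \<open>The stable part of \<open>\<sqsubset>\<close>: a strict difference at a letter survives
  appending arbitrary words on both sides, whereas being a proper prefix does not.\<close>

definition differ :: "'a list \<Rightarrow> 'a list \<Rightarrow> bool" where
  "differ u v \<longleftrightarrow> (\<exists>p a b u' v'. u = p @ a # u' \<and> v = p @ b # v' \<and> gt a b)"

lemma lex_irrefl [simp]: "\<not> u \<sqsubset> u"
  by (induction u) (auto simp: gt_irrefl)

lemma lex_trans: "u \<sqsubset> v \<Longrightarrow> v \<sqsubset> w \<Longrightarrow> u \<sqsubset> w"
proof (induction u arbitrary: v w)
  case Nil
  then show ?case by (cases v; cases w) auto
next
  case (Cons a u)
  then show ?case by (cases v; cases w) (auto intro: gt_trans)
qed

lemma lex_total: "set u \<subseteq> A \<Longrightarrow> set v \<subseteq> A \<Longrightarrow> u \<noteq> v \<Longrightarrow> u \<sqsubset> v \<or> v \<sqsubset> u"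
proof (induction u arbitrary: v)
  case Nil
  then show ?case by (cases v) auto
next
  case (Cons a u)
  then show ?case using gt_total[of a "hd v"] by (cases v) auto
qed

lemma lex_append [simp]: "x @ u \<sqsubset> x @ v \<longleftrightarrow> u \<sqsubset> v"
  by (induction x) (auto simp: gt_irrefl)

lemma lex_prefix [simp]: "u \<sqsubset> u @ v \<longleftrightarrow> v \<noteq> []"
  using lex_append[of u "[]" v] by (cases v) auto

lemma Nil_lex [simp]: "[] \<sqsubset> u \<longleftrightarrow> u \<noteq> []"
  by (cases u) auto

lemma lex_cases: "u \<sqsubset> v \<longleftrightarrow> (\<exists>t. t \<noteq> [] \<and> v = u @ t) \<or> differ u v"
proof
  show "u \<sqsubset> v \<Longrightarrow> (\<exists>t. t \<noteq> [] \<and> v = u @ t) \<or> differ u v"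
  proof (induction u arbitrary: v)
    case Nil
    then show ?case by simp
  next
    case (Cons a u)
    then obtain b v' where v: "v = b # v'" by (cases v) auto
    show ?case
    proof (cases "gt a b")
      case True
      then have "differ (a # u) v" unfolding v differ_def by (metis append_Nil)
      then show ?thesis ..
    next
      case False
      then have ab: "a = b" "u \<sqsubset> v'" using Cons.prems v by auto
      from Cons.IH[OF ab(2)] show ?thesis
      proof
        assume "differ u v'"
        then have "differ (a # u) v" unfolding v ab(1) differ_def by (metis append_Cons)
        then show ?thesis ..
      qed (auto simp: v ab)
    qed
  qed
next
  assume "(\<exists>t. t \<noteq> [] \<and> v = u @ t) \<or> differ u v"
  then show "u \<sqsubset> v" by (auto simp: differ_def)
qed

lemma differ_append: "differ u v \<Longrightarrow> u @ x \<sqsubset> v @ y"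
  by (auto simp: differ_def)

lemma differ_longer: "u \<sqsubset> v \<Longrightarrow> length v \<le> length u \<Longrightarrow> differ u v"
  by (auto simp: lex_cases)

lemma lex_append_longer: "u \<sqsubset> v \<Longrightarrow> length v \<le> length u \<Longrightarrow> u @ x \<sqsubset> v @ y"
  using differ_longer differ_append by blast

lemma lex_asym: "u \<sqsubset> v \<Longrightarrow> \<not> v \<sqsubset> u"
  using lex_trans lex_irrefl by blast

lemma lexleq_refl [simp]: "u \<sqsubseteq> u"
  by (simp add: lex_ge_def)

lemma lexleq_trans: "u \<sqsubseteq> v \<Longrightarrow> v \<sqsubseteq> w \<Longrightarrow> u \<sqsubseteq> w"
  by (auto simp: lex_ge_def intro: lex_trans)

lemma lex_leq_trans: "u \<sqsubset> v \<Longrightarrow> v \<sqsubseteq> w \<Longrightarrow> u \<sqsubset> w"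
  by (auto simp: lex_ge_def intro: lex_trans)

lemma leq_lex_trans: "u \<sqsubseteq> v \<Longrightarrow> v \<sqsubset> w \<Longrightarrow> u \<sqsubset> w"
  by (auto simp: lex_ge_def intro: lex_trans)

lemma lexleq_prefix [simp]: "u \<sqsubseteq> u @ v"
  by (simp add: lex_ge_def)

lemma not_lex: "set u \<subseteq> A \<Longrightarrow> set v \<subseteq> A \<Longrightarrow> \<not> u \<sqsubset> v \<longleftrightarrow> v \<sqsubseteq> u"
  using lex_total lex_asym by (auto simp: lex_ge_def)

lemma lexleq_antisym: "u \<sqsubseteq> v \<Longrightarrow> v \<sqsubseteq> u \<Longrightarrow> u = v"
  using lex_asym by (auto simp: lex_ge_def)

section \<open>Lyndon words and their proper suffixes\<close>

lemma alsw_suffixI: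
  assumes "w \<noteq> []" and suf: "\<And>u v. w = u @ v \<Longrightarrow> u \<noteq> [] \<Longrightarrow> v \<noteq> [] \<Longrightarrow> w \<sqsubset> v"
  shows "is_alsw gt w"
  unfolding is_alsw_def
proof (intro conjI allI impI)
  fix u v assume w: "w = u @ v \<and> u \<noteq> [] \<and> v \<noteq> []"
  then have "w \<sqsubset> v" using suf by blast
  then have "w @ [] \<sqsubset> v @ u" using w by (intro lex_append_longer) auto
  then show "u @ v \<sqsubset> v @ u" using w by simp
qed (fact assms(1))

text \<open>If \<open>v \<sqsubset> w\<close> without a differing letter, then \<open>v\<close> is a
  prefix as well as a suffix, say \<open>w = v @ t\<close>. Cancelling \<open>v\<close> in
  \<open>u @ v \<sqsubset> v @ u\<close> gives \<open>t \<sqsubset> u\<close>, and this contradicts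
  the rotation inequality for the factorization \<open>v @ t\<close>.\<close>

lemma alsw_suffixD:
  assumes w: "is_alsw gt w" and A: "set w \<subseteq> A" and uv: "w = u @ v" "u \<noteq> []" "v \<noteq> []"
  shows "w \<sqsubset> v"
proof (rule ccontr)
  assume "\<not> w \<sqsubset> v"
  moreover have "v \<noteq> w" using uv by simp
  ultimately have vw: "v \<sqsubset> w" using lex_total[of v w] A uv by auto
  have conj: "u @ v \<sqsubset> v @ u" using w uv unfolding is_alsw_def by blast
  show False
  proof (cases "differ v w")
    case True
    then have "v @ u \<sqsubset> w @ []" by (rule differ_append)
    then show False using conj uv lex_asym by simp
  next
    case False
    then obtain t where t: "t \<noteq> []" "w = v @ t" using vw lex_cases by blast
    have "t \<sqsubset> u" using conj t uv by simp
    moreover have "length t = length u" using t uv by (metis add_diff_cancel_left' add_diff_cancel_right' length_append)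
    ultimately have "t @ v \<sqsubset> u @ v" by (intro lex_append_longer) auto
    moreover have "v @ t \<sqsubset> t @ v" using w t uv unfolding is_alsw_def by blast
    ultimately show False using t uv lex_asym by simp
  qed
qed

lemma alsw_nonempty: "is_alsw gt w \<Longrightarrow> w \<noteq> []"
  by (simp add: is_alsw_def)

lemma alsw_single [simp]: "is_alsw gt [a]"
  by (auto simp: is_alsw_def Cons_eq_append_conv)

text \<open>Suffixes starting inside \<open>u\<close> exceed \<open>u @ v\<close> because
  \<open>u\<close> is Lyndon; the later ones are suffixes of \<open>v\<close>, so it remains to see
  \<open>u @ v \<sqsubset> v\<close>. If \<open>v = u @ t\<close>, this reduces to
  \<open>v \<sqsubset> t\<close>, which holds as \<open>v\<close> is Lyndon.\<close>

lemma alsw_append: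
  assumes u: "is_alsw gt u" and v: "is_alsw gt v" and uv: "u \<sqsubset> v"
    and A: "set u \<subseteq> A" "set v \<subseteq> A"
  shows "is_alsw gt (u @ v)"
proof (rule alsw_suffixI)
  show "u @ v \<noteq> []" using u by (simp add: is_alsw_def)
  have step: "u @ v \<sqsubset> v"
  proof (cases "differ u v")
    case True
    from differ_append[OF this, of v "[]"] show ?thesis by simp
  next
    case False
    then obtain t where t: "t \<noteq> []" "v = u @ t" using uv lex_cases by blast
    have "v \<sqsubset> t" using alsw_suffixD[OF v A(2) t(2)] t alsw_nonempty[OF u] by blast
    then show ?thesis using t by simp
  qed
  fix x y assume xy: "u @ v = x @ y" "x \<noteq> []" "y \<noteq> []"
  from xy(1) consider (l) z where "u = x @ z" "y = z @ v" "z \<noteq> []" | (e) "x = u" "y = v"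
    | (r) z where "x = u @ z" "v = z @ y" "z \<noteq> []"
    by (metis append_eq_appendE append_Nil append_Nil2)
  then show "u @ v \<sqsubset> y"
  proof cases
    case l
    then have "u \<sqsubset> z" using alsw_suffixD[OF u A(1)] xy by blast
    then show ?thesis using l(1,2) lex_append_longer[of u z v v] by simp
  next
    case e
    then show ?thesis using step by simp
  next
    case r
    then have "v \<sqsubset> y" using alsw_suffixD[OF v A(2)] xy by blast
    then show ?thesis using step lex_trans by blast
  qed
qed

lemma alsw_append_lex:
  assumes uv: "is_alsw gt (u @ v)" and ne: "u \<noteq> []" "v \<noteq> []"
    and A: "set u \<subseteq> A" "set v \<subseteq> A"
  shows "u \<sqsubset> v"
proof -
  have "u @ v \<sqsubset> v" using alsw_suffixD[OF uv] ne A by simp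
  moreover have "u \<sqsubset> u @ v" using ne by simp
  ultimately show ?thesis by (blast intro: lex_trans)
qed

text \<open>Meant for the word of an intersection composition. Suffixes starting inside
  \<open>x\<close> are handled by \<open>x @ y\<close>, all later ones by \<open>y @ z\<close>, and
  \<open>x @ y \<sqsubset> y\<close> links the two ranges.\<close>

lemma alsw_overlap:
  assumes xy: "is_alsw gt (x @ y)" and yz: "is_alsw gt (y @ z)"
    and ne: "x \<noteq> []" "y \<noteq> []" "z \<noteq> []"
    and A: "set x \<subseteq> A" "set y \<subseteq> A" "set z \<subseteq> A"
  shows "is_alsw gt (x @ y @ z)"
proof (rule alsw_suffixI)
  show "x @ y @ z \<noteq> []" using ne by simp
  have "x @ y \<sqsubset> y" using alsw_suffixD[OF xy] ne A by simp
  then have step: "x @ y @ z \<sqsubset> y @ z"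
    using lex_append_longer[of "x @ y" y z z] by simp
  fix p q assume pq: "x @ y @ z = p @ q" "p \<noteq> []" "q \<noteq> []"
  from pq(1) consider (l) t where "x = p @ t" "q = t @ y @ z" "t \<noteq> []" | (e) "p = x" "q = y @ z"
    | (r) t where "p = x @ t" "y @ z = t @ q" "t \<noteq> []"
    by (metis append_eq_appendE append_Nil append_Nil2)
  then show "x @ y @ z \<sqsubset> q"
  proof cases
    case l
    then have "x @ y \<sqsubset> t @ y" using alsw_suffixD[OF xy, of p "t @ y"] pq A by simp
    then show ?thesis using lex_append_longer[of "x @ y" "t @ y" z z] l by simp
  next
    case e
    then show ?thesis using step by simp
  next
    case r
    then have "y @ z \<sqsubset> q" using alsw_suffixD[OF yz _ r(2,3) pq(3)] A by (metis le_sup_iff set_append)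
    then show ?thesis using step lex_trans by blast
  qed
qed

section \<open>Least suffixes, longest Lyndon suffixes and the standard bracketing\<close>

lemma ex_min_suffix:
  assumes "x \<noteq> []" "set x \<subseteq> A"
  shows "\<exists>p m. x = p @ m \<and> m \<noteq> [] \<and> (\<forall>q s. x = q @ s \<and> s \<noteq> [] \<longrightarrow> m \<sqsubseteq> s)"
  using assms
proof (induction x)
  case (Cons a x)
  show ?case
  proof (cases "x = []")
    case True
    then show ?thesis by (intro exI[of _ "[]"] exI[of _ "[a]"]) (auto simp: Cons_eq_append_conv)
  next
    case False
    then obtain p m where pm: "x = p @ m" "m \<noteq> []" "\<forall>q s. x = q @ s \<and> s \<noteq> [] \<longrightarrow> m \<sqsubseteq> s"
      using Cons by auto
    show ?thesis
    proof (cases "m \<sqsubseteq> a # x")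
      case True
      then show ?thesis using pm by (intro exI[of _ "a # p"] exI[of _ m]) (auto simp: Cons_eq_append_conv)
    next
      case False
      then have "a # x \<sqsubset> m" using not_lex[of "a # x" m] Cons.prems pm(1) by auto
      then have "a # x \<sqsubseteq> s" if "x = q @ s" "s \<noteq> []" for q s
        using pm(3) that lex_leq_trans by (metis lex_ge_def)
      then show ?thesis using pm by (intro exI[of _ "[]"] exI[of _ "a # x"]) (auto simp: Cons_eq_append_conv)
    qed
  qed
qed simp

lemma min_suffix_alsw:
  assumes "x = p @ m" "m \<noteq> []" "\<forall>q s. x = q @ s \<and> s \<noteq> [] \<longrightarrow> m \<sqsubseteq> s"
  shows "is_alsw gt m"
proof (rule alsw_suffixI[OF assms(2)])
  fix u v assume "m = u @ v" "u \<noteq> []" "v \<noteq> []"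
  then show "m \<sqsubset> v" using assms(1,3) by (metis append.assoc lex_ge_def self_append_conv2)
qed

definition longest_alsw_suffix :: "'a list \<Rightarrow> 'a list \<Rightarrow> bool" where
  "longest_alsw_suffix x l \<longleftrightarrow> is_alsw gt l \<and> (\<exists>p. x = p @ l) \<and>
     (\<forall>p l'. x = p @ l' \<and> is_alsw gt l' \<longrightarrow> length l' \<le> length l)"

text \<open>The least suffix \<open>m\<close> of \<open>x\<close> is Lyndon, so it is a suffix of
  \<open>l\<close>; were it a proper one, the Lyndon word \<open>l\<close> would be smaller than
  \<open>m\<close>. Thus the longest Lyndon suffix is the least suffix.\<close>

lemma longest_alsw_suffix_leq:
  assumes l: "longest_alsw_suffix x l" and A: "set x \<subseteq> A"
  shows "l \<sqsubseteq> x"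
proof -
  obtain p0 where p0: "x = p0 @ l" and ll: "is_alsw gt l"
    using l unfolding longest_alsw_suffix_def by blast
  have ne: "x \<noteq> []" using p0 alsw_nonempty[OF ll] by simp
  obtain p m where pm: "x = p @ m" "m \<noteq> []" "\<forall>q s. x = q @ s \<and> s \<noteq> [] \<longrightarrow> m \<sqsubseteq> s"
    using ex_min_suffix[OF ne A] by blast
  have "is_alsw gt m" using min_suffix_alsw[OF pm] .
  then have "length m \<le> length l" using l pm unfolding longest_alsw_suffix_def by blast
  then obtain t where t: "l = t @ m" using pm p0 by (auto simp: append_eq_append_conv2)
  have "m \<sqsubseteq> l" using pm p0 ll alsw_nonempty by blast
  have "t = []"
  proof (rule ccontr)
    assume "t \<noteq> []"
    moreover have "set l \<subseteq> A" using p0 A by auto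
    ultimately have "l \<sqsubset> m" using alsw_suffixD[OF ll _ t] pm(2) by blast
    with \<open>m \<sqsubseteq> l\<close> show False using leq_lex_trans lex_irrefl by blast
  qed
  with t pm(3) ne show ?thesis by auto
qed

lemma ex_longest_proper_alsw_suffix:
  assumes "length u \<ge> 2"
  shows "\<exists>x v. u = x @ v \<and> x \<noteq> [] \<and> is_alsw gt v \<and>
    (\<forall>x' v'. u = x' @ v' \<and> x' \<noteq> [] \<and> is_alsw gt v' \<longrightarrow> length v' \<le> length v)"
proof -
  let ?P = "\<lambda>v. \<exists>x. u = x @ v \<and> x \<noteq> [] \<and> is_alsw gt v"
  have "u = butlast u @ [last u]" "butlast u \<noteq> []"
    using assms by (cases u rule: rev_cases, auto)+
  then have 1: "?P [last u]" by (metis alsw_single)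
  have 2: "\<forall>v. ?P v \<longrightarrow> length v < Suc (length u)" by auto
  obtain v where v: "?P v" "\<forall>v'. ?P v' \<longrightarrow> length v' \<le> length v"
    using ex_has_greatest_nat[where P = ?P and f = length, OF 1 2] by (rule exE) (erule conjE)
  from v(1) obtain x where "u = x @ v" "x \<noteq> []" "is_alsw gt v" by (elim exE conjE)
  then show ?thesis using v(2) by metis
qed

text \<open>The least suffix \<open>m\<close> of \<open>u\<close> is Lyndon. If it were proper,
  \<open>m \<sqsubset> v\<close> would make \<open>m @ v\<close> a longer Lyndon suffix than
  \<open>v\<close>, while \<open>v \<sqsubseteq> m\<close> is refuted by
  \<open>m \<sqsubseteq> u \<sqsubset> u @ v \<sqsubset> v\<close>.\<close>

lemma std_left_alsw:
  assumes uv: "is_alsw gt (u @ v)" and u: "u \<noteq> []" and v: "is_alsw gt v"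
    and longest: "\<forall>x' v'. u @ v = x' @ v' \<and> x' \<noteq> [] \<and> is_alsw gt v' \<longrightarrow> length v' \<le> length v"
    and A: "set u \<subseteq> A" "set v \<subseteq> A"
  shows "is_alsw gt u"
proof -
  obtain p m where pm: "u = p @ m" "m \<noteq> []" "\<forall>q s. u = q @ s \<and> s \<noteq> [] \<longrightarrow> m \<sqsubseteq> s"
    using ex_min_suffix[OF u A(1)] by blast
  have m: "is_alsw gt m" using min_suffix_alsw[OF pm] .
  have "p = []"
  proof (rule ccontr)
    assume p: "p \<noteq> []"
    have "\<not> m \<sqsubset> v"
    proof
      assume "m \<sqsubset> v"
      then have "is_alsw gt (m @ v)" using alsw_append[OF m v] A pm by simp
      then show False using longest[rule_format, of p "m @ v"] p pm by simp
    qed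
    then have "v \<sqsubseteq> m" using not_lex[of m v] A pm by simp
    moreover have "u @ v \<sqsubset> v" using alsw_suffixD[OF uv _ refl] u alsw_nonempty[OF v] A by simp
    moreover have "m \<sqsubseteq> u" using pm u by blast
    moreover have "u \<sqsubset> u @ v" using alsw_nonempty[OF v] by simp
    ultimately show False by (meson leq_lex_trans lex_irrefl lex_leq_trans lex_trans)
  qed
  then show ?thesis using pm m by simp
qed

lemma leaves_nonempty [simp]: "leaves t \<noteq> []"
  by (induction t) auto

lemma nlsw_alsw: "is_nlsw gt t \<Longrightarrow> is_alsw gt (leaves t)"
  by (cases t) auto

text \<open>A longer Lyndon suffix has the form \<open>z @ leaves t\<close> with
  \<open>z \<sqsubset> leaves t\<close>. The standard condition gives
  \<open>leaves t \<sqsubseteq> leaves s2\<close>, so \<open>leaves s2 \<sqsubseteq> z\<close>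
  yields a contradiction. The split is thereby determined by the word, which makes standard
  bracketings unique.\<close>

lemma nlsw_right_longest:
  assumes "is_nlsw gt (Branch s t)" "set (leaves (Branch s t)) \<subseteq> A"
    and "leaves (Branch s t) = x @ y" "x \<noteq> []" "is_alsw gt y"
  shows "length y \<le> length (leaves t)"
  using assms
proof (induction s arbitrary: t x y)
  case (Leaf a)
  then show ?case by (cases x) auto
next
  case (Branch s1 s2)
  let ?w = "leaves t"
  show ?case
  proof (rule ccontr)
    assume "\<not> length y \<le> length ?w"
    then obtain z where z: "y = z @ ?w" "z \<noteq> []" "leaves (Branch s1 s2) = x @ z"
      using append_eq_appendE[of "leaves (Branch s1 s2)" ?w x y] Branch.prems(3)
      by (metis le_cases length_append le_add2 leaves.simps(2))
    have s: "is_nlsw gt (Branch s1 s2)" and w_s2: "?w \<sqsubseteq> leaves s2"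
      and A: "set (leaves (Branch s1 s2)) \<subseteq> A" using Branch.prems(1,2) by auto
    have zA: "set z \<subseteq> A" "set ?w \<subseteq> A" using z(3) A Branch.prems(2) by auto
    have zw: "z \<sqsubset> ?w" using alsw_append_lex[of z ?w] Branch.prems(5) z zA by auto
    have al2: "is_alsw gt (leaves s2)" using s nlsw_alsw by auto
    have "leaves s2 \<sqsubseteq> z"
    proof (cases "length z < length (leaves s2)")
      case True
      then obtain q where "leaves s2 = q @ z" "q \<noteq> []"
        using z(3) by (elim append_eq_appendE[of "leaves s1" "leaves s2" x z, unfolded leaves.simps[symmetric]]) auto
      then show ?thesis using alsw_suffixD[OF al2] z(2) A by (auto simp: lex_ge_def)
    next
      case False
      then obtain q where q: "z = q @ leaves s2"
        using z(3) append_eq_appendE[of "leaves s1" "leaves s2" x z] by (metis False leaves.simps(2) length_append less_add_same_cancel2 length_greater_0_conv append_Nil)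
      \<comment> \<open>Since \<open>x\<close> is nonempty, Lyndon suffixes of \<open>z\<close> are
        proper suffixes of the word of the left subtree, so the induction hypothesis for
        \<open>Branch s1 s2\<close> bounds their length.\<close>
      have "longest_alsw_suffix z (leaves s2)" unfolding longest_alsw_suffix_def
      proof (intro conjI allI impI)
        fix p l' assume "z = p @ l' \<and> is_alsw gt l'"
        then show "length l' \<le> length (leaves s2)"
          using Branch.IH(1)[OF s A, of "x @ p" l'] z(3) Branch.prems(4) by simp
      qed (use al2 q in auto)
      then show ?thesis using longest_alsw_suffix_leq zA by blast
    qed
    then show False using w_s2 zw lexleq_trans lex_leq_trans leq_lex_trans lex_irrefl by meson
  qed
qed

lemma nlsw_unique:
  assumes "is_nlsw gt s" "is_nlsw gt t" "leaves s = leaves t" "set (leaves s) \<subseteq> A"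
  shows "s = t"
  using assms
proof (induction s arbitrary: t)
  case (Leaf a)
  then show ?case by (cases t) (auto simp: Cons_eq_append_conv)
next
  case (Branch s1 s2)
  obtain t1 t2 where t: "t = Branch t1 t2"
    using Branch.prems(3) by (cases t) (auto simp: append_eq_Cons_conv)
  have eq: "leaves s1 @ leaves s2 = leaves t1 @ leaves t2" using Branch.prems(3) t by simp
  have sub: "is_nlsw gt s1" "is_nlsw gt s2" "is_nlsw gt t1" "is_nlsw gt t2"
    using Branch.prems(1,2) t by simp_all
  have A: "set (leaves (Branch t1 t2)) \<subseteq> A" using Branch.prems(3,4) t by simp
  have "length (leaves s2) \<le> length (leaves t2)"
    by (rule nlsw_right_longest[OF Branch.prems(2)[unfolded t] A, of "leaves s1"])
      (simp_all add: eq sub nlsw_alsw)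
  moreover have "length (leaves t2) \<le> length (leaves s2)"
    by (rule nlsw_right_longest[OF Branch.prems(1,4), of "leaves t1"])
      (simp_all add: eq sub nlsw_alsw)
  ultimately have "leaves s1 = leaves t1" "leaves s2 = leaves t2"
    using eq by simp_all
  then show ?case using Branch.IH(1)[OF sub(1,3)] Branch.IH(2)[OF sub(2,4)] Branch.prems(4) t by simp
qed

lemma ex_nlsw:
  assumes "is_alsw gt u" "set u \<subseteq> A"
  shows "\<exists>t. is_nlsw gt t \<and> leaves t = u"
  using assms
proof (induction u rule: length_induct)
  case (1 u)
  show ?case
  proof (cases "length u \<ge> 2")
    case False
    then obtain a where "u = [a]" using alsw_nonempty[OF 1(2)] by (cases u; cases "tl u") auto
    then show ?thesis by (intro exI[of _ "Leaf a"]) auto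
  next
    case True
    then obtain x v where v: "u = x @ v" "x \<noteq> []" "is_alsw gt v"
      and longest: "\<forall>x' v'. u = x' @ v' \<and> x' \<noteq> [] \<and> is_alsw gt v' \<longrightarrow> length v' \<le> length v"
      using ex_longest_proper_alsw_suffix[OF True] by (elim exE conjE)
    have x: "is_alsw gt x" using std_left_alsw[of x v] v longest 1 by auto
    have A: "set x \<subseteq> A" "set v \<subseteq> A" using v 1 by auto
    have vne: "v \<noteq> []" using v alsw_nonempty by blast
    obtain s where s: "is_nlsw gt s" "leaves s = x" using 1(1)[rule_format, of x] x A v(1) vne by auto
    obtain t where t: "is_nlsw gt t" "leaves t = v" using 1(1)[rule_format, of v] v A by auto
    \<comment> \<open>The remaining condition on standard bracketings: its failure would make
      \<open>leaves s2 @ v\<close> a longer proper Lyndon suffix of \<open>u\<close>.\<close>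
    have "lex_ge gt v (leaves s2)" if "s = Branch s1 s2" for s1 s2
    proof (rule ccontr)
      assume "\<not> lex_ge gt v (leaves s2)"
      moreover have sA: "set (leaves s2) \<subseteq> A" using that s A by auto
      ultimately have "leaves s2 \<sqsubset> v" using not_lex[of "leaves s2" v] A by blast
      then have "is_alsw gt (leaves s2 @ v)"
        using alsw_append[of "leaves s2" v] v s that nlsw_alsw sA A by auto
      then have "length (leaves s2 @ v) \<le> length v"
        using longest v s that by (metis append.assoc leaves.simps(2) leaves_nonempty)
      then show False by simp
    qed
    then have "is_nlsw gt (Branch s t)" using s t v 1 by auto
    then show ?thesis using s t v by (intro exI[of _ "Branch s t"]) auto
  qed
qed

lemma shirshov:
  assumes "is_alsw gt u" "set u \<subseteq> A"
  shows "is_nlsw gt (shirshov gt u)" "leaves (shirshov gt u) = u"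
proof -
  have "\<exists>!t. is_nlsw gt t \<and> leaves t = u"
    using ex_nlsw[OF assms] nlsw_unique assms(2) by (metis (no_types, lifting))
  from theI'[OF this] show "is_nlsw gt (shirshov gt u)" "leaves (shirshov gt u) = u"
    unfolding shirshov_def by auto
qed

lemma shirshov_leaves:
  assumes "is_nlsw gt t" "set (leaves t) \<subseteq> A"
  shows "shirshov gt (leaves t) = t"
  using nlsw_unique[of "shirshov gt (leaves t)" t] shirshov[of "leaves t"] assms nlsw_alsw by auto

section \<open>Factorization into non-increasing Lyndon words (Chen, Fox and Lyndon)\<close>

definition lyndon_factors :: "'a list list \<Rightarrow> bool" where
  "lyndon_factors cs \<longleftrightarrow> (\<forall>c\<in>set cs. is_alsw gt c) \<and>
     (\<forall>t. Suc t < length cs \<longrightarrow> cs ! Suc t \<sqsubseteq> cs ! t)"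

text \<open>A factorization with the fewest Lyndon factors works, because neighbours
  \<open>x \<sqsubset> y\<close> could be merged into the Lyndon word \<open>x @ y\<close>. The
  factorization into letters starts the minimization.\<close>

lemma ex_lyndon_factors:
  assumes "set c \<subseteq> A"
  shows "\<exists>cs. concat cs = c \<and> lyndon_factors cs"
proof -
  let ?P = "\<lambda>cs. concat cs = c \<and> (\<forall>d\<in>set cs. is_alsw gt d)"
  have "?P (map (\<lambda>a. [a]) c)" by simp
  from ex_has_least_nat[where P = ?P and m = length, OF this]
  obtain cs where cs: "?P cs" "\<And>ds. ?P ds \<Longrightarrow> length cs \<le> length ds"
    by (elim exE conjE) blast
  have "cs ! Suc t \<sqsubseteq> cs ! t" if t: "Suc t < length cs" for t
  proof (rule ccontr)
    let ?x = "cs ! t" and ?y = "cs ! Suc t"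
    let ?ds = "take t cs @ [?x @ ?y] @ drop (Suc (Suc t)) cs"
    have split: "cs = take t cs @ [?x, ?y] @ drop (Suc (Suc t)) cs"
      using t by (simp add: Cons_nth_drop_Suc)
    have mem: "?x \<in> set cs" "?y \<in> set cs" using t by auto
    then have A: "set ?x \<subseteq> A" "set ?y \<subseteq> A" using assms cs(1) by (metis UN_subset_iff set_concat)+
    assume "\<not> ?y \<sqsubseteq> ?x"
    then have "?x \<sqsubset> ?y" using not_lex A by blast
    then have "is_alsw gt (?x @ ?y)" using alsw_append A cs(1) mem by blast
    moreover have "concat ?ds = concat cs" using arg_cong[OF split, of concat] by simp
    moreover have "set (take t cs) \<subseteq> set cs" "set (drop (Suc (Suc t)) cs) \<subseteq> set cs"
      by (auto dest: in_set_takeD in_set_dropD)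
    ultimately have "?P ?ds" using cs(1) by auto
    then have "length cs \<le> length ?ds" by (rule cs(2))
    then show False using t by simp
  qed
  then show ?thesis using cs(1) unfolding lyndon_factors_def by blast
qed

lemma lyndon_factors_mono:
  assumes "lyndon_factors cs" "i \<le> j" "j < length cs"
  shows "cs ! j \<sqsubseteq> cs ! i"
  using assms(2,3)
proof (induction j rule: dec_induct)
  case (step n)
  then show ?case using assms(1) lexleq_trans unfolding lyndon_factors_def by (meson Suc_lessD)
qed simp

text \<open>A nonempty suffix starts inside some factor \<open>c\<close>, with a part
  \<open>r\<close> of it; then \<open>last cs \<sqsubseteq> c \<sqsubseteq> r\<close>, and
  \<open>r\<close> is a prefix of the suffix. Being least determines the last factor, and so
  inductively the whole factorization.\<close>

lemma lyndon_factors_last_min: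
  assumes cs: "lyndon_factors cs" and A: "set (concat cs) \<subseteq> A"
    and s: "concat cs = q @ s" "s \<noteq> []"
  shows "last cs \<sqsubseteq> s"
  using assms
proof (induction cs arbitrary: q)
  case (Cons c cs)
  have c: "is_alsw gt c" and cs: "lyndon_factors cs"
    using Cons.prems(1) unfolding lyndon_factors_def
     apply simp
    using Cons.prems(1) unfolding lyndon_factors_def
    by (metis Suc_less_eq length_Cons list.set_intros(2) nth_Cons_Suc)
  have last: "last (c # cs) \<sqsubseteq> c"
    using lyndon_factors_mono[OF Cons.prems(1), of 0 "length cs"] by (simp add: last_conv_nth nth_Cons' split: if_splits)
  show ?case
  proof (cases "length s \<le> length (concat cs)")
    case True
    have "c @ concat cs = q @ s" using Cons.prems(3) by simp
    then obtain r where r: "concat cs = r @ s"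
    proof (cases rule: append_eq_appendE)
      case (left z)
      then show ?thesis using True that[of "[]"] by simp
    qed (use that in blast)
    then have "cs \<noteq> []" using Cons.prems(4) by auto
    then show ?thesis using Cons.IH[OF cs _ r Cons.prems(4)] Cons.prems(2) by simp
  next
    case False
    have "c @ concat cs = q @ s" using Cons.prems(3) by simp
    then obtain r where r: "s = r @ concat cs" "c = q @ r" "r \<noteq> []"
      by (cases rule: append_eq_appendE) (use False in auto)
    have "c \<sqsubseteq> r"
      using alsw_suffixD[OF c _ r(2) _ r(3)] Cons.prems(2) r(2) by (cases "q = []") (auto simp: lex_ge_def)
    then show ?thesis using last r(1) lexleq_trans lexleq_prefix by metis
  qed
qed simp

lemma lyndon_factors_butlast: "lyndon_factors (cs @ [c]) \<Longrightarrow> lyndon_factors cs"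
  unfolding lyndon_factors_def
  by (metis (no_types, lifting) Suc_lessD UnI1 less_SucI length_append_singleton nth_append set_append)

lemma lyndon_factors_unique:
  assumes "lyndon_factors cs" "lyndon_factors ds" "concat cs = concat ds" "set (concat cs) \<subseteq> A"
  shows "cs = ds"
  using assms
proof (induction cs arbitrary: ds rule: rev_induct)
  case Nil
  then have "\<forall>d\<in>set ds. d = []" "\<forall>d\<in>set ds. d \<noteq> []"
    using alsw_nonempty unfolding lyndon_factors_def by auto
  then show ?case by (cases ds) auto
next
  case (snoc c cs)
  have c: "c \<noteq> []" using snoc.prems(1) alsw_nonempty unfolding lyndon_factors_def by auto
  then have "ds \<noteq> []" using snoc.prems(3) by auto
  then obtain es d where ds: "ds = es @ [d]" by (metis rev_exhaust)
  have d: "d \<noteq> []" using snoc.prems(2) ds alsw_nonempty unfolding lyndon_factors_def by auto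
  have "c \<sqsubseteq> d" using lyndon_factors_last_min[OF snoc.prems(1,4), of "concat es" d] snoc.prems(3) ds d
    by simp
  moreover have "d \<sqsubseteq> c"
    using lyndon_factors_last_min[OF snoc.prems(2), of "concat cs" c] snoc.prems(3,4) ds c by simp
  ultimately have "c = d" by (rule lexleq_antisym)
  moreover from this have "cs = es"
    using snoc.IH[of es] snoc.prems ds lyndon_factors_butlast by auto
  ultimately show ?case using ds by simp
qed

text \<open>For \<open>w = v c\<^sub>1 \<dots> c\<^sub>m\<close> we have \<open>w \<sqsubset> c\<^sub>m \<sqsubseteq> c\<^sub>i\<close>, and since \<open>w\<close> is longer than \<open>c\<^sub>i\<close>, the two words
  differ at a position within \<open>c\<^sub>i\<close>.\<close>

lemma lyndon_factors_rotate:
  assumes vc: "is_alsw gt (v @ concat cs)" and v: "v \<noteq> []"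
    and A: "set (v @ concat cs) \<subseteq> A" and cs: "lyndon_factors cs" and i: "i < length cs"
  shows "v @ concat (take i cs) @ (cs ! i) \<sqsubset> (cs ! i) @ v @ concat (take i cs)"
proof -
  let ?w = "v @ concat cs" and ?l = "last cs"
  have ne: "cs \<noteq> []" using i by auto
  have split: "concat cs = concat (take i cs) @ cs ! i @ concat (drop (Suc i) cs)"
    using id_take_nth_drop[OF i] by (metis concat.simps(2) concat_append)
  have "?l \<noteq> []" using cs ne alsw_nonempty unfolding lyndon_factors_def by auto
  moreover have "?w = (v @ concat (butlast cs)) @ ?l"
    using ne by (metis append.assoc append_butlast_last_id append_Nil2 concat.simps concat_append)
  ultimately have "?w \<sqsubset> ?l" using alsw_suffixD[OF vc A] v by blast
  moreover have "?l \<sqsubseteq> cs ! i"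
    using lyndon_factors_mono[OF cs, of i "length cs - 1"] i by (simp add: last_conv_nth ne)
  ultimately have "?w \<sqsubset> cs ! i" by (rule lex_leq_trans)
  then have "differ ?w (cs ! i)" by (rule differ_longer) (simp add: split)
  then obtain p a b x y where d: "?w = p @ a # x" "cs ! i = p @ b # y" "gt a b"
    unfolding differ_def by blast
  let ?u = "v @ concat (take i cs) @ cs ! i"
  have u: "?w = ?u @ concat (drop (Suc i) cs)" using split by simp
  have len: "length (p @ [a]) \<le> length ?u" using d(2) by simp
  have "?u @ concat (drop (Suc i) cs) = (p @ [a]) @ x" using d(1) u by simp
  then obtain z where "?u = (p @ [a]) @ z"
  proof (cases rule: append_eq_appendE)
    case (right z)
    then show ?thesis using len that[of "[]"] by simp
  qed (use that in blast)
  then have "differ ?u (cs ! i)" using d unfolding differ_def by auto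
  from differ_append[OF this, of "[]" "v @ concat (take i cs)"] show ?thesis by simp
qed

end


text \<open>The order \<open>gt'\<close> need not be the one induced by \<open>h\<close> outside \<open>A\<close>; this covers the letters
  \<open>[p]\<close> of the Shirshov bracketing, which are ordered through \<open>p\<close>.\<close>

lemma shirshov_map:
  assumes gt: "order_on gt A" and gt': "order_on gt' (h ` A)"
    and h: "\<And>a b. a \<in> A \<Longrightarrow> b \<in> A \<Longrightarrow> gt' (h a) (h b) \<longleftrightarrow> gt a b" and inj: "inj_on h A"
    and u: "is_alsw gt u" "set u \<subseteq> A"
  shows "shirshov gt' (map h u) = map_btree h (shirshov gt u)"
proof -
  interpret gt: order_on gt A by fact
  interpret gt': order_on gt' "h ` A" by fact
  have lex: "lex_gt gt' (map h x) (map h y) \<longleftrightarrow> lex_gt gt x y" if "set x \<subseteq> A" "set y \<subseteq> A" for x y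
    using that
  proof (induction x arbitrary: y)
    case Nil
    then show ?case by (cases y) auto
  next
    case (Cons a x)
    then show ?case by (cases y) (auto simp: h dest: inj_onD[OF inj])
  qed
  have alsw: "is_alsw gt' (map h x)" if x: "is_alsw gt x" "set x \<subseteq> A" for x
    unfolding is_alsw_def
  proof (intro conjI allI impI)
    fix p q assume "map h x = p @ q \<and> p \<noteq> [] \<and> q \<noteq> []"
    then obtain p' q' where pq: "x = p' @ q'" "p = map h p'" "q = map h q'" "p' \<noteq> []" "q' \<noteq> []"
      by (auto simp: map_eq_append_conv)
    then have "lex_gt gt (p' @ q') (q' @ p')" using x(1) unfolding is_alsw_def by blast
    then have "lex_gt gt' (map h (p' @ q')) (map h (q' @ p'))" using x(2) pq(1) by (subst lex) auto
    then show "lex_gt gt' (p @ q) (q @ p)" using pq by simp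
  qed (use x gt.alsw_nonempty in auto)
  have leaves: "leaves (map_btree h t) = map h (leaves t)" for t
    by (induction t) auto
  have nlsw: "is_nlsw gt' (map_btree h t)" if "is_nlsw gt t" "set (leaves t) \<subseteq> A" for t
    using that
  proof (induction t)
    case (Branch s t)
    have "map_btree h s = Branch v1 v2 \<Longrightarrow> lex_ge gt' (map h (leaves t)) (leaves v2)" for v1 v2
      using Branch.prems lex[of "leaves t"] by (cases s) (auto simp: lex_ge_def leaves)
    then show ?case using Branch alsw[of "leaves s @ leaves t"] by (auto simp: leaves)
  qed (use gt'.alsw_single in auto)
  show ?thesis
    using gt'.shirshov_leaves[OF nlsw[OF gt.shirshov(1)[OF u]]] gt.shirshov(2)[OF u] u(2)
    by (auto simp: leaves image_mono)
qed

section \<open>The degree-lexicographic order\<close>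

lemma deg_simps [simp]: "deg [] = 0" "deg (p # u) = deg_prime p + deg u" "deg (u @ v) = deg u + deg v"
  by (simp_all add: deg_def)

lemma deg_prime_Op [simp]: "deg_prime (Op \<omega> us) = Suc (sum_list (map deg us))"
  by (simp add: deg_def[abs_def] comp_def)

declare deg_prime.simps(2) [simp del]

lemma deg_prime_pos: "0 < deg_prime p"
  by (cases p) auto

lemma deg_prime_nonzero [simp]: "deg_prime p \<noteq> 0"
  using deg_prime_pos[of p] by simp

lemma deg_prime_le: "p \<in> set u \<Longrightarrow> deg_prime p \<le> deg u"
  by (induction u) auto

lemma deg_nonempty: "u \<noteq> [] \<Longrightarrow> 0 < deg u"
  by (cases u) (auto simp: deg_prime_pos)

lemma first_difference:
  assumes "length u = length v" "u \<noteq> v"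
  shows "\<exists>i<length u. take i u = take i v \<and> u ! i \<noteq> v ! i"
  using assms
proof (induction u v rule: list_induct2)
  case (Cons a u b v)
  show ?case
  proof (cases "a = b")
    case True
    then obtain i where "i < length u" "take i u = take i v" "u ! i \<noteq> v ! i" using Cons by auto
    then show ?thesis using True by (intro exI[of _ "Suc i"]) auto
  qed (intro exI[of _ 0], auto)
qed simp

lemma lex_gt_index:
  assumes "length u = length v"
  shows "lex_gt gt u v \<longleftrightarrow> (\<exists>i<length u. take i u = take i v \<and> gt (u ! i) (v ! i))"
  using assms
proof (induction u v rule: list_induct2)
  case (Cons a u b v)
  show ?case
  proof
    assume "lex_gt gt (a # u) (b # v)"
    then consider "gt a b" | i where "a = b" "i < length u" "take i u = take i v" "gt (u ! i) (v ! i)"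
      using Cons.IH by auto
    then show "\<exists>i<length (a # u). take i (a # u) = take i (b # v) \<and> gt ((a # u) ! i) ((b # v) ! i)"
    proof cases
      case 1
      then show ?thesis by (intro exI[of _ 0]) auto
    next
      case (2 i)
      then show ?thesis by (intro exI[of _ "Suc i"]) auto
    qed
  next
    assume "\<exists>i<length (a # u). take i (a # u) = take i (b # v) \<and> gt ((a # u) ! i) ((b # v) ! i)"
    then obtain i where "i < length (a # u)" "take i (a # u) = take i (b # v)" "gt ((a # u) ! i) ((b # v) ! i)"
      by blast
    then show "lex_gt gt (a # u) (b # v)" using Cons.IH by (cases i) auto
  qed
qed simp

lemma lex_index:
  assumes "length v = length u" "i < length u" "take i u = take i v" "(v ! i, u ! i) \<in> r"
  shows "(v, u) \<in> lex r"
proof -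
  have "u = take i u @ u ! i # drop (Suc i) u" "v = take i u @ v ! i # drop (Suc i) v"
    using assms id_take_nth_drop by metis+
  then show ?thesis unfolding lex_conv using assms by blast
qed

lemma prime_gt_deg: "prime_gt p q \<Longrightarrow> deg_prime q \<le> deg_prime p"
  by (cases rule: prime_gt.cases) auto

lemma dl_gt_deg: "dl_gt u v \<Longrightarrow> deg v \<le> deg u"
  by (cases rule: dl_gt.cases) auto

lemma dl_gt_iff: "dl_gt u v \<longleftrightarrow> deg u > deg v \<or> deg u = deg v \<and>
    (length u > length v \<or> length u = length v \<and> lex_gt prime_gt u v)"
proof
  assume "dl_gt u v"
  then show "deg u > deg v \<or> deg u = deg v \<and> (length u > length v \<or> length u = length v \<and> lex_gt prime_gt u v)"
    by cases (auto simp: lex_gt_index)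
next
  assume "deg u > deg v \<or> deg u = deg v \<and> (length u > length v \<or> length u = length v \<and> lex_gt prime_gt u v)"
  then consider "deg u > deg v" | "deg u = deg v" "length u > length v"
    | "deg u = deg v" "length u = length v" "lex_gt prime_gt u v" by blast
  then show "dl_gt u v"
  proof cases
    case 3
    then obtain i where "i < length u" "take i u = take i v" "prime_gt (u ! i) (v ! i)"
      using lex_gt_index by blast
    then show ?thesis using 3 word_lex by blast
  qed (auto intro: word_deg word_bre)
qed

lemma
  fixes p q :: "('x::wellorder, 'o::wellorder) oprime" and u v :: "('x, 'o) oword"
  shows prime_gt_neq: "prime_gt p q \<Longrightarrow> p \<noteq> q"
    and dl_gt_neq: "dl_gt u v \<Longrightarrow> u \<noteq> v"
  by (induction p q and u v rule: prime_gt_dl_gt.inducts) auto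

lemma prime_gt_irrefl [simp]: "\<not> prime_gt p p" and dl_gt_irrefl [simp]: "\<not> dl_gt u u"
  using prime_gt_neq dl_gt_neq by blast+

lemma take_eq_le: "take j u = take j v \<Longrightarrow> i \<le> j \<Longrightarrow> take i u = take i v"
  by (metis min.absorb1 take_take)

lemma take_eq_nth: "take j u = take j v \<Longrightarrow> i < j \<Longrightarrow> u ! i = v ! i"
  by (metis nth_take)

text \<open>The third word is quantified inside the conclusion because the mutual induction runs
  over the derivation of the first comparison. If both comparisons are decided at indices, the
  composed one is decided at their minimum.\<close>

lemma
  fixes p q :: "('x::wellorder, 'o::wellorder) oprime" and u v :: "('x, 'o) oword"
  shows prime_gt_trans': "prime_gt p q \<Longrightarrow> \<forall>r. prime_gt q r \<longrightarrow> prime_gt p r"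
    and dl_gt_trans': "dl_gt u v \<Longrightarrow> \<forall>w. dl_gt v w \<longrightarrow> dl_gt u w"
proof (induction p q and u v rule: prime_gt_dl_gt.inducts)
  case (prime_deg q p)
  then show ?case using prime_gt_deg prime_gt_dl_gt.prime_deg by (meson le_less_trans)
next
  case (prime_var x y)
  show ?case
  proof (intro allI impI)
    fix r :: "('x, 'o) oprime" assume "prime_gt (Var y) r"
    then show "prime_gt (Var x) r"
      using prime_var by cases (auto intro: prime_gt_dl_gt.prime_deg prime_gt_dl_gt.prime_var)
  qed
next
  case (prime_sym \<omega> us \<theta> vs)
  show ?case
  proof (intro allI impI)
    fix r assume "prime_gt (Op \<theta> vs) r"
    then show "prime_gt (Op \<omega> us) r"
      using prime_sym by cases (auto intro: prime_gt_dl_gt.prime_deg prime_gt_dl_gt.prime_sym)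
  qed
next
  case (prime_arg \<omega> us vs i)
  show ?case
  proof (intro allI impI)
    fix r assume "prime_gt (Op \<omega> vs) r"
    then show "prime_gt (Op \<omega> us) r"
    proof cases
      case prime_deg
      then show ?thesis using prime_arg by (intro prime_gt_dl_gt.prime_deg) simp
    next
      case (prime_sym \<theta> ws)
      then show ?thesis using prime_arg by (auto intro: prime_gt_dl_gt.prime_sym)
    next
      case r: (prime_arg ws j)
      have "dl_gt (us ! min i j) (ws ! min i j)"
      proof (cases i j rule: linorder_cases)
        case less
        then show ?thesis using r prime_arg take_eq_nth[of j vs ws i] by (simp add: min_def)
      next
        case equal
        then show ?thesis using r prime_arg by simp
      next
        case greater
        then show ?thesis using r prime_arg take_eq_nth[of i us vs j] by (simp add: min_def)
      qed
      moreover have "take (min i j) us = take (min i j) ws"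
        using r prime_arg take_eq_le by (metis min.cobounded1 min.cobounded2)
      ultimately show ?thesis
        using r prime_arg by (auto intro!: prime_gt_dl_gt.prime_arg[where i = "min i j"])
    qed
  qed
next
  case (word_deg v u)
  then show ?case using dl_gt_deg prime_gt_dl_gt.word_deg by (meson le_less_trans)
next
  case (word_bre u v)
  show ?case
  proof (intro allI impI)
    fix w assume "dl_gt v w"
    then show "dl_gt u w" using word_bre by cases (auto intro: prime_gt_dl_gt.word_deg prime_gt_dl_gt.word_bre)
  qed
next
  case (word_lex u v i)
  show ?case
  proof (intro allI impI)
    fix w assume "dl_gt v w"
    then show "dl_gt u w"
    proof cases
      case word_deg
      then show ?thesis using word_lex by (intro prime_gt_dl_gt.word_deg) simp
    next
      case word_bre
      then show ?thesis using word_lex by (intro prime_gt_dl_gt.word_bre) simp_all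
    next
      case r: (word_lex j)
      have "prime_gt (u ! min i j) (w ! min i j)"
      proof (cases i j rule: linorder_cases)
        case less
        then show ?thesis using r word_lex take_eq_nth[of j v w i] by (simp add: min_def)
      next
        case equal
        then show ?thesis using r word_lex by simp
      next
        case greater
        then show ?thesis using r word_lex take_eq_nth[of i u v j] by (simp add: min_def)
      qed
      moreover have "take (min i j) u = take (min i j) w"
        using r word_lex take_eq_le by (metis min.cobounded1 min.cobounded2)
      ultimately show ?thesis
        using r word_lex by (auto intro!: prime_gt_dl_gt.word_lex[where i = "min i j"])
    qed
  qed
qed

lemma prime_gt_trans: "prime_gt p q \<Longrightarrow> prime_gt q r \<Longrightarrow> prime_gt p r"
  using prime_gt_trans' by blast

lemma dl_gt_trans: "dl_gt u v \<Longrightarrow> dl_gt v w \<Longrightarrow> dl_gt u w"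
  using dl_gt_trans' by blast

section \<open>Compatibility of the order with concatenation and operators\<close>

lemma lex_gt_append_left: "lex_gt prime_gt u v \<Longrightarrow> lex_gt prime_gt (a @ u) (a @ v)"
  by (induction a) auto

lemma lex_gt_append_right: "length u = length v \<Longrightarrow> lex_gt gt u v \<Longrightarrow> lex_gt gt (u @ b) (v @ b)"
  by (induction u v rule: list_induct2) auto

lemma dl_gt_append: "dl_gt u v \<Longrightarrow> dl_gt (a @ u @ b) (a @ v @ b)"
  by (auto simp: dl_gt_iff intro!: lex_gt_append_left lex_gt_append_right)

lemma dl_gt_Op: "dl_gt u v \<Longrightarrow> dl_gt [Op \<omega> (us @ u # vs)] [Op \<omega> (us @ v # vs)]"
proof -
  assume uv: "dl_gt u v"
  have "prime_gt (Op \<omega> (us @ u # vs)) (Op \<omega> (us @ v # vs))"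
  proof (cases "deg u = deg v")
    case True
    then show ?thesis using uv by (intro prime_arg[where i = "length us"]) auto
  next
    case False
    then show ?thesis using uv dl_gt_deg[OF uv] by (intro prime_deg) auto
  qed
  then show ?thesis by (auto simp: dl_gt_iff dest: prime_gt_deg)
qed

section \<open>Words over \<open>X\<close> and \<open>\<Omega>\<close>\<close>

definition oprimes :: "'x set \<Rightarrow> 'o set \<Rightarrow> ('o \<Rightarrow> nat) \<Rightarrow> ('x, 'o) oprime set" where
  "oprimes X Om ar = Var ` X \<union> op_exprs Om ar (owords X Om ar)"

definition aprimes ::
  "'x::wellorder set \<Rightarrow> 'o::wellorder set \<Rightarrow> ('o \<Rightarrow> nat) \<Rightarrow> ('x, 'o) oprime set" where
  "aprimes X Om ar = Var ` X \<union> op_exprs Om ar (oalsw X Om ar)"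

lemma words_on_mono: "Y \<subseteq> Z \<Longrightarrow> words_on Y \<subseteq> words_on Z"
  by (auto simp: words_on_def)

lemma op_exprs_mono: "Y \<subseteq> Z \<Longrightarrow> op_exprs Om ar Y \<subseteq> op_exprs Om ar Z"
  by (auto simp: op_exprs_def)

lemma owords_level_mono: "i \<le> j \<Longrightarrow> owords_level X Om ar i \<subseteq> owords_level X Om ar j"
proof (rule lift_Suc_mono_le[of "owords_level X Om ar"])
  show "owords_level X Om ar n \<subseteq> owords_level X Om ar (Suc n)" for n
  proof (induction n)
    case (Suc n)
    have "words_on (Var ` X \<union> op_exprs Om ar (owords_level X Om ar n))
        \<subseteq> words_on (Var ` X \<union> op_exprs Om ar (owords_level X Om ar (Suc n)))"
      using op_exprs_mono[OF Suc] by (intro words_on_mono) blast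
    then show ?case unfolding owords_level.simps(2) by blast
  qed (auto simp: words_on_def)
qed

lemma oalsw_level_mono: "i \<le> j \<Longrightarrow> oalsw_level X Om ar i \<subseteq> oalsw_level X Om ar j"
proof (rule lift_Suc_mono_le[of "oalsw_level X Om ar"])
  show "oalsw_level X Om ar n \<subseteq> oalsw_level X Om ar (Suc n)" for n
  proof (induction n)
    case (Suc n)
    have "words_on (Var ` X \<union> op_exprs Om ar (oalsw_level X Om ar n))
        \<subseteq> words_on (Var ` X \<union> op_exprs Om ar (oalsw_level X Om ar (Suc n)))"
      using op_exprs_mono[OF Suc] by (intro words_on_mono) blast
    then show ?case unfolding oalsw_level.simps(2) by blast
  qed (auto simp: words_on_def)
qed

lemma finite_subset_chain:
  assumes "\<And>i j::nat. i \<le> j \<Longrightarrow> L i \<subseteq> L j" "finite B" "B \<subseteq> (\<Union>n. L n)"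
  shows "\<exists>n. B \<subseteq> L n"
  using assms(2,3)
proof (induction B)
  case (insert b B)
  then obtain n m where "B \<subseteq> L n" "b \<in> L m" by auto
  then have "insert b B \<subseteq> L (max n m)" using assms(1)[of n "max n m"] assms(1)[of m "max n m"] by auto
  then show ?case ..
qed simp

text \<open>Finitely many letters with finitely many arguments each are contained in a single level
  of an increasing chain. This makes the unions of levels fixed points, and the levels disappear
  from the later proofs.\<close>

lemma op_exprs_chain:
  assumes "\<And>i j::nat. i \<le> j \<Longrightarrow> L i \<subseteq> L j" and u: "set u \<subseteq> Y \<union> op_exprs Om ar (\<Union>n. L n)"
  shows "\<exists>n. set u \<subseteq> Y \<union> op_exprs Om ar (L n)"
proof (rule finite_subset_chain)
  show "i \<le> j \<Longrightarrow> Y \<union> op_exprs Om ar (L i) \<subseteq> Y \<union> op_exprs Om ar (L j)" for i j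
    using op_exprs_mono[OF assms(1)[of i j]] by blast
  show "set u \<subseteq> (\<Union>n. Y \<union> op_exprs Om ar (L n))"
  proof
    fix p assume "p \<in> set u"
    then consider "p \<in> Y" | \<omega> us where "p = Op \<omega> us" "\<omega> \<in> Om" "length us = ar \<omega>" "set us \<subseteq> (\<Union>n. L n)"
      using u by (auto simp: op_exprs_def)
    then show "p \<in> (\<Union>n. Y \<union> op_exprs Om ar (L n))"
    proof cases
      case 2
      then obtain n where "set us \<subseteq> L n" using finite_subset_chain[of L "set us"] assms(1) by auto
      then show ?thesis using 2 by (auto simp: op_exprs_def)
    qed auto
  qed
qed simp

lemma owords_iff: "w \<in> owords X Om ar \<longleftrightarrow> w \<noteq> [] \<and> set w \<subseteq> oprimes X Om ar"
proof
  assume "w \<in> owords X Om ar"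
  then obtain n where n: "w \<in> owords_level X Om ar n" by (auto simp: owords_def)
  have "owords_level X Om ar m \<subseteq> owords X Om ar" for m by (auto simp: owords_def)
  then have *: "Var ` X \<union> op_exprs Om ar (owords_level X Om ar m) \<subseteq> oprimes X Om ar" for m
    unfolding oprimes_def by (intro Un_mono op_exprs_mono order_refl)
  show "w \<noteq> [] \<and> set w \<subseteq> oprimes X Om ar"
  proof (cases n)
    case 0
    then show ?thesis using n *[of 0] by (auto simp: words_on_def)
  next
    case (Suc m)
    then have "w \<noteq> []" "set w \<subseteq> Var ` X \<union> op_exprs Om ar (owords_level X Om ar m)"
      using n by (simp_all add: words_on_def)
    then show ?thesis using *[of m] by blast
  qed
next
  assume w: "w \<noteq> [] \<and> set w \<subseteq> oprimes X Om ar"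
  then obtain n where "set w \<subseteq> Var ` X \<union> op_exprs Om ar (owords_level X Om ar n)"
    using op_exprs_chain[of "owords_level X Om ar" w "Var ` X" Om ar, OF owords_level_mono]
    unfolding oprimes_def owords_def by blast
  then have "w \<in> owords_level X Om ar (Suc n)" using w by (simp add: words_on_def)
  then show "w \<in> owords X Om ar" unfolding owords_def by blast
qed

lemma owords_args:
  "set us \<subseteq> owords X Om ar \<Longrightarrow> u \<in> set us \<Longrightarrow> u \<noteq> [] \<and> set u \<subseteq> oprimes X Om ar"
  using owords_iff by blast

lemma oalsw_iff: "w \<in> oalsw X Om ar \<longleftrightarrow> is_alsw prime_gt w \<and> set w \<subseteq> aprimes X Om ar"
proof
  assume "w \<in> oalsw X Om ar"
  then obtain n where n: "w \<in> oalsw_level X Om ar n" by (auto simp: oalsw_def)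
  have "oalsw_level X Om ar m \<subseteq> oalsw X Om ar" for m by (auto simp: oalsw_def)
  then have *: "Var ` X \<union> op_exprs Om ar (oalsw_level X Om ar m) \<subseteq> aprimes X Om ar" for m
    unfolding aprimes_def by (intro Un_mono op_exprs_mono order_refl)
  show "is_alsw prime_gt w \<and> set w \<subseteq> aprimes X Om ar"
  proof (cases n)
    case 0
    then show ?thesis using n *[of 0] by (auto simp: words_on_def)
  next
    case (Suc m)
    then have "is_alsw prime_gt w" "set w \<subseteq> Var ` X \<union> op_exprs Om ar (oalsw_level X Om ar m)"
      using n by (simp_all add: words_on_def)
    then show ?thesis using *[of m] by blast
  qed
next
  assume w: "is_alsw prime_gt w \<and> set w \<subseteq> aprimes X Om ar"
  then obtain n where "set w \<subseteq> Var ` X \<union> op_exprs Om ar (oalsw_level X Om ar n)"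
    using op_exprs_chain[of "oalsw_level X Om ar" w "Var ` X" Om ar, OF oalsw_level_mono]
    unfolding aprimes_def oalsw_def by blast
  then have "w \<in> oalsw_level X Om ar (Suc n)" using w by (simp add: words_on_def is_alsw_def)
  then show "w \<in> oalsw X Om ar" unfolding oalsw_def by blast
qed

lemma oalsw_level_owords: "oalsw_level X Om ar n \<subseteq> owords_level X Om ar n"
proof (induction n)
  case (Suc n)
  then have "words_on (Var ` X \<union> op_exprs Om ar (oalsw_level X Om ar n)) \<subseteq> owords_level X Om ar (Suc n)"
    unfolding owords_level.simps by (intro words_on_mono Un_mono op_exprs_mono order_refl)
  then show ?case unfolding oalsw_level.simps by blast
qed auto

lemma oalsw_owords: "oalsw X Om ar \<subseteq> owords X Om ar"
  unfolding oalsw_def owords_def by (intro UN_mono order_refl oalsw_level_owords)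

lemma aprimes_oprimes: "aprimes X Om ar \<subseteq> oprimes X Om ar"
  unfolding aprimes_def oprimes_def by (intro Un_mono op_exprs_mono order_refl oalsw_owords)

locale operated =
  fixes X :: "'x::wellorder set" and Om :: "'o::wellorder set" and ar :: "'o \<Rightarrow> nat"
  assumes arity: "\<omega> \<in> Om \<Longrightarrow> 1 \<le> ar \<omega>"
begin

abbreviation "PR \<equiv> oprimes X Om ar"
abbreviation "OW \<equiv> owords X Om ar"
abbreviation "AP \<equiv> aprimes X Om ar"
abbreviation "AW \<equiv> oalsw X Om ar"

lemma Op_PR: "Op \<omega> us \<in> PR \<longleftrightarrow> \<omega> \<in> Om \<and> length us = ar \<omega> \<and> set us \<subseteq> OW"
  by (auto simp: oprimes_def op_exprs_def)

lemma Var_PR: "Var x \<in> PR \<longleftrightarrow> x \<in> X"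
  by (auto simp: oprimes_def op_exprs_def)

lemma Op_AP: "Op \<omega> us \<in> AP \<longleftrightarrow> \<omega> \<in> Om \<and> length us = ar \<omega> \<and> set us \<subseteq> AW"
  by (auto simp: aprimes_def op_exprs_def)

lemma Var_AP: "Var x \<in> AP \<longleftrightarrow> x \<in> X"
  by (auto simp: aprimes_def op_exprs_def)

text \<open>Positive arity enters here: a letter and an operator expression can only be compared by
  degree, so operator expressions must have degree greater than 1.\<close>

lemma deg_Op_PR: "Op \<omega> us \<in> PR \<Longrightarrow> 1 < deg_prime (Op \<omega> us)"
proof -
  assume p: "Op \<omega> us \<in> PR"
  then have "us \<noteq> []" using arity[of \<omega>] by (auto simp: Op_PR)
  then have "hd us \<in> set us" "hd us \<in> OW" using p by (auto simp: Op_PR)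
  then have "0 < deg (hd us)" by (simp add: owords_iff deg_nonempty)
  then have "0 < sum_list (map deg us)" using \<open>us \<noteq> []\<close> by (cases us) auto
  then show ?thesis by simp
qed

lemma deg_arg: "u \<in> set us \<Longrightarrow> deg u < deg_prime (Op \<omega> us)"
  by (simp add: member_le_sum_list le_imp_less_Suc)

text \<open>Comparability is assumed for the letters of \<open>u\<close> only. This fits the
  induction over primes, where it is known for the letters in the arguments of one of the two
  primes.\<close>

lemma dl_gt_total_aux:
  assumes "\<And>p q. p \<in> set u \<Longrightarrow> p \<in> PR \<Longrightarrow> q \<in> PR \<Longrightarrow> p \<noteq> q \<Longrightarrow> prime_gt p q \<or> prime_gt q p"
    and "set u \<subseteq> PR" "set v \<subseteq> PR" "u \<noteq> v"
  shows "dl_gt u v \<or> dl_gt v u"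
proof (cases "deg u = deg v \<and> length u = length v")
  case True
  then obtain i where i: "i < length u" "take i u = take i v" "u ! i \<noteq> v ! i"
    using first_difference assms by blast
  moreover have "u ! i \<in> set u" "v ! i \<in> set v" using i True by auto
  ultimately have "prime_gt (u ! i) (v ! i) \<or> prime_gt (v ! i) (u ! i)"
    using assms(1)[of "u ! i" "v ! i"] assms(2,3) by blast
  then show ?thesis using True i word_lex[of u v i] word_lex[of v u i] by auto
next
  case False
  then show ?thesis by (auto simp: dl_gt_iff)
qed

lemma prime_gt_total: "p \<in> PR \<Longrightarrow> q \<in> PR \<Longrightarrow> p \<noteq> q \<Longrightarrow> prime_gt p q \<or> prime_gt q p"
proof (induction p arbitrary: q)
  case (Var x)
  show ?case
  proof (cases q)
    case (Var y)
    then show ?thesis using Var.prems prime_var by (metis linorder_neqE)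
  next
    case (Op \<omega> us)
    then have "prime_gt q (Var x)" using deg_Op_PR[of \<omega> us] Var.prems by (intro prime_deg) auto
    then show ?thesis ..
  qed
next
  case (Op \<omega> us)
  show ?case
  proof (cases "deg_prime (Op \<omega> us) = deg_prime q")
    case False
    then show ?thesis by (metis linorder_neqE prime_deg)
  next
    case deg: True
    show ?thesis
    proof (cases q)
      case (Var y)
      then show ?thesis using deg_Op_PR[OF Op.prems(1)] deg by (simp only: deg_prime.simps(1))
    next
      case q: (Op \<theta> vs)
      show ?thesis
      proof (cases "\<omega> = \<theta>")
        case False
        then show ?thesis using deg q prime_sym by (metis linorder_neqE)
      next
        case True
        then have us: "length us = length vs" "us \<noteq> vs" "set us \<subseteq> OW" "set vs \<subseteq> OW"
          using Op.prems q by (auto simp: Op_PR)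
        then obtain i where i: "i < length us" "take i us = take i vs" "us ! i \<noteq> vs ! i"
          using first_difference by blast
        then have mem: "us ! i \<in> set us" "us ! i \<in> OW" "vs ! i \<in> OW" using us by auto
        have "dl_gt (us ! i) (vs ! i) \<or> dl_gt (vs ! i) (us ! i)"
        proof (rule dl_gt_total_aux)
          show "p \<in> set (us ! i) \<Longrightarrow> p \<in> PR \<Longrightarrow> q \<in> PR \<Longrightarrow> p \<noteq> q \<Longrightarrow> prime_gt p q \<or> prime_gt q p"
            for p q using Op.IH mem by blast
        qed (use mem i in \<open>auto simp: owords_iff\<close>)
        then show ?thesis using deg q us i True prime_arg[of \<omega> us vs i] prime_arg[of \<omega> vs us i] by auto
      qed
    qed
  qed
qed

lemma dl_gt_total: "set u \<subseteq> PR \<Longrightarrow> set v \<subseteq> PR \<Longrightarrow> u \<noteq> v \<Longrightarrow> dl_gt u v \<or> dl_gt v u"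
  using dl_gt_total_aux prime_gt_total by blast

sublocale lyn: order_on prime_gt PR
  using prime_gt_trans prime_gt_total by unfold_locales auto

section \<open>Well-foundedness of the degree-lexicographic order\<close>

definition word_rel :: "nat \<Rightarrow> (('x, 'o) oword \<times> ('x, 'o) oword) set" where
  "word_rel n = {(v, u). set u \<subseteq> PR \<and> set v \<subseteq> PR \<and> deg u \<le> n \<and> deg v \<le> n \<and> dl_gt u v}"

definition prime_rel :: "nat \<Rightarrow> (('x, 'o) oprime \<times> ('x, 'o) oprime) set" where
  "prime_rel n = {(q, p). p \<in> PR \<and> q \<in> PR \<and> deg_prime p \<le> n \<and> prime_gt p q}"

text \<open>Arguments of a prime of degree at most \<open>n\<close> have degree below
  \<open>n\<close>, so comparing argument lists only involves \<open>word_rel (n - 1)\<close>. The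
  degree bound unwinds the mutual recursion between primes and words.\<close>

lemma wf_prime_rel:
  assumes "\<And>m. m < n \<Longrightarrow> wf (word_rel m)"
  shows "wf (prime_rel n)"
proof -
  \<comment> \<open>Components foreign to a constructor get fixed defaults. Related primes of equal
    degree are both letters or both operator expressions, so the defaults coincide whenever they are
    compared.\<close>
  let ?f = "\<lambda>p. (deg_prime p, (case p of Var x \<Rightarrow> x | Op \<omega> us \<Rightarrow> undefined),
    (case p of Var x \<Rightarrow> undefined | Op \<omega> us \<Rightarrow> \<omega>), (case p of Var x \<Rightarrow> [] | Op \<omega> us \<Rightarrow> us))"
  let ?R = "less_than <*lex*> {(x::'x, y). x < y} <*lex*> {(x::'o, y). x < y} <*lex*> lex (word_rel (n - 1))"
  show ?thesis
  proof (cases n)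
    case 0
    then have "prime_rel n = {}" using deg_prime_pos by (auto simp: prime_rel_def)
    then show ?thesis by simp
  next
    case (Suc m)
    have "wf ?R" using assms[of m] Suc by (intro wf_lex_prod wf_lex) (auto simp: wf)
    moreover have "prime_rel n \<subseteq> inv_image ?R ?f"
    proof (rule subrelI)
      fix q p assume "(q, p) \<in> prime_rel n"
      then have pq: "p \<in> PR" "q \<in> PR" "deg_prime p \<le> n" and gt: "prime_gt p q"
        by (auto simp: prime_rel_def)
      from gt show "(q, p) \<in> inv_image ?R ?f"
      proof cases
        case (prime_arg \<omega> us vs i)
        have us: "set us \<subseteq> OW" "set vs \<subseteq> OW" "length us = length vs" using pq prime_arg by (auto simp: Op_PR)
        have mem: "us ! i \<in> set us" "vs ! i \<in> set vs" using prime_arg by auto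
        have "(vs ! i, us ! i) \<in> word_rel m"
          unfolding word_rel_def using deg_arg[OF mem(1), of \<omega>] deg_arg[OF mem(2), of \<omega>] prime_arg pq Suc us
            owords_args[OF us(1) mem(1)] owords_args[OF us(2) mem(2)]
          by auto
        then have "(vs, us) \<in> lex (word_rel m)" using prime_arg us(3) lex_index by metis
        then show ?thesis using prime_arg Suc by simp
      qed simp_all
    qed
    ultimately show ?thesis by (rule wf_subset[OF wf_inv_image])
  qed
qed

lemma wf_word_rel: "wf (word_rel n)"
proof (induction n rule: less_induct)
  case (less n)
  let ?R = "less_than <*lex*> lenlex (prime_rel n)"
  have "wf ?R" using wf_prime_rel less by (intro wf_lex_prod wf_lenlex) auto
  moreover have "word_rel n \<subseteq> inv_image ?R (\<lambda>u. (deg u, u))"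
  proof (rule subrelI)
    fix v u assume "(v, u) \<in> word_rel n"
    then have uv: "set u \<subseteq> PR" "set v \<subseteq> PR" "deg u \<le> n" and gt: "dl_gt u v"
      by (auto simp: word_rel_def)
    from gt show "(v, u) \<in> inv_image ?R (\<lambda>u. (deg u, u))"
    proof cases
      case (word_lex i)
      have mem: "u ! i \<in> set u" "v ! i \<in> set v" using word_lex by auto
      have "deg_prime (u ! i) \<le> n" using deg_prime_le[OF mem(1)] uv(3) by simp
      then have "(v ! i, u ! i) \<in> prime_rel n"
        unfolding prime_rel_def using word_lex uv mem by auto
      then have "(v, u) \<in> lex (prime_rel n)" using word_lex lex_index by metis
      then have "(v, u) \<in> lenlex (prime_rel n)" using word_lex by (simp add: lenlex_def)
      then show ?thesis using word_lex by simp
    qed (simp_all add: lenlex_conv)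
  qed
  ultimately show ?case by (rule wf_subset[OF wf_inv_image])
qed

text \<open>A descending sequence never leaves the words of degree at most that of its start, and on
  these \<open>word_rel\<close> is available.\<close>

lemma wf_dl_gt: "wf {(v, u). u \<in> OW \<and> v \<in> OW \<and> dl_gt u v}"
  unfolding wf_eq_minimal
proof (intro allI impI)
  fix Q :: "('x, 'o) oword set" and x assume "x \<in> Q"
  then obtain z where z: "z \<in> Q \<inter> {z. deg z \<le> deg x}"
    and min: "\<And>y. (y, z) \<in> word_rel (deg x) \<Longrightarrow> y \<notin> Q \<inter> {z. deg z \<le> deg x}"
    using wfE_min[OF wf_word_rel, of x "Q \<inter> {z. deg z \<le> deg x}" "deg x"] by auto
  have "y \<notin> Q" if "(y, z) \<in> {(v, u). u \<in> OW \<and> v \<in> OW \<and> dl_gt u v}" for y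
  proof -
    have yz: "z \<in> OW" "y \<in> OW" "dl_gt z y" using that by auto
    then have "deg y \<le> deg x" using dl_gt_deg z by fastforce
    then have "(y, z) \<in> word_rel (deg x)" using yz z by (auto simp: word_rel_def owords_iff)
    then show ?thesis using min \<open>deg y \<le> deg x\<close> by blast
  qed
  then show "\<exists>z\<in>Q. \<forall>y. (y, z) \<in> {(v, u). u \<in> OW \<and> v \<in> OW \<and> dl_gt u v} \<longrightarrow> y \<notin> Q"
    using z by blast
qed

section \<open>Contexts\<close>

text \<open>Words with one hole are represented by the functions \<open>u \<mapsto> \<pi>|\<^sub>u\<close>, so that disjoint, nested and
  overlapping occurrences can be compared without syntax.\<close>

inductive ctx :: "(('x, 'o) oword \<Rightarrow> ('x, 'o) oword) \<Rightarrow> bool" where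
  ctx_append: "set a \<subseteq> PR \<Longrightarrow> set b \<subseteq> PR \<Longrightarrow> ctx (\<lambda>u. a @ u @ b)"
| ctx_Op: "ctx F \<Longrightarrow> \<omega> \<in> Om \<Longrightarrow> length us + Suc (length vs) = ar \<omega> \<Longrightarrow> set us \<subseteq> OW \<Longrightarrow> set vs \<subseteq> OW \<Longrightarrow>
    set a \<subseteq> PR \<Longrightarrow> set b \<subseteq> PR \<Longrightarrow> ctx (\<lambda>u. a @ Op \<omega> (us @ F u # vs) # b)"

lemma ctx_id: "ctx (\<lambda>u. u)"
  using ctx_append[of "[]" "[]"] by simp

lemma ctx_OW: "ctx F \<Longrightarrow> u \<in> OW \<Longrightarrow> F u \<in> OW"
  by (induction rule: ctx.induct) (auto simp: owords_iff Op_PR)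

lemma ctx_mono: "ctx F \<Longrightarrow> dl_gt u v \<Longrightarrow> dl_gt (F u) (F v)"
proof (induction rule: ctx.induct)
  case (ctx_Op F \<omega> us vs a b)
  then show ?case
    using dl_gt_append[OF dl_gt_Op[of "F u" "F v" \<omega> us vs], of a b] by simp
qed (rule dl_gt_append)

lemma ctx_pad: "ctx F \<Longrightarrow> set a \<subseteq> PR \<Longrightarrow> set b \<subseteq> PR \<Longrightarrow> ctx (\<lambda>u. a @ F u @ b)"
proof (induction rule: ctx.induct)
  case (ctx_append a' b')
  then show ?case using ctx.ctx_append[of "a @ a'" "b' @ b"] by simp
next
  case (ctx_Op F \<omega> us vs a' b')
  then show ?case using ctx.ctx_Op[of F \<omega> us vs "a @ a'" "b' @ b"] by simp
qed

lemma ctx_comp: "ctx F \<Longrightarrow> ctx G \<Longrightarrow> ctx (\<lambda>u. F (G u))"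
proof (induction rule: ctx.induct)
  case (ctx_append a b)
  then show ?case using ctx_pad by blast
next
  case (ctx_Op F \<omega> us vs a b)
  then show ?case using ctx.ctx_Op[of "\<lambda>u. F (G u)"] by blast
qed

end

section \<open>Substitution into words with a hole\<close>

lemma plug_append [simp]: "plug (\<pi> @ \<sigma>) s = plug \<pi> s @ plug \<sigma> s"
  by (simp add: plug_def bind_word_def)

lemma plug_Nil [simp]: "plug [] s = []"
  by (simp add: plug_def bind_word_def)

lemma plug_Cons: "plug (p # \<pi>) s = plug [p] s @ plug \<pi> s"
  by (simp add: plug_def bind_word_def)

lemma plug_concat: "plug \<pi> s = concat (map (\<lambda>p. plug [p] s) \<pi>)"
  by (simp add: plug_def bind_word_def)

lemma plug_star [simp]: "plug star s = s"
  by (simp add: plug_def bind_word_def)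

lemma plug_Var [simp]: "plug [Var (Some x)] s = [Var x]"
  by (simp add: plug_def bind_word_def)

lemma plug_Op [simp]: "plug [Op \<omega> us] s = [Op \<omega> (map (\<lambda>u. plug u s) us)]"
  by (simp add: plug_def bind_word_def comp_def)

lemma lift_word_eq: "lift_word u = map (map_oprime Some (\<lambda>a. a)) u"
  by (simp add: lift_word_def id_def)

lemma plug_lift [simp]: "plug (lift_word u) s = u"
proof -
  have "plug [map_oprime Some (\<lambda>a. a) p] s = [p]" for p :: "('a, 'b) oprime"
  proof (induction p)
    case (Op \<omega> us)
    have "plug (map (map_oprime Some (\<lambda>a. a)) u) s = u" if "u \<in> set us" for u
    proof -
      have "plug (map (map_oprime Some (\<lambda>a. a)) u) s = concat (map (\<lambda>p. plug [map_oprime Some (\<lambda>a. a) p] s) u)"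
        by (subst plug_concat) (simp add: comp_def)
      also have "map (\<lambda>p. plug [map_oprime Some (\<lambda>a. a) p] s) u = map (\<lambda>p. [p]) u"
        by (rule list.map_cong0) (rule Op.IH[OF that])
      finally show ?thesis by simp
    qed
    then show ?case by (simp add: map_idI)
  qed simp
  then show ?thesis unfolding lift_word_eq by (subst plug_concat) (simp add: comp_def)
qed

definition holes :: "('x option, 'o) oword \<Rightarrow> nat" where
  "holes \<pi> = sum_list (map holes_prime \<pi>)"

lemma holes_simps [simp]: "holes [] = 0" "holes (p # \<pi>) = holes_prime p + holes \<pi>"
  "holes (\<pi> @ \<sigma>) = holes \<pi> + holes \<sigma>"
  by (simp_all add: holes_def)

lemma holes_prime_Op [simp]: "holes_prime (Op \<omega> us) = sum_list (map holes us)"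
  by (simp add: holes_def[abs_def] comp_def)

declare holes_prime.simps(2) [simp del]

lemma holes_lift [simp]: "holes (lift_word u) = 0"
proof -
  have "holes_prime (map_oprime Some (\<lambda>a. a) p) = 0" for p :: "('a, 'b) oprime"
  proof (induction p)
    case (Op \<omega> us)
    then show ?case by (auto simp: holes_def)
  qed simp
  then show ?thesis by (auto simp: lift_word_eq holes_def)
qed

lemma star_words_iff: "\<pi> \<in> star_words X Om ar \<longleftrightarrow> \<pi> \<in> owords (insert None (Some ` X)) Om ar \<and> holes \<pi> = 1"
  by (simp add: star_words_def holes_def)

lemma lift_word_oprimes:
  assumes "set u \<subseteq> oprimes X Om ar"
  shows "set (lift_word u) \<subseteq> oprimes (insert None (Some ` X)) Om ar"
proof -
  have "map_oprime Some (\<lambda>a. a) p \<in> oprimes (insert None (Some ` X)) Om ar" if "p \<in> oprimes X Om ar"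
    for p :: "('a, 'b) oprime"
    using that
  proof (induction p)
    case (Op \<omega> us)
    then have us: "\<omega> \<in> Om" "length us = ar \<omega>" "set us \<subseteq> owords X Om ar"
      by (auto simp: oprimes_def op_exprs_def)
    have "map (map_oprime Some (\<lambda>a. a)) u \<in> owords (insert None (Some ` X)) Om ar" if "u \<in> set us" for u
    proof -
      have "u \<noteq> []" "\<forall>q\<in>set u. q \<in> oprimes X Om ar" using owords_args[OF us(3) that] by auto
      then show ?thesis using Op.IH[OF that] unfolding owords_iff set_map by blast
    qed
    then show ?case using us(1,2) by (auto simp: oprimes_def op_exprs_def)
  qed (auto simp: oprimes_def op_exprs_def)
  then show ?thesis using assms by (auto simp: lift_word_eq)
qed

lemma sum_list_eq_1_split:
  fixes f :: "'a \<Rightarrow> nat"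
  assumes "sum_list (map f xs) = 1"
  shows "\<exists>as x bs. xs = as @ x # bs \<and> f x = 1 \<and> (\<forall>y\<in>set as \<union> set bs. f y = 0)"
  using assms
proof (induction xs)
  case (Cons x xs)
  show ?case
  proof (cases "f x = 0")
    case True
    then obtain as y bs where "xs = as @ y # bs" "f y = 1" "\<forall>z\<in>set as \<union> set bs. f z = 0"
      using Cons by auto
    then show ?thesis using True by (intro exI[of _ "x # as"] exI[of _ y] exI[of _ bs]) auto
  next
    case False
    have "f x + sum_list (map f xs) = 1" using Cons.prems by simp
    then have "f x = 1" "sum_list (map f xs) = 0" using False by linarith+
    then show ?thesis by (intro exI[of _ "[]"] exI[of _ x] exI[of _ xs]) auto
  qed
qed simp

section \<open>Star words and contexts give the same functions\<close>

context operated
begin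

abbreviation "SW \<equiv> star_words X Om ar"

lemma no_hole_prime:
  "p \<in> oprimes (insert None (Some ` X)) Om ar \<Longrightarrow> holes_prime p = 0 \<Longrightarrow> \<exists>q\<in>PR. \<forall>s. plug [p] s = [q]"
proof (induction p)
  case (Var z)
  then show ?case by (auto simp: oprimes_def op_exprs_def split: if_splits)
next
  case (Op \<omega> us)
  then have us: "\<omega> \<in> Om" "length us = ar \<omega>" "set us \<subseteq> owords (insert None (Some ` X)) Om ar"
    by (auto simp: oprimes_def op_exprs_def)
  have arg: "plug u s = plug u t \<and> plug u s \<in> OW" if u: "u \<in> set us" for u s t
  proof -
    have "set v \<subseteq> set u \<Longrightarrow> plug v s = plug v t \<and> set (plug v s) \<subseteq> PR \<and> (v \<noteq> [] \<longrightarrow> plug v s \<noteq> [])" for v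
    proof (induction v)
      case (Cons p v)
      moreover have "set u \<subseteq> oprimes (insert None (Some ` X)) Om ar" "\<forall>q\<in>set u. holes_prime q = 0"
        using owords_args[OF us(3) u] u Op.prems(2) by (auto simp: holes_def)
      ultimately have "p \<in> oprimes (insert None (Some ` X)) Om ar" "holes_prime p = 0"
        by auto
      then obtain q where "q \<in> PR" "\<forall>s. plug [p] s = [q]" using Op.IH[OF u, of p] Cons.prems by auto
      then show ?case using Cons plug_Cons[of p v] by auto
    qed simp
    moreover have "u \<noteq> []" using us(3) u by (auto simp: owords_iff)
    ultimately show ?thesis unfolding owords_iff by blast
  qed
  define q where "q = Op \<omega> (map (\<lambda>u. plug u []) us)"
  have "q \<in> PR" using us arg by (auto simp: q_def Op_PR)
  moreover have "plug [Op \<omega> us] s = [q]" for s using arg by (auto simp: q_def)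
  ultimately show ?case by blast
qed

lemma no_hole_word:
  "set \<pi> \<subseteq> oprimes (insert None (Some ` X)) Om ar \<Longrightarrow> holes \<pi> = 0 \<Longrightarrow>
    \<exists>u. set u \<subseteq> PR \<and> (\<forall>s. plug \<pi> s = u) \<and> (\<pi> \<noteq> [] \<longrightarrow> u \<noteq> [])"
proof (induction \<pi>)
  case (Cons p \<pi>)
  then obtain q u where "q \<in> PR" "\<forall>s. plug [p] s = [q]" "set u \<subseteq> PR" "\<forall>s. plug \<pi> s = u"
    using no_hole_prime[of p] by auto
  then show ?case using plug_Cons[of p \<pi>] by (intro exI[of _ "q # u"]) auto
qed simp

text \<open>Stated relative to its primes, so that it can serve inside the induction over primes,
  for the argument that contains the hole.\<close>

lemma ctx_plug_word:
  assumes p: "\<And>p. p \<in> set \<pi> \<Longrightarrow> holes_prime p = 1 \<Longrightarrow> p \<in> oprimes (insert None (Some ` X)) Om ar \<Longrightarrow>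
      ctx (plug [p])"
    and \<pi>: "set \<pi> \<subseteq> oprimes (insert None (Some ` X)) Om ar" "holes \<pi> = 1"
  shows "ctx (plug \<pi>)"
proof -
  obtain \<alpha> p \<beta> where split: "\<pi> = \<alpha> @ p # \<beta>" "holes_prime p = 1" "holes \<alpha> = 0" "holes \<beta> = 0"
    using sum_list_eq_1_split[of holes_prime \<pi>] \<pi>(2) by (auto simp: holes_def)
  obtain a b where "set a \<subseteq> PR" "set b \<subseteq> PR" and ab: "\<forall>s. plug \<alpha> s = a" "\<forall>s. plug \<beta> s = b"
    using no_hole_word[of \<alpha>] no_hole_word[of \<beta>] split \<pi> by auto
  then have "ctx (\<lambda>u. a @ plug [p] u @ b)" using ctx_pad p[of p] split \<pi> by auto
  moreover have "plug \<pi> = (\<lambda>u. a @ plug [p] u @ b)"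
    using ab split(1) plug_Cons[of p \<beta>] by (auto simp: fun_eq_iff)
  ultimately show ?thesis by simp
qed

lemma ctx_plug_prime:
  "p \<in> oprimes (insert None (Some ` X)) Om ar \<Longrightarrow> holes_prime p = 1 \<Longrightarrow> ctx (plug [p])"
proof (induction p)
  case (Var z)
  then show ?case using ctx_id by (auto split: if_splits)
next
  case (Op \<omega> us)
  then have us: "\<omega> \<in> Om" "length us = ar \<omega>" "set us \<subseteq> owords (insert None (Some ` X)) Om ar"
    by (auto simp: oprimes_def op_exprs_def)
  obtain xs u ys where split: "us = xs @ u # ys" "holes u = 1" "\<forall>y\<in>set xs \<union> set ys. holes y = 0"
    using sum_list_eq_1_split[of holes us] Op.prems(2) by auto
  have u: "u \<in> set us" using split(1) by simp
  have "ctx (plug u)"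
    by (rule ctx_plug_word) (use Op.IH[OF u] owords_args[OF us(3) u] split(2) in auto)
  moreover have arg: "plug y s = plug y t \<and> plug y s \<in> OW" if y: "y \<in> set xs \<union> set ys" for y s t
  proof -
    have "y \<in> set us" "holes y = 0" using split y by auto
    moreover obtain v where "set v \<subseteq> PR" "\<forall>s. plug y s = v" "y \<noteq> [] \<longrightarrow> v \<noteq> []"
      using no_hole_word[of y] owords_args[OF us(3)] calculation by blast
    ultimately show ?thesis using owords_args[OF us(3)] by (auto simp: owords_iff)
  qed
  moreover define xs' ys' where "xs' = map (\<lambda>u. plug u []) xs" and "ys' = map (\<lambda>u. plug u []) ys"
  ultimately have ctx: "ctx (\<lambda>s. [] @ Op \<omega> (xs' @ plug u s # ys') # [])"
    using us split(1) arg by (intro ctx_Op) auto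
  have "map (\<lambda>u. plug u s) xs = xs'" "map (\<lambda>u. plug u s) ys = ys'" for s
    unfolding xs'_def ys'_def using arg by auto
  then have "plug [Op \<omega> us] = (\<lambda>s. [] @ Op \<omega> (xs' @ plug u s # ys') # [])"
    using split(1) by (simp add: fun_eq_iff)
  then show ?case using ctx by simp
qed

lemma ctx_plug: "\<pi> \<in> SW \<Longrightarrow> ctx (plug \<pi>)"
  using ctx_plug_word[of \<pi>] ctx_plug_prime by (auto simp: star_words_iff owords_iff)

lemma star_lift_SW:
  assumes "set a \<subseteq> PR" "set b \<subseteq> PR"
  shows "lift_word a @ star @ lift_word b \<in> SW"
proof -
  have "Var None \<in> oprimes (insert None (Some ` X)) Om ar" by (simp add: oprimes_def)
  then show ?thesis using assms[THEN lift_word_oprimes] by (auto simp: star_words_iff owords_iff)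
qed

text \<open>With \<open>ctx_plug\<close> this identifies the contexts with the functions
  \<open>plug \<pi>\<close>, so that \<open>ctx\<close> may replace star words in all statements
  about occurrences.\<close>

lemma ctx_star_word: "ctx F \<Longrightarrow> \<exists>\<pi>\<in>SW. plug \<pi> = F"
proof (induction rule: ctx.induct)
  case (ctx_append a b)
  let ?\<pi> = "lift_word a @ star @ lift_word b"
  have "plug ?\<pi> = (\<lambda>u. a @ u @ b)" by (auto simp del: append_Cons)
  moreover have "?\<pi> \<in> SW" using star_lift_SW ctx_append by blast
  ultimately show ?case by blast
next
  case (ctx_Op F \<omega> us vs a b)
  then obtain \<pi> where \<pi>: "\<pi> \<in> SW" "plug \<pi> = F" by blast
  let ?p = "Op \<omega> (map lift_word us @ \<pi> # map lift_word vs)"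
  let ?\<pi> = "lift_word a @ [?p] @ lift_word b"
  have "plug ?\<pi> = (\<lambda>u. a @ Op \<omega> (us @ F u # vs) # b)"
    using \<pi>(2) by (auto simp: comp_def simp del: append_Cons)
  moreover have "lift_word u \<in> owords (insert None (Some ` X)) Om ar" if "u \<in> OW" for u
    using that lift_word_oprimes[of u X Om ar] by (auto simp: owords_iff lift_word_eq)
  then have "?p \<in> oprimes (insert None (Some ` X)) Om ar"
    using ctx_Op.hyps \<pi>(1) by (auto simp: oprimes_def op_exprs_def star_words_iff subset_iff)
  then have "?\<pi> \<in> SW" using ctx_Op.hyps(6,7)[THEN lift_word_oprimes] \<pi>(1)
    by (auto simp: star_words_iff owords_iff comp_def sum_list_0)
  ultimately show ?case by blast
qed

end

section \<open>Linear maps on spaces with basis\<close>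

interpretation V: vector_space "scl :: 'k::field \<Rightarrow> ('a \<Rightarrow>\<^sub>0 'k) \<Rightarrow> ('a \<Rightarrow>\<^sub>0 'k)"
  by (rule vector_space_scl)

abbreviation linmap :: "(('a \<Rightarrow>\<^sub>0 'k::field) \<Rightarrow> ('b \<Rightarrow>\<^sub>0 'k)) \<Rightarrow> bool" where
  "linmap h \<equiv> module_hom scl scl h"

lemma linmapI:
  "(\<And>x y. h (x + y) = h x + h y) \<Longrightarrow> (\<And>c x. h (scl c x) = scl c (h x)) \<Longrightarrow> linmap h"
  by (simp add: module_hom_iff module_scl)

lemma linmap_compose: "linmap g \<Longrightarrow> linmap h \<Longrightarrow> linmap (\<lambda>x. g (h x))"
  by (auto intro!: linmapI simp: module_hom.add module_hom.scale)

lemma linmap_span: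
  assumes h: "linmap h" and x: "x \<in> V.span B" and B: "\<And>b. b \<in> B \<Longrightarrow> h b \<in> V.span C"
  shows "h x \<in> V.span C"
  using x
  by (induction rule: V.span_induct_alt)
    (simp_all add: module_hom.zero[OF h] module_hom.add[OF h] module_hom.scale[OF h] B
      V.span_add V.span_scale V.span_zero)

definition lin :: "('a \<Rightarrow> ('b \<Rightarrow>\<^sub>0 'k::field)) \<Rightarrow> ('a \<Rightarrow>\<^sub>0 'k) \<Rightarrow> ('b \<Rightarrow>\<^sub>0 'k)" where
  "lin h f = (\<Sum>u\<in>Poly_Mapping.keys f. scl (Poly_Mapping.lookup f u) (h u))"

lemma lin_superset:
  assumes "finite K" "Poly_Mapping.keys f \<subseteq> K"
  shows "lin h f = (\<Sum>u\<in>K. scl (Poly_Mapping.lookup f u) (h u))"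
  unfolding lin_def using assms
  by (intro sum.mono_neutral_left) (auto simp: in_keys_iff)

lemma linmap_lin:
  fixes h :: "'a \<Rightarrow> ('b \<Rightarrow>\<^sub>0 'k::field)"
  shows "linmap (lin h)"
proof (rule linmapI)
  fix x y :: "'a \<Rightarrow>\<^sub>0 'k"
  let ?K = "Poly_Mapping.keys x \<union> Poly_Mapping.keys y"
  have "Poly_Mapping.keys (x + y) \<subseteq> ?K" by (rule Poly_Mapping.keys_add)
  then show "lin h (x + y) = lin h x + lin h y"
    by (simp add: lin_superset[of ?K] lookup_add V.scale_left_distrib sum.distrib)
next
  fix c and x :: "'a \<Rightarrow>\<^sub>0 'k"
  have "Poly_Mapping.keys (scl c x) \<subseteq> Poly_Mapping.keys x" by (auto simp: in_keys_iff)
  then have "lin h (scl c x) = (\<Sum>u\<in>Poly_Mapping.keys x. scl (c * Poly_Mapping.lookup x u) (h u))"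
    by (subst lin_superset) auto
  then show "lin h (scl c x) = scl c (lin h x)"
    by (simp add: lin_def V.scale_sum_right)
qed

lemma lookup_mon: "Poly_Mapping.lookup (mon u) v = (if u = v then 1 else 0)"
  by (simp add: mon_def lookup_single when_def)

lemma keys_mon [simp]: "Poly_Mapping.keys (mon u :: ('x, 'o, 'k::field) oalg) = {u}"
  by (simp add: mon_def)

lemma lin_mon [simp]: "lin h (mon u) = h u"
  by (simp add: lin_def lookup_mon)

lemma lookup_sum: "Poly_Mapping.lookup (sum f A) x = (\<Sum>a\<in>A. Poly_Mapping.lookup (f a) x)"
  by (induction A rule: infinite_finite_induct) (auto simp: lookup_add)

lemma lin_mon_id [simp]: "lin mon f = f"
  by (rule poly_mapping_eqI)
    (simp add: lin_def lookup_sum lookup_mon in_keys_iff if_distrib[of "(*) _"] cong: if_cong)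

lemma linmap_eq_lin: "linmap g \<Longrightarrow> g f = lin (\<lambda>u. g (mon u)) f"
proof -
  assume g: "linmap g"
  have "g f = g (lin mon f)" by simp
  also have "\<dots> = lin (\<lambda>u. g (mon u)) f"
    unfolding lin_def by (simp add: module_hom.sum[OF g] module_hom.scale[OF g])
  finally show ?thesis .
qed

lemma linmap_ext:
  assumes "linmap g" "linmap h" "\<And>u. u \<in> Poly_Mapping.keys f \<Longrightarrow> g (mon u) = h (mon u)"
  shows "g f = h f"
proof -
  have "g f = lin (\<lambda>u. g (mon u)) f" using assms(1) by (rule linmap_eq_lin)
  also have "\<dots> = lin (\<lambda>u. h (mon u)) f" unfolding lin_def using assms(3) by simp
  also have "\<dots> = h f" using assms(2) by (rule linmap_eq_lin[symmetric])
  finally show ?thesis .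
qed

lemma linmap_lin_param: "(\<And>u. linmap (B u)) \<Longrightarrow> linmap (\<lambda>x. lin (\<lambda>u. B u x) f)"
  unfolding lin_def
  by (rule linmapI) (simp_all add: module_hom.add[of scl scl] module_hom.scale[of scl scl]
      V.scale_right_distrib sum.distrib V.scale_sum_right mult.commute)

lemma linmap_zero: "linmap (\<lambda>x. 0)"
  by (rule linmapI) simp_all

lemma linmap_minus: "linmap g \<Longrightarrow> linmap h \<Longrightarrow> linmap (\<lambda>x. g x - h x)"
  by (rule linmapI) (simp_all add: module_hom.add module_hom.scale V.scale_right_diff_distrib)

section \<open>Products, commutators and operators\<close>

lemma mul_lin: "mul f g = lin (\<lambda>u. lin (\<lambda>v. mon (u @ v)) g) f"
  by (simp add: mul_def lin_def V.scale_sum_right)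

lemma linmap_mul_left: "linmap (\<lambda>f. mul f g)"
  unfolding mul_lin by (rule linmap_lin)

lemma linmap_mul_right: "linmap (mul f)"
  unfolding mul_lin[abs_def] by (intro linmap_lin_param linmap_lin)

lemma mul_mon [simp]: "mul (mon u) (mon v) = mon (u @ v)"
  by (simp add: mul_lin)

lemma mul_assoc: "mul (mul f g) h = mul f (mul g h)"
proof -
  note L = linmap_mul_left linmap_mul_right
  have 1: "mul (mul (mon u) (mon v)) h = mul (mon u) (mul (mon v) h)" for u v
    by (rule linmap_ext[OF L(2) linmap_compose[OF L(2) L(2)]]) simp
  have 2: "mul (mul (mon u) g) h = mul (mon u) (mul g h)" for u
    by (rule linmap_ext[OF linmap_compose[OF L(1) L(2)] linmap_compose[OF L(2) L(1)]]) (rule 1)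
  show ?thesis
    by (rule linmap_ext[OF linmap_compose[OF L(1) L(1)] L(1)]) (rule 2)
qed

lemma linmap_comm_left: "linmap (\<lambda>f. comm f g)"
  unfolding comm_def by (intro linmap_minus linmap_mul_left linmap_mul_right)

lemma linmap_comm_right: "linmap (comm f)"
  unfolding comm_def[abs_def] by (intro linmap_minus linmap_mul_left linmap_mul_right)

lemma comm_anti: "comm f g = - comm g f"
  by (simp add: comm_def)

lemma comm_self [simp]: "comm f f = 0"
  by (simp add: comm_def)

lemma comm_jacobi: "comm (comm a b) c = comm (comm a c) b + comm a (comm b c)"
  unfolding comm_def
  by (simp add: module_hom.diff[OF linmap_mul_left] module_hom.diff[OF linmap_mul_right] mul_assoc)

text \<open>The sum over \<open>listset\<close> in \<open>oper\<close> as an iterated linear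
  extension; in this form linearity in each argument follows by induction on the arguments before
  it.\<close>

primrec mlin :: "('a \<Rightarrow>\<^sub>0 'k::field) list \<Rightarrow> ('a list \<Rightarrow> ('b \<Rightarrow>\<^sub>0 'k)) \<Rightarrow> ('b \<Rightarrow>\<^sub>0 'k)" where
  "mlin [] h = h []"
| "mlin (f # fs) h = lin (\<lambda>u. mlin fs (\<lambda>us. h (u # us))) f"

lemma mlin_listset:
  "(\<Sum>us\<in>listset (map Poly_Mapping.keys fs).
      scl (\<Prod>i<length fs. Poly_Mapping.lookup (fs ! i) (us ! i)) (h us)) = mlin fs h"
proof (induction fs arbitrary: h)
  case (Cons f fs)
  let ?L = "listset (map Poly_Mapping.keys fs)"
  have "listset (map Poly_Mapping.keys (f # fs)) = (\<lambda>(u, us). u # us) ` (Poly_Mapping.keys f \<times> ?L)"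
    by (auto simp: set_Cons_def)
  moreover have "inj_on (\<lambda>(u, us). u # us) (Poly_Mapping.keys f \<times> ?L)"
    by (auto simp: inj_on_def)
  ultimately have "(\<Sum>us\<in>listset (map Poly_Mapping.keys (f # fs)).
      scl (\<Prod>i<length (f # fs). Poly_Mapping.lookup ((f # fs) ! i) (us ! i)) (h us)) =
    (\<Sum>(u, us)\<in>Poly_Mapping.keys f \<times> ?L. scl (Poly_Mapping.lookup f u)
      (scl (\<Prod>i<length fs. Poly_Mapping.lookup (fs ! i) (us ! i)) (h (u # us))))"
    by (simp add: sum.reindex prod.lessThan_Suc_shift case_prod_unfold del: prod.lessThan_Suc)
  also have "\<dots> = (\<Sum>u\<in>Poly_Mapping.keys f. scl (Poly_Mapping.lookup f u)
      (\<Sum>us\<in>?L. scl (\<Prod>i<length fs. Poly_Mapping.lookup (fs ! i) (us ! i)) (h (u # us))))"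
    by (simp add: sum.cartesian_product[symmetric] V.scale_sum_right)
  also have "\<dots> = mlin (f # fs) h"
    unfolding Cons by (simp add: lin_def)
  finally show ?case .
qed simp

lemma oper_mlin: "oper \<omega> fs = mlin fs (\<lambda>us. mon [Op \<omega> us])"
  by (simp add: oper_def mlin_listset)

lemma linmap_mlin: "linmap (\<lambda>x. mlin (as @ x # bs) h)"
  by (induction as arbitrary: h) (auto intro!: linmap_lin linmap_lin_param)

lemma mlin_mon: "mlin (map mon us) h = h us"
  by (induction us arbitrary: h) auto

lemma linmap_oper: "linmap (\<lambda>x. oper \<omega> (as @ x # bs))"
  unfolding oper_mlin by (rule linmap_mlin)

lemma oper_mon: "oper \<omega> (map mon us) = mon [Op \<omega> us]"
  by (simp add: oper_mlin mlin_mon)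

text \<open>Arguments are replaced from left to right by elements of their spanning sets. The sets
  may differ by position, as needed for an operator with one argument in an ideal and the others
  arbitrary.\<close>

lemma multilinear_span:
  assumes M: "\<And>as bs. linmap (\<lambda>x. M (as @ x # bs))"
    and xs: "list_all2 (\<lambda>x B. x \<in> V.span B) xs Bs"
    and C: "\<And>bs. list_all2 (\<in>) bs Bs \<Longrightarrow> M bs \<in> V.span C"
  shows "M xs \<in> V.span C"
proof -
  have "list_all2 (\<in>) bs As \<Longrightarrow> list_all2 (\<lambda>x B. x \<in> V.span B) ys Cs \<Longrightarrow> As @ Cs = Bs \<Longrightarrow>
      M (bs @ ys) \<in> V.span C" for bs ys As Cs
  proof (induction ys arbitrary: bs As Cs)
    case Nil
    then show ?case using C by simp
  next
    case (Cons y ys)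
    then obtain B Cs' where Cs: "Cs = B # Cs'" "y \<in> V.span B" "list_all2 (\<lambda>x B. x \<in> V.span B) ys Cs'"
      by (auto simp: list_all2_Cons1)
    have "M (bs @ b # ys) \<in> V.span C" if "b \<in> B" for b
      using Cons.IH[of "bs @ [b]" "As @ [B]" Cs'] Cons.prems Cs that by (simp add: list_all2_appendI)
    then show ?case using linmap_span[OF M, of y B bs ys C] Cs by simp
  qed
  from this[of "[]" "[]" xs Bs] xs show ?thesis by simp
qed

lemma multilinear_span_replicate:
  assumes "\<And>as bs. linmap (\<lambda>x. M (as @ x # bs))"
    and "set xs \<subseteq> V.span B"
    and "\<And>bs. length bs = length xs \<Longrightarrow> set bs \<subseteq> B \<Longrightarrow> M bs \<in> V.span C"
  shows "M xs \<in> V.span C"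
proof (rule multilinear_span[OF assms(1), of xs "replicate (length xs) B"])
  show "list_all2 (\<lambda>x B. x \<in> V.span B) xs (replicate (length xs) B)"
    using assms(2) by (auto simp: list_all2_conv_all_nth)
  fix bs assume bs: "list_all2 (\<in>) bs (replicate (length xs) B)"
  then have "length bs = length xs" using list_all2_lengthD by fastforce
  moreover have "set bs \<subseteq> B" using bs by (auto simp: list_all2_conv_all_nth in_set_conv_nth)
  ultimately show "M bs \<in> V.span C" by (rule assms(3))
qed

section \<open>Lower terms\<close>

text \<open>\<open>G\<close> is a set of elements labelled with words; the label of an element is meant to be its
  leading word.\<close>

definition low :: "(('x::wellorder, 'o::wellorder) oword \<times> ('y, 'o, 'k::field) oalg) set \<Rightarrow>
    ('x, 'o) oword \<Rightarrow> ('y, 'o, 'k) oalg set" where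
  "low G w = V.span {e. \<exists>u. (u, e) \<in> G \<and> dl_gt w u}"

lemma low_base: "(u, e) \<in> G \<Longrightarrow> dl_gt w u \<Longrightarrow> e \<in> low G w"
  unfolding low_def by (rule V.span_base) blast

lemma low_mono: "dl_gt w w' \<Longrightarrow> low G w' \<subseteq> low G w"
  unfolding low_def by (rule V.span_mono) (auto intro: dl_gt_trans)

lemma low_mono': "G \<subseteq> H \<Longrightarrow> low G w \<subseteq> low H w"
  unfolding low_def by (rule V.span_mono) auto

lemma low_zero: "0 \<in> low G w"
  and low_add: "x \<in> low G w \<Longrightarrow> y \<in> low G w \<Longrightarrow> x + y \<in> low G w"
  and low_diff: "x \<in> low G w \<Longrightarrow> y \<in> low G w \<Longrightarrow> x - y \<in> low G w"
  and low_neg: "x \<in> low G w \<Longrightarrow> - x \<in> low G w"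
  and low_scl: "x \<in> low G w \<Longrightarrow> scl c x \<in> low G w"
  unfolding low_def by (auto intro: V.span_zero V.span_add V.span_diff V.span_neg V.span_scale)

lemma linmap_low:
  assumes "linmap h" "x \<in> low G w" "\<And>u e. (u, e) \<in> G \<Longrightarrow> dl_gt w u \<Longrightarrow> h e \<in> low H v"
  shows "h x \<in> low H v"
  using linmap_span[OF assms(1), of x "{e. \<exists>u. (u, e) \<in> G \<and> dl_gt w u}"] assms(2,3)
  unfolding low_def by blast

text \<open>An entry \<open>(G, (u, e), x)\<close> of \<open>ts\<close> stands for an argument \<open>x\<close> that is the sum of the element \<open>e\<close>
  of \<open>G\<close> with label \<open>u\<close> and of lower terms.\<close>

lemma multi_low:
  fixes M :: "('y, 'o::wellorder, 'k::field) oalg list \<Rightarrow> ('y, 'o, 'k) oalg"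
    and c :: "('x::wellorder, 'o) oword list \<Rightarrow> ('x, 'o) oword"
    and ts :: "((('x, 'o) oword \<times> ('y, 'o, 'k) oalg) set \<times> (('x, 'o) oword \<times> ('y, 'o, 'k) oalg) \<times>
      ('y, 'o, 'k) oalg) list"
  assumes M: "\<And>as bs. linmap (\<lambda>x. M (as @ x # bs))"
    and c: "\<And>as u v bs. dl_gt u v \<Longrightarrow> dl_gt (c (as @ u # bs)) (c (as @ v # bs))"
    and H: "\<And>qs. map fst qs = map fst ts \<Longrightarrow> \<forall>(G, p)\<in>set qs. p \<in> G \<Longrightarrow>
      (c (map (fst \<circ> snd) qs), M (map (snd \<circ> snd) qs)) \<in> H"
    and ts: "\<And>G u e x. (G, (u, e), x) \<in> set ts \<Longrightarrow> (u, e) \<in> G \<and> x - e \<in> low G u"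
  shows "M (map (snd \<circ> snd) ts) - M (map (snd \<circ> fst \<circ> snd) ts) \<in> low H (c (map (fst \<circ> fst \<circ> snd) ts))"
proof -
  let ?x = "\<lambda>ts. map (snd \<circ> snd) ts" and ?e = "\<lambda>ts. map (snd \<circ> fst \<circ> snd) ts"
    and ?u = "\<lambda>ts. map (fst \<circ> fst \<circ> snd) ts"
  let ?ok = "\<lambda>qs. \<forall>(G, p)\<in>set qs. p \<in> G"
  \<comment> \<open>Induction along the arguments. Those in \<open>qs\<close> are already replaced
    by arbitrary members of their sets, because expanding \<open>x - e\<close> puts members with
    smaller labels in the place of \<open>e\<close>.\<close>
  have "map fst qs @ map fst ss = map fst ts \<Longrightarrow> ?ok qs \<Longrightarrow> set ss \<subseteq> set ts \<Longrightarrow>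
      M (map (snd \<circ> snd) qs @ ?x ss) - M (map (snd \<circ> snd) qs @ ?e ss)
        \<in> low H (c (map (fst \<circ> snd) qs @ ?u ss))" for qs ss
  proof (induction ss arbitrary: qs)
    case Nil
    then show ?case by (simp add: low_zero)
  next
    case (Cons t ss)
    obtain G u e x where t: "t = (G, (u, e), x)" by (metis prod.collapse)
    have ue: "(u, e) \<in> G" "x - e \<in> low G u" using ts[of G u e x] Cons.prems(3) t by auto
    let ?Q = "map (snd \<circ> snd) qs" and ?U = "map (fst \<circ> snd) qs"
    let ?w = "c (?U @ u # ?u ss)"
    have IH: "M (?Q @ e' # ?x ss) - M (?Q @ e' # ?e ss) \<in> low H (c (?U @ u' # ?u ss))"
      if "(u', e') \<in> G" for u' e'
      using Cons.IH[of "qs @ [(G, (u', e'))]"] Cons.prems that t by (simp add: comp_def)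
    have "M (?Q @ (x - e) # ?x ss) \<in> low H ?w"
    proof (rule linmap_low[OF M ue(2)])
      fix u' e' assume u': "(u', e') \<in> G" "dl_gt u u'"
      let ?w' = "c (?U @ u' # ?u ss)"
      have w': "dl_gt ?w ?w'" using c u'(2) by blast
      let ?qs = "qs @ (G, (u', e')) # map (\<lambda>(G, p, x). (G, p)) ss"
      have "map fst ?qs = map fst ts" using Cons.prems(1) t by (simp add: case_prod_unfold comp_def)
      moreover have "?ok ?qs" using Cons.prems(2,3) ts u' by auto
      ultimately have "(?w', M (?Q @ e' # ?e ss)) \<in> H"
        using H[of ?qs] by (simp add: case_prod_unfold comp_def)
      then have "M (?Q @ e' # ?e ss) \<in> low H ?w" using w' low_base by blast
      moreover have "M (?Q @ e' # ?x ss) - M (?Q @ e' # ?e ss) \<in> low H ?w"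
        using IH[OF u'(1)] low_mono[OF w'] by blast
      ultimately have "M (?Q @ e' # ?x ss) - M (?Q @ e' # ?e ss) + M (?Q @ e' # ?e ss) \<in> low H ?w"
        using low_add by blast
      then show "M (?Q @ e' # ?x ss) \<in> low H ?w" by simp
    qed
    then have "M (?Q @ x # ?x ss) - M (?Q @ e # ?x ss) \<in> low H ?w"
      by (simp add: module_hom.diff[OF M])
    from low_add[OF this IH[OF ue(1)]]
    show ?case using t by (simp add: comp_def)
  qed
  from this[of "[]" ts] show ?thesis by simp
qed

lemma mul_low:
  assumes H: "\<And>u e v e'. (u, e) \<in> G1 \<Longrightarrow> (v, e') \<in> G2 \<Longrightarrow> (u @ v, mul e e') \<in> H"
    and "(u, e) \<in> G1" "x - e \<in> low G1 u" "(v, e') \<in> G2" "y - e' \<in> low G2 v"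
  shows "mul x y - mul e e' \<in> low H (u @ v)"
proof -
  \<comment> \<open>Lists of length other than 2 are sent to 0, which keeps \<open>?M\<close> linear
    in every argument.\<close>
  let ?M = "\<lambda>l. case l of [a, b] \<Rightarrow> mul a b | _ \<Rightarrow> 0"
  let ?ts = "[(G1, (u, e), x), (G2, (v, e'), y)]"
  have "?M (map (snd \<circ> snd) ?ts) - ?M (map (snd \<circ> fst \<circ> snd) ?ts)
      \<in> low H (concat (map (fst \<circ> fst \<circ> snd) ?ts))"
  proof (rule multi_low)
    show "linmap (\<lambda>x. ?M (as @ x # bs))" for as bs
    proof (cases as)
      case Nil
      then show ?thesis
        by (cases bs; cases "tl bs") (auto intro: linmap_mul_left linmap_zero)
    next
      case (Cons a as')
      then show ?thesis
        by (cases as'; cases "tl as'"; cases bs) (auto intro: linmap_mul_right linmap_zero)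
    qed
    show "dl_gt u v \<Longrightarrow> dl_gt (concat (as @ u # bs)) (concat (as @ v # bs))" for as u v bs
      using dl_gt_append[of u v "concat as" "concat bs"] by simp
  next
    fix qs assume "map fst qs = map fst ?ts" and ok: "\<forall>(G, p)\<in>set qs. p \<in> G"
    then obtain p1 p2 where "qs = [(G1, p1), (G2, p2)]" by (auto simp: map_eq_Cons_conv)
    then show "(concat (map (fst \<circ> snd) qs), ?M (map (snd \<circ> snd) qs)) \<in> H"
      using ok H[of "fst p1" "snd p1" "fst p2" "snd p2"] by simp
  qed (use assms in auto)
  then show ?thesis by simp
qed

text \<open>\<open>mul y x\<close> has the leading label \<open>v @ u\<close>, which
  \<open>gt\<close> places below \<open>u @ v\<close>; so it counts as lower together with its
  leading term. For this reason both products of generators have to lie in \<open>H\<close>.\<close>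

lemma comm_low:
  assumes H: "\<And>u e v e'. (u, e) \<in> G1 \<Longrightarrow> (v, e') \<in> G2 \<Longrightarrow> (u @ v, mul e e') \<in> H \<and> (v @ u, mul e' e) \<in> H"
    and x: "(u, e) \<in> G1" "x - e \<in> low G1 u" and y: "(v, e') \<in> G2" "y - e' \<in> low G2 v"
    and gt: "dl_gt (u @ v) (v @ u)"
  shows "comm x y - mul e e' \<in> low H (u @ v)"
proof -
  have xy: "mul x y - mul e e' \<in> low H (u @ v)" using mul_low[of G1 G2 H] H x y by blast
  have "mul y x - mul e' e \<in> low H (v @ u)" using mul_low[of G2 G1 H] H x y by blast
  then have "mul y x - mul e' e \<in> low H (u @ v)" using low_mono[OF gt] by blast
  moreover have "mul e' e \<in> low H (u @ v)" using H[OF x(1) y(1)] gt low_base by blast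
  ultimately have "mul y x - mul e' e + mul e' e \<in> low H (u @ v)" by (rule low_add)
  then have "(mul x y - mul e e') - mul y x \<in> low H (u @ v)" using low_diff[OF xy] by simp
  then show ?thesis by (simp add: comm_def algebra_simps)
qed

section \<open>Leading words\<close>

lemma lead_eqI:
  assumes "u \<in> Poly_Mapping.keys f" "\<And>v. v \<in> Poly_Mapping.keys f \<Longrightarrow> v \<noteq> u \<Longrightarrow> dl_gt u v"
  shows "lead f = u"
  unfolding lead_def
proof (rule the_equality)
  fix w assume w: "w \<in> Poly_Mapping.keys f \<and> (\<forall>v\<in>Poly_Mapping.keys f. v \<noteq> w \<longrightarrow> dl_gt w v)"
  then show "w = u" using assms dl_gt_trans dl_gt_irrefl by metis
qed (use assms in auto)

context operated
begin

abbreviation MW :: "(('x, 'o) oword \<times> ('x, 'o, 'k::field) oalg) set" where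
  "MW \<equiv> {(u, mon u) | u. u \<in> OW}"

abbreviation FA :: "('x, 'o, 'k::field) oalg set" where
  "FA \<equiv> free_alg X Om ar"

lemma ex_dl_max:
  "finite T \<Longrightarrow> T \<noteq> {} \<Longrightarrow> T \<subseteq> OW \<Longrightarrow> \<exists>m\<in>T. \<forall>w\<in>T. w \<noteq> m \<longrightarrow> dl_gt m w"
proof (induction T rule: finite_ne_induct)
  case (insert w T)
  then obtain m where m: "m \<in> T" "\<forall>w\<in>T. w \<noteq> m \<longrightarrow> dl_gt m w" by auto
  have "m \<in> OW" "w \<in> OW" "m \<noteq> w" using m(1) insert by auto
  then have "set m \<subseteq> PR" "set w \<subseteq> PR" "m \<noteq> w" by (auto simp: owords_iff)
  then consider "dl_gt m w" | "dl_gt w m" using dl_gt_total by blast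
  then show ?case
  proof cases
    case 1
    then show ?thesis using m by (intro bexI[of _ m]) auto
  next
    case 2
    then have "\<forall>x\<in>insert w T. x \<noteq> w \<longrightarrow> dl_gt w x" using m(2) dl_gt_trans by (metis insertE)
    then show ?thesis by blast
  qed
qed simp

lemma lead_keys:
  assumes "f \<noteq> 0" "f \<in> FA"
  shows "lead f \<in> Poly_Mapping.keys f" "v \<in> Poly_Mapping.keys f \<Longrightarrow> v \<noteq> lead f \<Longrightarrow> dl_gt (lead f) v"
proof -
  obtain m where "m \<in> Poly_Mapping.keys f" "\<forall>w\<in>Poly_Mapping.keys f. w \<noteq> m \<longrightarrow> dl_gt m w"
    using ex_dl_max[of "Poly_Mapping.keys f"] assms by (auto simp: free_alg_def)
  then show "lead f \<in> Poly_Mapping.keys f" "v \<in> Poly_Mapping.keys f \<Longrightarrow> v \<noteq> lead f \<Longrightarrow> dl_gt (lead f) v"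
    using lead_eqI[of m f] by auto
qed

lemma lead_OW: "f \<noteq> 0 \<Longrightarrow> f \<in> FA \<Longrightarrow> lead f \<in> OW"
  using lead_keys by (auto simp: free_alg_def)

lemma subspace_keys: "V.subspace {f :: 'a \<Rightarrow>\<^sub>0 'k::field. Poly_Mapping.keys f \<subseteq> K}"
  unfolding V.subspace_def
proof (intro conjI ballI allI)
  fix x y :: "'a \<Rightarrow>\<^sub>0 'k" assume "x \<in> {f. Poly_Mapping.keys f \<subseteq> K}" "y \<in> {f. Poly_Mapping.keys f \<subseteq> K}"
  then show "x + y \<in> {f. Poly_Mapping.keys f \<subseteq> K}" using Poly_Mapping.keys_add[of x y] by blast
qed (auto simp: in_keys_iff)

lemma low_MW_iff: "f \<in> low MW w \<longleftrightarrow> Poly_Mapping.keys f \<subseteq> {u \<in> OW. dl_gt w u}"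
proof
  assume "f \<in> low MW w"
  moreover have "low MW w \<subseteq> {f. Poly_Mapping.keys f \<subseteq> {u \<in> OW. dl_gt w u}}"
    unfolding low_def by (rule V.span_minimal) (auto simp: subspace_keys)
  ultimately show "Poly_Mapping.keys f \<subseteq> {u \<in> OW. dl_gt w u}" by auto
next
  assume "Poly_Mapping.keys f \<subseteq> {u \<in> OW. dl_gt w u}"
  then have "lin mon f \<in> low MW w"
    unfolding lin_def low_def by (intro V.span_sum V.span_scale V.span_base) auto
  then show "f \<in> low MW w" by simp
qed

text \<open>\<open>f - mon w \<in> low MW w\<close> is the form in which "monic with leading word
  \<open>w\<close>" is used from here on, since memberships in spans can be added and transported by
  linear maps.\<close>

lemma lead_low:
  assumes f: "f - mon w \<in> low MW w" and w: "w \<in> OW"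
  shows "lead f = w" "Poly_Mapping.lookup f w = 1" "f \<noteq> 0" "f \<in> FA" "monic f"
proof -
  have keys: "Poly_Mapping.keys (f - mon w) \<subseteq> {u \<in> OW. dl_gt w u}"
    using f low_MW_iff by blast
  then have "Poly_Mapping.lookup (f - mon w) w = 0" by (auto simp: in_keys_iff)
  then show one: "Poly_Mapping.lookup f w = 1" by (simp add: lookup_minus lookup_mon)
  have others: "v \<in> {u \<in> OW. dl_gt w u}" if "v \<in> Poly_Mapping.keys f" "v \<noteq> w" for v
  proof -
    have "v \<in> Poly_Mapping.keys (f - mon w)" using that by (simp add: in_keys_iff lookup_minus lookup_mon)
    then show ?thesis using keys by blast
  qed
  show lead: "lead f = w" using one others by (intro lead_eqI) (auto simp: in_keys_iff)
  show "f \<noteq> 0" using one by auto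
  then show "monic f" using lead one by (simp add: monic_def)
  show "f \<in> FA" using others w by (auto simp: free_alg_def)
qed

lemma monic_low:
  assumes "monic f" "f \<in> FA"
  shows "f - mon (lead f) \<in> low MW (lead f)"
  unfolding low_MW_iff
proof
  fix v assume v: "v \<in> Poly_Mapping.keys (f - mon (lead f))"
  have f: "f \<noteq> 0" "Poly_Mapping.lookup f (lead f) = 1" using assms by (auto simp: monic_def)
  then have "v \<noteq> lead f" using v by (auto simp: in_keys_iff lookup_minus lookup_mon)
  then have "v \<in> Poly_Mapping.keys f" using v by (auto simp: in_keys_iff lookup_minus lookup_mon)
  then show "v \<in> {u \<in> OW. dl_gt (lead f) u}"
    using lead_keys[OF f(1) assms(2)] \<open>v \<noteq> lead f\<close> assms(2) by (auto simp: free_alg_def)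
qed

text \<open>The greatest word of \<open>T\<close> occurs in its own summand only, as all words of
  the other summands are smaller; so it cannot cancel.\<close>

lemma lead_sum:
  assumes "finite T" "T \<noteq> {}" "T \<subseteq> OW" "\<And>w. w \<in> T \<Longrightarrow> F w - mon w \<in> low MW w" "\<And>w. w \<in> T \<Longrightarrow> c w \<noteq> 0"
  shows "(\<Sum>w\<in>T. scl (c w) (F w)) \<noteq> 0" "lead (\<Sum>w\<in>T. scl (c w) (F w)) \<in> T"
proof -
  let ?f = "\<Sum>w\<in>T. scl (c w) (F w)"
  obtain m where m: "m \<in> T" "\<And>w. w \<in> T \<Longrightarrow> w \<noteq> m \<Longrightarrow> dl_gt m w" using ex_dl_max[OF assms(1-3)] by blast
  have zero: "Poly_Mapping.lookup (F w) v = 0" if w: "w \<in> T" and v: "v \<noteq> w" "\<not> dl_gt w v" for w v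
  proof -
    have "v \<notin> Poly_Mapping.keys (F w - mon w)" using assms(4)[OF w] v low_MW_iff by blast
    then show ?thesis using v by (auto simp: in_keys_iff lookup_minus lookup_mon)
  qed
  have "Poly_Mapping.lookup ?f m = (\<Sum>w\<in>T. c w * Poly_Mapping.lookup (F w) m)"
    by (simp add: lookup_sum)
  also have "\<dots> = (\<Sum>w\<in>{m}. c w * Poly_Mapping.lookup (F w) m)"
  proof (intro sum.mono_neutral_right ballI)
    fix w assume "w \<in> T - {m}"
    then show "c w * Poly_Mapping.lookup (F w) m = 0"
      using zero[of w m] m(2)[of w] dl_gt_trans[of m w m] by auto
  qed (use assms(1) m in auto)
  also have "\<dots> = c m" using lead_low(2)[OF assms(4)[OF m(1)]] m assms(3) by auto
  finally have m_key: "m \<in> Poly_Mapping.keys ?f" using assms(5) m by (simp add: in_keys_iff)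
  then show "?f \<noteq> 0" by auto
  have "lead ?f = m"
  proof (rule lead_eqI[OF m_key])
    fix v assume v: "v \<in> Poly_Mapping.keys ?f" "v \<noteq> m"
    then obtain w where w: "w \<in> T" "Poly_Mapping.lookup (F w) v \<noteq> 0"
      by (auto simp: in_keys_iff lookup_sum) (metis (mono_tags, lifting) mult_zero_right sum.neutral)
    then show "dl_gt m v" using zero[OF w(1), of v] m(2)[OF w(1)] v dl_gt_trans by metis
  qed
  then show "lead ?f \<in> T" using m by simp
qed

lemma FA_subspace: "V.subspace FA"
  unfolding free_alg_def by (rule subspace_keys)

lemma mon_FA: "u \<in> OW \<Longrightarrow> mon u \<in> FA"
  by (simp add: free_alg_def)

lemma FA_span: "FA = V.span (mon ` OW)"
proof
  show "V.span (mon ` OW) \<subseteq> FA"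
    using mon_FA by (intro V.span_minimal FA_subspace) auto
  show "FA \<subseteq> V.span (mon ` OW :: ('x, 'o, 'k::field) oalg set)"
  proof
    fix f :: "('x, 'o, 'k) oalg" assume "f \<in> FA"
    then have "lin mon f \<in> V.span (mon ` OW)"
      unfolding lin_def by (intro V.span_sum V.span_scale V.span_base) (auto simp: free_alg_def)
    then show "f \<in> V.span (mon ` OW)" by simp
  qed
qed

lemma mul_FA: "f \<in> FA \<Longrightarrow> g \<in> FA \<Longrightarrow> mul f g \<in> FA"
proof -
  assume f: "f \<in> FA" and g: "g \<in> FA"
  have "mul (mon u) g \<in> V.span (mon ` OW)" if "u \<in> OW" for u
    using that g unfolding FA_span
    by (rule_tac linmap_span[OF linmap_mul_right]) (auto intro!: V.span_base simp: owords_iff)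
  then show ?thesis using f unfolding FA_span by (rule_tac linmap_span[OF linmap_mul_left, of f]) auto
qed

lemma comm_FA: "f \<in> FA \<Longrightarrow> g \<in> FA \<Longrightarrow> comm f g \<in> FA"
  unfolding comm_def using mul_FA V.subspace_diff[OF FA_subspace] by blast

lemma map_imageE:
  assumes "set bs \<subseteq> f ` A"
  obtains us where "bs = map f us" "set us \<subseteq> A"
proof -
  have "bs \<in> lists (f ` A)" using assms by auto
  then show ?thesis using that by (auto simp: lists_image)
qed

lemma oper_FA:
  fixes fs :: "('x, 'o, 'k::field) oalg list"
  assumes "\<omega> \<in> Om" "length fs = ar \<omega>" "set fs \<subseteq> FA"
  shows "oper \<omega> fs \<in> FA"
  unfolding FA_span
proof (rule multilinear_span_replicate[OF linmap_oper])
  show "set fs \<subseteq> V.span (mon ` OW)" using assms(3) unfolding FA_span .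
  fix bs :: "('x, 'o, 'k) oalg list" assume bs: "length bs = length fs" "set bs \<subseteq> mon ` OW"
  then obtain us where us: "bs = map mon us" "set us \<subseteq> OW"
    by (elim map_imageE)
  then have "[Op \<omega> us] \<in> OW" using bs assms by (simp add: owords_iff Op_PR)
  then show "oper \<omega> bs \<in> V.span (mon ` OW)" using us by (auto simp: oper_mon intro: V.span_base)
qed

end

section \<open>Bracketed words and their leading words\<close>

lemma lie_elem_simps [simp]:
  "lie_elem (NVar x) = mon [Var x]"
  "lie_elem (NOp \<omega> ts) = oper \<omega> (map lie_elem ts)"
  "lie_elem (NBr s t) = comm (lie_elem s) (lie_elem t)"
  by (simp_all add: lie_elem_def[abs_def])

lemma bracket_prime_Op [simp]: "bracket_prime (Op \<omega> us) = NOp \<omega> (map bracket us)"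
  by (simp add: bracket_def[abs_def] comp_def)

declare bracket_prime.simps(2) [simp del]

context operated
begin

text \<open>Only that property of Lyndon-Shirshov bracketings is kept which fixes leading words: at
  every bracket the product in the written order is the greater one. It passes to subtrees, in
  particular to those beside a hole.\<close>

primrec good :: "('x, 'o) naword \<Rightarrow> bool" where
  "good (NVar x) \<longleftrightarrow> x \<in> X"
| "good (NOp \<omega> ts) \<longleftrightarrow> \<omega> \<in> Om \<and> length ts = ar \<omega> \<and> (\<forall>b\<in>set (map good ts). b)"
| "good (NBr s t) \<longleftrightarrow> good s \<and> good t \<and>
     dl_gt (assoc_word s @ assoc_word t) (assoc_word t @ assoc_word s)"

lemma good_word: "good T \<Longrightarrow> assoc_word T \<in> OW"
proof (induction T)
  case (NOp \<omega> ts)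
  then have "set (map assoc_word ts) \<subseteq> OW" by auto
  then show ?case using NOp.prems by (simp add: owords_iff[of "[_]"] Op_PR)
qed (auto simp: owords_iff Var_PR)

lemma mul_MW: "(u, e) \<in> MW \<Longrightarrow> (v, e') \<in> MW \<Longrightarrow> (u @ v, mul e e') \<in> MW"
  by (auto simp: owords_iff)

lemma good_low:
  "good T \<Longrightarrow> lie_elem T - mon (assoc_word T) \<in> low (MW :: (_ \<times> ('x, 'o, 'k::field) oalg) set) (assoc_word T)"
proof (induction T)
  case (NVar x)
  then show ?case by (simp add: low_zero)
next
  case (NBr s t)
  have OW: "assoc_word s \<in> OW" "assoc_word t \<in> OW" using NBr.prems good_word by auto
  have "comm (lie_elem s) (lie_elem t) - mul (mon (assoc_word s)) (mon (assoc_word t))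
      \<in> low (MW :: (_ \<times> ('x, 'o, 'k) oalg) set) (assoc_word s @ assoc_word t)"
    by (rule comm_low[where ?G1.0 = MW and ?G2.0 = MW]) (use mul_MW NBr OW in auto)
  then show ?case by simp
next
  case (NOp \<omega> ts)
  let ?MW = "MW :: (('x, 'o) oword \<times> ('x, 'o, 'k) oalg) set"
  let ?ts = "map (\<lambda>t. (?MW, (assoc_word t, mon (assoc_word t) :: ('x, 'o, 'k) oalg),
    lie_elem t :: ('x, 'o, 'k) oalg)) ts"
  have "oper \<omega> (map (snd \<circ> snd) ?ts) - oper \<omega> (map (snd \<circ> fst \<circ> snd) ?ts)
      \<in> low ?MW [Op \<omega> (map (fst \<circ> fst \<circ> snd) ?ts)]"
  proof (rule multi_low[where M = "oper \<omega>" and c = "\<lambda>us. [Op \<omega> us]", OF linmap_oper])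
    show "dl_gt u v \<Longrightarrow> dl_gt [Op \<omega> (as @ u # bs)] [Op \<omega> (as @ v # bs)]"
      for u v :: "('x, 'o) oword" and as bs by (rule dl_gt_Op)
  next
    fix qs assume qs: "map fst qs = map fst ?ts" and ok: "\<forall>(G, p)\<in>set qs. p \<in> G"
    have "fst q = ?MW" if "q \<in> set qs" for q
    proof -
      have "fst q \<in> set (map fst qs)" using that by simp
      then show ?thesis unfolding qs by auto
    qed
    then have q: "snd q \<in> ?MW" if "q \<in> set qs" for q using ok that by (cases q) fastforce
    have "map (snd \<circ> snd) qs = map mon (map (fst \<circ> snd) qs)" using q by force
    then have "oper \<omega> (map (snd \<circ> snd) qs) = mon [Op \<omega> (map (fst \<circ> snd) qs)]"
      by (simp only: oper_mon)
    moreover have "set (map (fst \<circ> snd) qs) \<subseteq> OW" using q by force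
    moreover have "length (map (fst \<circ> snd) qs) = ar \<omega>"
      using arg_cong[OF qs, of length] NOp.prems by simp
    ultimately show "([Op \<omega> (map (fst \<circ> snd) qs)], oper \<omega> (map (snd \<circ> snd) qs)) \<in> ?MW"
      using NOp.prems by (simp add: owords_iff[of "[_]"] Op_PR)
  next
    show "(G, (u, e), x) \<in> set ?ts \<Longrightarrow> (u, e) \<in> G \<and> x - e \<in> low G u" for G u e x
      using NOp good_word by auto
  qed
  then show ?case
    by (simp add: comp_def oper_mon[of \<omega> "map assoc_word ts", simplified, symmetric])
qed

lemma lex_gt_rotate: "lex_gt prime_gt (u @ v) (v @ u) \<Longrightarrow> dl_gt (u @ v) (v @ u)"
  by (simp add: dl_gt_iff)

text \<open>The order on pairs reads first components only and is total merely on the graph of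
  \<open>bracket_prime\<close>. Transport along the map from \<open>p\<close> to
  \<open>(p, bracket_prime p)\<close> removes the pairs.\<close>

lemma bracket_eq:
  assumes "is_alsw prime_gt w" "set w \<subseteq> PR"
  shows "bracket w = graft bracket_prime (shirshov prime_gt w)"
proof -
  let ?h = "\<lambda>p. (p, bracket_prime p)"
  have "order_on (\<lambda>a b. prime_gt (fst a) (fst b)) (?h ` PR)"
  proof unfold_locales
    fix a b assume "a \<in> ?h ` PR" "b \<in> ?h ` PR" "a \<noteq> b"
    then show "prime_gt (fst a) (fst b) \<or> prime_gt (fst b) (fst a)" using prime_gt_total by fastforce
  qed (use prime_gt_trans in auto)
  then have "shirshov (\<lambda>a b. prime_gt (fst a) (fst b)) (map ?h w) = map_btree ?h (shirshov prime_gt w)"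
    using assms by (intro shirshov_map[OF lyn.order_on_axioms]) (auto simp: inj_on_def)
  moreover have "graft snd (map_btree ?h t) = graft bracket_prime t" for t
    by (induction t) auto
  ultimately show ?thesis by (simp add: bracket_def bracket_letters_def)
qed

lemma AW_PR: "w \<in> AW \<Longrightarrow> set w \<subseteq> PR"
  using oalsw_owords owords_iff by blast

lemma AW_alsw: "w \<in> AW \<Longrightarrow> is_alsw prime_gt w"
  by (simp add: oalsw_iff)

lemma AW_nonempty: "w \<in> AW \<Longrightarrow> w \<noteq> []"
  by (simp add: oalsw_iff is_alsw_def)

lemma assoc_graft:
  "(\<And>p. p \<in> set (leaves t) \<Longrightarrow> assoc_word (bracket_prime p) = [p]) \<Longrightarrow>
    assoc_word (graft bracket_prime t) = leaves t"
  by (induction t) auto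

lemma good_graft:
  assumes "is_nlsw prime_gt t"
    and "\<And>p. p \<in> set (leaves t) \<Longrightarrow> good (bracket_prime p) \<and> assoc_word (bracket_prime p) = [p]"
  shows "good (graft bracket_prime t)"
  using assms
proof (induction t)
  case (Branch s t)
  then have "is_alsw prime_gt (leaves s @ leaves t)" by simp
  then have "lex_gt prime_gt (leaves s @ leaves t) (leaves t @ leaves s)"
    unfolding is_alsw_def by simp
  then show ?case using Branch lex_gt_rotate by (simp add: assoc_graft)
qed simp

lemma bracket_prime_good: "p \<in> AP \<Longrightarrow> good (bracket_prime p) \<and> assoc_word (bracket_prime p) = [p]"
proof (induction p)
  case (Op \<omega> us)
  have us: "\<omega> \<in> Om" "length us = ar \<omega>" "set us \<subseteq> AW" using Op.prems by (auto simp: Op_AP)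
  have u: "good (bracket u) \<and> assoc_word (bracket u) = u" if u: "u \<in> set us" for u
  proof -
    have a: "is_alsw prime_gt u" "set u \<subseteq> PR" "set u \<subseteq> AP"
      using AW_PR[of u] oalsw_iff[of u] us(3) u by blast+
    then have "p \<in> set u \<Longrightarrow> good (bracket_prime p) \<and> assoc_word (bracket_prime p) = [p]" for p
      using Op.IH[OF u, of p] by blast
    then show ?thesis
      using good_graft[OF lyn.shirshov(1)[OF a(1,2)]] assoc_graft[of "shirshov prime_gt u"]
        lyn.shirshov(2)[OF a(1,2)] bracket_eq[OF a(1,2)] by auto
  qed
  then show ?case using us by (auto simp: map_idI)
qed (auto simp: Var_AP)

lemma good_bracket: "w \<in> AW \<Longrightarrow> good (bracket w)"
  and assoc_bracket: "w \<in> AW \<Longrightarrow> assoc_word (bracket w) = w"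
proof -
  assume w: "w \<in> AW"
  have p: "p \<in> set w \<Longrightarrow> good (bracket_prime p) \<and> assoc_word (bracket_prime p) = [p]" for p
    using bracket_prime_good w by (auto simp: oalsw_iff)
  note s = lyn.shirshov[OF AW_alsw[OF w] AW_PR[OF w]] bracket_eq[OF AW_alsw[OF w] AW_PR[OF w]]
  show "good (bracket w)" using good_graft[OF s(1)] p s by auto
  show "assoc_word (bracket w) = w" using assoc_graft[of "shirshov prime_gt w"] p s by auto
qed

abbreviation LB :: "('x, 'o) oword \<Rightarrow> ('x, 'o, 'k::field) oalg" where
  "LB w \<equiv> lie_elem (bracket w)"

lemma LB_low: "w \<in> AW \<Longrightarrow> LB w - mon w \<in> low MW w"
  using good_low[OF good_bracket, of w] by (simp add: assoc_bracket)

section \<open>The bracketings of Lyndon--Shirshov words span the free algebra\<close>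

lemma AW_append: "is_alsw prime_gt (u @ v) \<Longrightarrow> u \<in> AW \<Longrightarrow> v \<in> AW \<Longrightarrow> u @ v \<in> AW"
  by (simp add: oalsw_iff)

lemma LB_graft: "w \<in> AW \<Longrightarrow> LB w = lie_elem (graft bracket_prime (shirshov prime_gt w))"
  by (simp add: bracket_eq AW_alsw AW_PR)

text \<open>Subtrees of a standard bracketing are standard, hence they are the bracketings of their
  own words.\<close>

lemma LB_split:
  assumes u: "u \<in> AW" and t: "shirshov prime_gt u = Branch t1 t2"
  shows "u = leaves t1 @ leaves t2" "leaves t1 \<in> AW" "leaves t2 \<in> AW"
    "LB u = comm (LB (leaves t1)) (LB (leaves t2))"
proof -
  note s = lyn.shirshov[OF AW_alsw[OF u] AW_PR[OF u]]
  show eq: "u = leaves t1 @ leaves t2" using s(2) t by simp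
  have n: "is_nlsw prime_gt t1" "is_nlsw prime_gt t2" using s(1) t by auto
  show AW: "leaves t1 \<in> AW" "leaves t2 \<in> AW"
    using n lyn.nlsw_alsw u eq by (auto simp: oalsw_iff)
  have "shirshov prime_gt (leaves t1) = t1" "shirshov prime_gt (leaves t2) = t2"
    using lyn.shirshov_leaves n AW AW_PR by auto
  then show "LB u = comm (LB (leaves t1)) (LB (leaves t2))"
    using u AW t by (simp add: LB_graft)
qed

lemma LB_append:
  assumes u: "u \<in> AW" and v: "v \<in> AW" and uv: "lex_gt prime_gt u v"
    and std: "\<And>t1 t2. shirshov prime_gt u = Branch t1 t2 \<Longrightarrow> lex_ge prime_gt v (leaves t2)"
  shows "u @ v \<in> AW" "LB (u @ v) = comm (LB u) (LB v)"
proof -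
  note su = lyn.shirshov[OF AW_alsw[OF u] AW_PR[OF u]] and sv = lyn.shirshov[OF AW_alsw[OF v] AW_PR[OF v]]
  have al: "is_alsw prime_gt (u @ v)"
    using lyn.alsw_append AW_alsw AW_PR u v uv by blast
  then show AW: "u @ v \<in> AW" using AW_append u v by blast
  let ?t = "Branch (shirshov prime_gt u) (shirshov prime_gt v)"
  have "is_nlsw prime_gt ?t" using su sv al std by auto
  then have "shirshov prime_gt (u @ v) = ?t"
    using lyn.shirshov_leaves[of ?t] su sv AW_PR u v by simp
  then show "LB (u @ v) = comm (LB u) (LB v)" using AW u v by (simp add: LB_graft)
qed

text \<open>If \<open>[u][v]\<close> is not yet a standard bracketing and \<open>[u] = [u'][u'']\<close>, then \<open>u'\<close> and \<open>u''\<close> come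
  before \<open>v\<close>, and the Jacobi identity yields commutators that are shorter, or have the same
  length and a second factor before \<open>v\<close>; only finitely many words over \<open>B\<close> are relevant.\<close>

lemma comm_LB_aux:
  assumes B: "finite B"
  shows "u \<in> AW \<Longrightarrow> v \<in> AW \<Longrightarrow> set u \<subseteq> B \<Longrightarrow> set v \<subseteq> B \<Longrightarrow> lex_gt prime_gt u v \<Longrightarrow>
    length u + length v \<le> N \<Longrightarrow>
    comm (LB u) (LB v :: ('x, 'o, 'k::field) oalg) \<in>
      V.span {LB w | w. w \<in> AW \<and> set w \<subseteq> B \<and> length w = length u + length v \<and> lex_gt prime_gt w v}"
proof -
  let ?F = "{w. set w \<subseteq> B \<and> length w \<le> N}"
  let ?below = "\<lambda>v. card {w \<in> ?F. lex_gt prime_gt w v}"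
  \<comment> \<open>\<open>?below\<close> never exceeds \<open>card ?F\<close>, so the factor
    \<open>Suc (card ?F)\<close> makes the total length decisive and \<open>?below v\<close> the
    tie-breaker.\<close>
  let ?m = "\<lambda>u v. (length u + length v) * Suc (card ?F) + ?below v"
  define T :: "nat \<Rightarrow> ('x, 'o) oword \<Rightarrow> ('x, 'o, 'k) oalg set"
    where "T n v = {LB w | w. w \<in> AW \<and> set w \<subseteq> B \<and> length w = n \<and> lex_gt prime_gt w v}" for n v
  have finF: "finite ?F" using finite_lists_length_le[OF B] by simp
  have below_le: "?below v \<le> card ?F" for v by (rule card_mono[OF finF]) auto
  have below_less: "?below x < ?below v" if "lex_gt prime_gt x v" "x \<in> ?F" for x v
  proof (rule psubset_card_mono)
    show "finite {w \<in> ?F. lex_gt prime_gt w v}" by (rule finite_subset[OF _ finF]) auto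
    show "{w \<in> ?F. lex_gt prime_gt w x} \<subset> {w \<in> ?F. lex_gt prime_gt w v}"
      using that lyn.lex_trans by (auto simp: psubset_eq set_eq_iff) (use lyn.lex_irrefl in blast)
  qed
  have m_shorter: "?m x y < ?m u v" if "length x + length y < length u + length v" for x y u v :: "('x, 'o) oword"
  proof -
    have "(length x + length y + 1) * Suc (card ?F) \<le> (length u + length v) * Suc (card ?F)"
      using that by (intro mult_le_mono1) simp
    then show ?thesis using below_le[of y] by simp
  qed
  have T_mono: "V.span (T n y) \<subseteq> V.span (T n v)" if "lex_gt prime_gt y v" for n y v
    unfolding T_def using that lyn.lex_trans by (intro V.span_mono) blast
  have "u \<in> AW \<Longrightarrow> v \<in> AW \<Longrightarrow> set u \<subseteq> B \<Longrightarrow> set v \<subseteq> B \<Longrightarrow> lex_gt prime_gt u v \<Longrightarrow>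
    length u + length v \<le> N \<Longrightarrow> comm (LB u) (LB v) \<in> V.span (T (length u + length v) v)"
  proof (induction "?m u v" arbitrary: u v rule: less_induct)
    case less
    note uv = less.prems
    let ?n = "length u + length v"
    \<comment> \<open>As both words come before \<open>v\<close>, either order of the two factors
      has a second factor before \<open>v\<close>; the measure drops whichever of them is
      smaller.\<close>
    have sym: "comm (LB x) (LB y) \<in> V.span (T ?n v)"
      if x: "x \<in> AW" "set x \<subseteq> B" "lex_gt prime_gt x v" and y: "y \<in> AW" "set y \<subseteq> B" "lex_gt prime_gt y v"
        and len: "length x + length y = ?n" for x y
    proof -
      have "x \<in> ?F" "y \<in> ?F" using x y len uv by auto
      then have m: "?m x y < ?m u v" "?m y x < ?m u v"
        using below_less x y len by (simp_all add: add.commute)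
      consider "x = y" | "lex_gt prime_gt x y" | "lex_gt prime_gt y x"
        using lyn.lex_total[of x y] AW_PR x y by blast
      then show ?thesis
      proof cases
        case 1
        then show ?thesis by (simp add: V.span_zero)
      next
        case 2
        have "comm (LB x) (LB y) \<in> V.span (T (length x + length y) y)"
          using less.hyps[OF m(1) x(1) y(1) x(2) y(2) 2] len uv by simp
        then show ?thesis using T_mono[OF y(3)] len by auto
      next
        case 3
        have "comm (LB y) (LB x) \<in> V.span (T (length y + length x) x)"
          using less.hyps[OF m(2) y(1) x(1) y(2) x(2) 3] len uv by simp
        then have "- comm (LB y) (LB x) \<in> V.span (T ?n v)"
          using T_mono[OF x(3)] len by (auto simp: add.commute intro: V.span_neg)
        then show ?thesis by (simp flip: comm_anti)
      qed
    qed
    show ?case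
    proof (cases "\<exists>t1 t2. shirshov prime_gt u = Branch t1 t2 \<and> \<not> lex_ge prime_gt v (leaves t2)")
      case False
      then have std: "u @ v \<in> AW" "LB (u @ v) = comm (LB u) (LB v)"
        using LB_append[OF uv(1,2,5)] by blast+
      have "lex_gt prime_gt (u @ v) v"
        using lyn.alsw_suffixD[OF AW_alsw[OF std(1)] AW_PR[OF std(1)] refl] AW_nonempty uv(1,2) by blast
      then show ?thesis unfolding std(2)[symmetric] T_def
        using std(1) uv by (intro V.span_base CollectI exI[of _ "u @ v"]) auto
    next
      case True
      then obtain t1 t2 where t: "shirshov prime_gt u = Branch t1 t2" "\<not> lex_ge prime_gt v (leaves t2)"
        by blast
      let ?x = "leaves t1" and ?y = "leaves t2"
      note sp = LB_split[OF uv(1) t(1)]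
      have B: "set ?x \<subseteq> B" "set ?y \<subseteq> B" using sp(1) uv(3) by auto
      have yv: "lex_gt prime_gt ?y v" using lyn.not_lex t(2) AW_PR sp uv(2) by blast
      have xy: "lex_gt prime_gt ?x ?y"
        using lyn.alsw_append_lex[of ?x ?y] AW_alsw[OF uv(1)] sp(1) AW_PR[OF sp(2)] AW_PR[OF sp(3)] by simp
      then have xv: "lex_gt prime_gt ?x v" using yv lyn.lex_trans by blast
      have len: "length u = length ?x + length ?y" using sp(1) by simp
      have ne: "length ?x > 0" "length ?y > 0" by auto
      \<comment> \<open>The inner commutators of the Jacobi identity are shorter, and the words they
        produce come before \<open>v\<close>, so \<open>sym\<close> applies to the outer
        commutators.\<close>
      have xv_span: "comm (LB ?x) (LB v) \<in> V.span (T (length ?x + length v) v)"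
        using ne len uv by (intro less.hyps m_shorter sp B xv) auto
      have yv_span: "comm (LB ?y) (LB v) \<in> V.span (T (length ?y + length v) v)"
        using ne len uv by (intro less.hyps m_shorter sp B yv) auto
      have "comm (comm (LB ?x) (LB v)) (LB ?y) \<in> V.span (T ?n v)"
      proof (rule linmap_span[OF linmap_comm_left xv_span])
        fix b assume "b \<in> T (length ?x + length v) v"
        then show "comm b (LB ?y) \<in> V.span (T ?n v)"
          unfolding T_def[of "length ?x + length v"] using sym sp B yv len by auto
      qed
      moreover have "comm (LB ?x) (comm (LB ?y) (LB v)) \<in> V.span (T ?n v)"
      proof (rule linmap_span[OF linmap_comm_right yv_span])
        fix b assume "b \<in> T (length ?y + length v) v"
        then show "comm (LB ?x) b \<in> V.span (T ?n v)"
          unfolding T_def[of "length ?y + length v"] using sym sp B xv len by auto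
      qed
      ultimately show ?thesis unfolding sp(4) by (subst comm_jacobi) (rule V.span_add)
    qed
  qed
  then show "u \<in> AW \<Longrightarrow> v \<in> AW \<Longrightarrow> set u \<subseteq> B \<Longrightarrow> set v \<subseteq> B \<Longrightarrow> lex_gt prime_gt u v \<Longrightarrow>
    length u + length v \<le> N \<Longrightarrow> comm (LB u) (LB v :: ('x, 'o, 'k::field) oalg) \<in>
      V.span {LB w | w. w \<in> AW \<and> set w \<subseteq> B \<and> length w = length u + length v \<and> lex_gt prime_gt w v}"
    unfolding T_def .
qed

lemma comm_LB:
  assumes u: "u \<in> AW" and v: "v \<in> AW"
  shows "comm (LB u) (LB v) \<in> V.span (LB ` AW)"
proof -
  have *: "comm (LB x) (LB y) \<in> V.span (LB ` AW)" if "x \<in> AW" "y \<in> AW" "lex_gt prime_gt x y" for x y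
  proof -
    have "comm (LB x) (LB y) \<in> V.span {LB w | w. w \<in> AW \<and> set w \<subseteq> set x \<union> set y \<and>
        length w = length x + length y \<and> lex_gt prime_gt w y}"
      by (rule comm_LB_aux[OF _ that(1,2) _ _ that(3) order_refl]) auto
    moreover have "{LB w | w. w \<in> AW \<and> set w \<subseteq> set x \<union> set y \<and>
        length w = length x + length y \<and> lex_gt prime_gt w y} \<subseteq> LB ` AW" by auto
    ultimately show ?thesis using V.span_mono by blast
  qed
  consider "u = v" | "lex_gt prime_gt u v" | "lex_gt prime_gt v u"
    using lyn.lex_total[of u v] AW_PR u v by blast
  then show ?thesis
  proof cases
    case 1
    then show ?thesis by (simp add: V.span_zero)
  next
    case 2
    then show ?thesis using * u v by blast
  next
    case 3
    then have "- comm (LB v) (LB u) \<in> V.span (LB ` AW)" using * u v by (intro V.span_neg) blast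
    then show ?thesis by (simp flip: comm_anti)
  qed
qed

lemma single_AW: "p \<in> AP \<Longrightarrow> [p] \<in> AW"
  by (simp add: oalsw_iff)

lemma LB_single: "p \<in> AP \<Longrightarrow> LB [p] = lie_elem (bracket_prime p)"
proof -
  assume p: "p \<in> AP"
  have "shirshov prime_gt (leaves (Leaf p)) = Leaf p"
    using p aprimes_oprimes by (intro lyn.shirshov_leaves) auto
  then show ?thesis using LB_graft[OF single_AW[OF p]] by simp
qed

section \<open>The free Lie algebra with operators as the span of the bracketed words\<close>

abbreviation LA :: "('x, 'o, 'k::field) oalg set" where
  "LA \<equiv> Lie X Om ar"

lemma lie_subalg_FA: "lie_subalg X Om ar FA"
  unfolding lie_subalg_def using FA_subspace comm_FA oper_FA by blast

lemma Lie_iff: "f \<in> LA \<longleftrightarrow> (\<forall>A. lie_subalg X Om ar A \<and> (\<lambda>x. mon [Var x]) ` X \<subseteq> A \<longrightarrow> f \<in> A)"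
  by (auto simp: Lie_def hull_def)

lemma lie_subalg_Lie: "lie_subalg X Om ar (LA :: ('x, 'o, 'k::field) oalg set)"
proof -
  have "(\<lambda>x. mon [Var x]) ` X \<subseteq> (FA :: ('x, 'o, 'k) oalg set)"
    by (auto intro!: mon_FA simp: owords_iff Var_PR)
  then have "LA \<subseteq> (FA :: ('x, 'o, 'k) oalg set)" using lie_subalg_FA Lie_iff by blast
  moreover have "V.subspace (LA :: ('x, 'o, 'k) oalg set)"
  proof -
    have "(LA :: ('x, 'o, 'k) oalg set) = \<Inter>{A. lie_subalg X Om ar A \<and> (\<lambda>x. mon [Var x]) ` X \<subseteq> A}"
      by (simp add: Lie_def hull_def)
    moreover have "V.subspace \<dots>" by (rule V.subspace_Inter) (auto simp: lie_subalg_def)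
    ultimately show ?thesis by simp
  qed
  moreover have "comm f g \<in> LA" if "f \<in> LA" "g \<in> LA" for f g :: "('x, 'o, 'k) oalg"
    using that unfolding Lie_iff lie_subalg_def by blast
  moreover have "oper \<omega> fs \<in> LA" if fs: "\<omega> \<in> Om" "length fs = ar \<omega>" "set fs \<subseteq> LA"
    for \<omega> and fs :: "('x, 'o, 'k) oalg list"
    unfolding Lie_iff
  proof (intro allI impI)
    fix A :: "('x, 'o, 'k) oalg set"
    assume A: "lie_subalg X Om ar A \<and> (\<lambda>x. mon [Var x]) ` X \<subseteq> A"
    then have "set fs \<subseteq> A" using fs(3) Lie_iff by blast
    then show "oper \<omega> fs \<in> A" using A fs unfolding lie_subalg_def by blast
  qed
  ultimately show ?thesis unfolding lie_subalg_def by blast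
qed

lemma LA_FA: "f \<in> LA \<Longrightarrow> f \<in> FA"
  and LA_subspace: "V.subspace LA"
  and LA_comm: "f \<in> LA \<Longrightarrow> g \<in> LA \<Longrightarrow> comm f g \<in> LA"
  and LA_oper: "\<omega> \<in> Om \<Longrightarrow> length fs = ar \<omega> \<Longrightarrow> set fs \<subseteq> LA \<Longrightarrow> oper \<omega> fs \<in> LA"
  using lie_subalg_Lie unfolding lie_subalg_def by blast+

lemma LA_Var: "x \<in> X \<Longrightarrow> mon [Var x] \<in> LA"
  unfolding Lie_iff by blast

lemma good_LA: "good T \<Longrightarrow> lie_elem T \<in> LA"
proof (induction T)
  case (NOp \<omega> ts)
  then show ?case by (auto intro!: LA_oper)
qed (auto intro: LA_Var LA_comm)

lemma LB_LA: "w \<in> AW \<Longrightarrow> LB w \<in> LA"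
  by (rule good_LA[OF good_bracket])

text \<open>The span is closed under commutators by \<open>comm_LB\<close>, and under operators
  because an operator applied to bracketings gives the bracketing of a single prime.\<close>

lemma LA_span: "LA = V.span (LB ` AW)"
proof
  show "V.span (LB ` AW) \<subseteq> LA" using LB_LA by (intro V.span_minimal LA_subspace) auto
  have "lie_subalg X Om ar (V.span (LB ` AW) :: ('x, 'o, 'a) oalg set)"
    unfolding lie_subalg_def
  proof (intro conjI ballI allI impI)
    show "V.span (LB ` AW) \<subseteq> FA"
      using LB_LA LA_FA by (intro V.span_minimal FA_subspace) auto
    show "V.subspace (V.span (LB ` AW))" by (rule V.subspace_span)
    fix f g :: "('x, 'o, 'a) oalg" assume f: "f \<in> V.span (LB ` AW)" and g: "g \<in> V.span (LB ` AW)"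
    have "comm (LB u) g \<in> V.span (LB ` AW)" if "u \<in> AW" for u
      using that by (intro linmap_span[OF linmap_comm_right g]) (auto intro: comm_LB)
    then show "comm f g \<in> V.span (LB ` AW)" by (intro linmap_span[OF linmap_comm_left f]) auto
  next
    fix \<omega> and fs :: "('x, 'o, 'a) oalg list"
    assume \<omega>: "\<omega> \<in> Om" and fs: "length fs = ar \<omega> \<and> set fs \<subseteq> V.span (LB ` AW)"
    show "oper \<omega> fs \<in> V.span (LB ` AW)"
    proof (rule multilinear_span_replicate[OF linmap_oper])
      show "set fs \<subseteq> V.span (LB ` AW)" using fs by blast
      fix bs :: "('x, 'o, 'a) oalg list" assume bs: "length bs = length fs" "set bs \<subseteq> LB ` AW"
      then obtain us where us: "bs = map LB us" "set us \<subseteq> AW" by (elim map_imageE)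
      then have p: "Op \<omega> us \<in> AP" using \<omega> fs bs by (simp add: Op_AP)
      have "oper \<omega> bs = LB [Op \<omega> us]" using us by (simp add: LB_single[OF p] comp_def)
      then show "oper \<omega> bs \<in> V.span (LB ` AW)" using single_AW[OF p] by (auto intro: V.span_base)
    qed
  qed
  moreover have "(\<lambda>x. mon [Var x]) ` X \<subseteq> V.span (LB ` AW :: ('x, 'o, 'a) oalg set)"
  proof
    fix e :: "('x, 'o, 'a) oalg" assume "e \<in> (\<lambda>x. mon [Var x]) ` X"
    then obtain x where x: "x \<in> X" "e = mon [Var x]" by blast
    then have p: "Var x \<in> AP" by (simp add: Var_AP)
    then have "e = LB [Var x]" using x by (simp add: LB_single[OF p])
    then show "e \<in> V.span (LB ` AW)" using single_AW[OF p] by (auto intro: V.span_base)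
  qed
  ultimately show "LA \<subseteq> V.span (LB ` AW :: ('x, 'o, 'a) oalg set)" using Lie_iff by blast
qed

text \<open>Repeated images are merged and zero coefficients dropped, which is the shape from which
  a leading word can be read off.\<close>

lemma span_image_nonzero:
  assumes "f \<in> V.span (F ` A)"
  shows "\<exists>T c. finite T \<and> T \<subseteq> A \<and> (\<forall>w\<in>T. c w \<noteq> 0) \<and> f = (\<Sum>w\<in>T. scl (c w) (F w))"
proof -
  obtain t r where t: "finite t" "t \<subseteq> F ` A" "f = (\<Sum>a\<in>t. scl (r a) a)"
    using assms unfolding V.span_explicit by blast
  then obtain U where U: "U \<subseteq> A" "inj_on F U" "t = F ` U" using t(2)[unfolded subset_image_inj] by blast
  then have finU: "finite U" using t(1) finite_image_iff by blast
  let ?T = "{w \<in> U. r (F w) \<noteq> 0}"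
  have "f = (\<Sum>w\<in>U. scl (r (F w)) (F w))" using t(3) U by (simp add: sum.reindex)
  also have "\<dots> = (\<Sum>w\<in>?T. scl (r (F w)) (F w))"
    using finU by (intro sum.mono_neutral_right) auto
  finally show ?thesis using U finU by (intro exI[of _ ?T] exI[of _ "\<lambda>w. r (F w)"]) auto
qed

lemma lead_LB_sum:
  assumes "finite T" "T \<noteq> {}" "T \<subseteq> AW" "\<And>w. w \<in> T \<Longrightarrow> c w \<noteq> 0"
  shows "(\<Sum>w\<in>T. scl (c w) (LB w)) \<noteq> 0" "lead (\<Sum>w\<in>T. scl (c w) (LB w)) \<in> T"
proof -
  have OW: "T \<subseteq> OW" using assms(3) oalsw_owords by blast
  have low: "LB w - mon w \<in> low MW w" if "w \<in> T" for w using LB_low that assms(3) by blast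
  show "(\<Sum>w\<in>T. scl (c w) (LB w)) \<noteq> 0" "lead (\<Sum>w\<in>T. scl (c w) (LB w)) \<in> T"
    using lead_sum[OF assms(1,2) OW low assms(4)] by simp_all
qed

text \<open>Bracketings of distinct words have distinct leading words, so the greatest word in a
  representation of \<open>f\<close> by bracketings survives.\<close>

lemma lead_LA:
  assumes "f \<in> LA" "f \<noteq> 0"
  shows "lead f \<in> AW"
proof -
  obtain T c where T: "finite T" "T \<subseteq> AW" "\<forall>w\<in>T. c w \<noteq> 0" "f = (\<Sum>w\<in>T. scl (c w) (LB w))"
    using span_image_nonzero[OF assms(1)[unfolded LA_span]] by blast
  then have "T \<noteq> {}" using assms(2) by auto
  then show ?thesis using lead_LB_sum(2)[OF T(1) _ T(2), of c] T by auto
qed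

end

section \<open>Substitution into contexts\<close>

text \<open>If \<open>F\<close> is \<open>u \<mapsto> \<pi>|\<^sub>u\<close>, then \<open>sub F f\<close> is \<open>\<pi>|\<^sub>f\<close>.\<close>

definition sub :: "(('x, 'o) oword \<Rightarrow> ('x, 'o) oword) \<Rightarrow> ('x, 'o, 'k::field) oalg \<Rightarrow> ('x, 'o, 'k) oalg" where
  "sub F f = lin (\<lambda>u. mon (F u)) f"

lemma linmap_sub: "linmap (sub F)"
  unfolding sub_def[abs_def] by (rule linmap_lin)

lemma sub_mon [simp]: "sub F (mon u) = mon (F u)"
  by (simp add: sub_def)

lemma sub_id [simp]: "sub (\<lambda>u. u) f = f"
  by (simp add: sub_def)

lemma sub_sub: "sub F (sub G f) = sub (\<lambda>u. F (G u)) f"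
  by (rule linmap_ext[OF linmap_compose[OF linmap_sub linmap_sub] linmap_sub]) simp

lemma mul_sub_left: "mul (mon a) (sub F f) = sub (\<lambda>u. a @ F u) f"
  by (rule linmap_ext[OF linmap_compose[OF linmap_mul_right linmap_sub] linmap_sub]) simp

lemma mul_sub_right: "mul (sub F f) (mon b) = sub (\<lambda>u. F u @ b) f"
  by (rule linmap_ext[OF linmap_compose[OF linmap_mul_left linmap_sub] linmap_sub]) simp

lemma oper_sub:
  "oper \<omega> (map mon us @ sub F f # map mon vs) = sub (\<lambda>u. [Op \<omega> (us @ F u # vs)]) f"
proof (rule linmap_ext[OF linmap_compose[OF linmap_oper linmap_sub] linmap_sub])
  fix u
  show "oper \<omega> (map mon us @ sub F (mon u) # map mon vs) = sub (\<lambda>u. [Op \<omega> (us @ F u # vs)]) (mon u)"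
    using oper_mon[of \<omega> "us @ F u # vs"] by simp
qed

context operated
begin

text \<open>The \<open>S\<close>-words of the associative theory, labelled with what is their
  leading word once \<open>S\<close> is monic.\<close>

definition SG :: "('x, 'o, 'k::field) oalg set \<Rightarrow> (('x, 'o) oword \<times> ('x, 'o, 'k) oalg) set" where
  "SG S = {(F (lead s), sub F s) | F s. ctx F \<and> s \<in> S}"

lemma SG_I: "ctx F \<Longrightarrow> s \<in> S \<Longrightarrow> (F (lead s), sub F s) \<in> SG S"
  by (auto simp: SG_def)

lemma SG_E:
  assumes "(u, e) \<in> SG S"
  obtains F s where "ctx F" "s \<in> S" "u = F (lead s)" "e = sub F s"
  using assms by (auto simp: SG_def)

lemma SG_ctx: "ctx F \<Longrightarrow> (u, e) \<in> SG S \<Longrightarrow> (F u, sub F e) \<in> SG S"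
proof (elim SG_E)
  fix G s assume "ctx F" "ctx G" "s \<in> S" "u = G (lead s)" "e = sub G s"
  then show "(F u, sub F e) \<in> SG S"
    using SG_I[OF ctx_comp, of F G s S] by (simp add: sub_sub)
qed

lemma sub_low_SG:
  assumes F: "ctx F" and h: "h \<in> low (SG S) w"
  shows "sub F h \<in> low (SG S) (F w)"
proof (rule linmap_low[OF linmap_sub h])
  fix u e assume "(u, e) \<in> SG S" "dl_gt w u"
  then show "sub F e \<in> low (SG S) (F w)" using SG_ctx[OF F] ctx_mono[OF F] low_base by blast
qed

lemma sub_low_MW:
  fixes h :: "('x, 'o, 'k::field) oalg"
  assumes F: "ctx F" and h: "h \<in> low MW w"
  shows "sub F h \<in> low MW (F w)"
proof (rule linmap_low[OF linmap_sub h])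
  fix u and e :: "('x, 'o, 'k) oalg" assume "(u, e) \<in> MW" and gt: "dl_gt w u"
  then have "(F u, sub F e) \<in> MW" using ctx_OW[OF F] by auto
  then show "sub F e \<in> low MW (F w)" by (rule low_base[OF _ ctx_mono[OF F gt]])
qed

lemma sub_lead:
  assumes "ctx F" "monic f" "f \<in> FA"
  shows "sub F f - mon (F (lead f)) \<in> low MW (F (lead f))"
  using sub_low_MW[OF assms(1) monic_low[OF assms(2,3)]] by (simp add: module_hom.diff[OF linmap_sub])

lemma low_SG_MW:
  fixes S :: "('x, 'o, 'k::field) oalg set"
  assumes S: "\<And>s. s \<in> S \<Longrightarrow> monic s \<and> s \<in> FA" and h: "h \<in> low (SG S) w"
  shows "h \<in> low MW w"
proof -
  have "(\<lambda>x. x) h \<in> low MW w"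
  proof (rule linmap_low[OF _ h])
    show "linmap (\<lambda>x :: ('x, 'o, 'k) oalg. x)" by (rule linmapI) simp_all
    fix u e assume "(u, e) \<in> SG S" and gt: "dl_gt w u"
    then obtain F s where F: "ctx F" "s \<in> S" "u = F (lead s)" "e = sub F s" by (elim SG_E)
    then have s: "monic s" "s \<in> FA" using S by auto
    have "sub F s - mon u \<in> low MW w"
      using sub_lead[OF F(1) s] F low_mono[OF gt] by blast
    moreover have "lead s \<in> OW" using s by (simp add: lead_OW monic_def)
    then have "mon u \<in> low MW w" using ctx_OW[OF F(1)] F gt by (intro low_base) auto
    ultimately have "sub F s - mon u + mon u \<in> low MW w" by (rule low_add)
    then show "e \<in> low MW w" using F by simp
  qed
  then show ?thesis .
qed

lemma mul_SG_MW:
  assumes "(u, e) \<in> SG S" "(v, e') \<in> MW"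
  shows "(u @ v, mul e e') \<in> SG S \<and> (v @ u, mul e' e) \<in> SG S"
proof -
  obtain F s where F: "ctx F" "s \<in> S" "u = F (lead s)" "e = sub F s" using assms(1) by (elim SG_E)
  have v: "set v \<subseteq> PR" "e' = mon v" using assms(2) by (auto simp: owords_iff)
  have "ctx (\<lambda>u. F u @ v)" "ctx (\<lambda>u. v @ F u)" using ctx_pad[OF F(1), of "[]" v] ctx_pad[OF F(1), of v "[]"] v by auto
  then show ?thesis using SG_I[of _ s S] F v by (auto simp: mul_sub_left mul_sub_right)
qed

lemma oper_SG:
  assumes "(u, e) \<in> SG S" "\<omega> \<in> Om" "length us + Suc (length vs) = ar \<omega>" "set us \<subseteq> OW" "set vs \<subseteq> OW"
  shows "([Op \<omega> (us @ u # vs)], oper \<omega> (map mon us @ e # map mon vs)) \<in> SG S"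
proof -
  obtain F s where F: "ctx F" "s \<in> S" "u = F (lead s)" "e = sub F s" using assms(1) by (elim SG_E)
  have "ctx (\<lambda>u. [Op \<omega> (us @ F u # vs)])" using ctx_Op[OF F(1) assms(2-5), of "[]" "[]"] by simp
  then show ?thesis using SG_I[of _ s S] F by (simp add: oper_sub)
qed

end

section \<open>Bracketed words with a hole\<close>

lemma plug_na_simps [simp]:
  "plug_na (NVar None) t = t" "plug_na (NVar (Some x)) t = NVar x"
  "plug_na (NOp \<omega> ts) t = NOp \<omega> (map (\<lambda>s. plug_na s t) ts)"
  "plug_na (NBr a b) t = NBr (plug_na a t) (plug_na b t)"
  by (simp_all add: plug_na_def)

lemma assoc_plug_na: "assoc_word (plug_na C t) = plug (assoc_word C) (assoc_word t)"
proof (induction C)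
  case (NVar z)
  then show ?case by (cases z) auto
qed auto

lemma assoc_nonempty [simp]: "assoc_word C \<noteq> []"
  by (induction C) auto

lemma plug_nonempty: "\<pi> \<noteq> [] \<Longrightarrow> s \<noteq> [] \<Longrightarrow> plug \<pi> s \<noteq> []"
proof (cases \<pi>)
  case (Cons p \<pi>')
  assume s: "s \<noteq> []"
  have "plug [p] s \<noteq> []"
  proof (cases p)
    case (Var z)
    then show ?thesis using s by (cases z) auto
  qed auto
  then show ?thesis unfolding Cons by (subst plug_Cons) simp
qed simp

abbreviation ev_hole :: "('x, 'o, 'k::field) oalg \<Rightarrow> ('x option, 'o) naword \<Rightarrow> ('x, 'o, 'k) oalg" where
  "ev_hole g \<equiv> eval_na (case_option g (\<lambda>x. mon [Var x]))"

lemma no_hole_eval: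
  "holes (assoc_word C) = 0 \<Longrightarrow>
    ev_hole g C = lie_elem (plug_na C t) \<and> plug (assoc_word C) s = assoc_word (plug_na C t)"
proof (induction C)
  case (NVar z)
  then show ?case by (cases z) auto
qed (auto cong: map_cong)

lemma no_hole_plug: "holes (assoc_word C) = 0 \<Longrightarrow> plug (assoc_word C) s = assoc_word (plug_na C t)"
  using no_hole_eval by blast

lemma no_hole_inj:
  "holes (assoc_word C) = 0 \<Longrightarrow> holes (assoc_word D) = 0 \<Longrightarrow> plug_na C t = plug_na D t \<Longrightarrow> C = D"
proof (induction C arbitrary: D)
  case (NVar z)
  then show ?case by (cases z; cases D; cases "case D of NVar y \<Rightarrow> y | _ \<Rightarrow> None") auto
next
  case (NOp \<omega> ts)
  then obtain ss where D: "D = NOp \<omega> ss" "map (\<lambda>s. plug_na s t) ts = map (\<lambda>s. plug_na s t) ss"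
  proof (cases D)
    case (NVar y)
    then show ?thesis using NOp.prems by (cases y) auto
  qed (use NOp.prems in auto)
  have "ts = ss"
  proof (rule nth_equalityI)
    show len: "length ts = length ss" using D(2) by (rule map_eq_imp_length_eq)
    fix i assume i: "i < length ts"
    then have "plug_na (ts ! i) t = plug_na (ss ! i) t" using D(2) len by (metis nth_map)
    moreover have "ts ! i \<in> set ts" "ss ! i \<in> set ss" using i len by auto
    ultimately show "ts ! i = ss ! i" using NOp.IH[of "ts ! i" "ss ! i"] NOp.prems D(1) by auto
  qed
  then show ?case using D by simp
next
  case (NBr a b)
  then obtain a' b' where "D = NBr a' b'"
  proof (cases D)
    case (NVar y)
    then show ?thesis using NBr.prems by (cases y) auto
  qed (use NBr.prems in auto)
  then show ?case using NBr by auto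
qed

lemma assoc_single:
  "assoc_word D = [Var z] \<Longrightarrow> D = NVar z"
  "assoc_word D = [Op \<omega> us] \<Longrightarrow> \<exists>ts. D = NOp \<omega> ts \<and> us = map assoc_word ts"
  by (cases D; auto simp: append_eq_Cons_conv)+

text \<open>Cutting a word once behind and once before its hole gives prefixes of different length,
  and they stay different after plugging in a nonempty \<open>s\<close>. Hence two bracketings of
  one star word that agree after plugging have the hole on the same side of the top bracket.\<close>

lemma hole_position:
  assumes eq: "u @ v = u' @ v'" and h: "holes u = 1" "holes u' = 0" and s: "s \<noteq> []"
    and plug: "plug u s = plug u' s"
  shows False
  using eq
proof (cases rule: append_eq_appendE)
  case (left z)
  then show ?thesis using plug plug_nonempty[OF _ s, of z] by simp
next
  case (right z)
  then show ?thesis using h by simp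
qed

text \<open>The star word alone leaves the bracketing free, and the plugged tree alone leaves the
  position of the hole free; together they determine \<open>C\<close>. This justifies
  \<open>THE C\<close> in \<open>special_bracketing\<close>.\<close>

lemma one_hole_inj:
  "holes (assoc_word C) = 1 \<Longrightarrow> assoc_word C = assoc_word D \<Longrightarrow> plug_na C t = plug_na D t \<Longrightarrow> C = D"
proof (induction C arbitrary: D)
  case (NVar z)
  then show ?case using assoc_single(1)[of D z] by simp
next
  case (NOp \<omega> ts)
  obtain ss where D: "D = NOp \<omega> ss" "map assoc_word ts = map assoc_word ss"
    using assoc_single(2)[of D \<omega> "map assoc_word ts"] NOp.prems(2) by auto
  have "ts = ss"
  proof (rule nth_equalityI)
    show len: "length ts = length ss" using D(2) by (rule map_eq_imp_length_eq)
    fix i assume i: "i < length ts"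
    have mem: "ts ! i \<in> set ts" using i by auto
    have "sum_list (map (holes \<circ> assoc_word) ts) = 1" using NOp.prems(1) by (simp add: comp_def)
    then have "holes (assoc_word (ts ! i)) \<le> 1"
      using member_le_sum_list[of "(holes \<circ> assoc_word) (ts ! i)" "map (holes \<circ> assoc_word) ts"] mem by auto
    moreover have "assoc_word (ts ! i) = assoc_word (ss ! i)" using D(2) i len by (metis nth_map)
    moreover have "plug_na (ts ! i) t = plug_na (ss ! i) t"
      using NOp.prems(3) D(1) i len by (simp add: list_eq_iff_nth_eq)
    ultimately show "ts ! i = ss ! i"
      using NOp.IH[OF mem, of "ss ! i"] no_hole_inj[of "ts ! i" "ss ! i" t] by fastforce
  qed
  then show ?case using D by simp
next
  case (NBr a b)
  obtain a' b' where D: "D = NBr a' b'"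
  proof (cases D)
    case (NOp \<omega> ts)
    then show ?thesis using NBr.prems(2) by (auto simp: append_eq_Cons_conv)
  next
    case (NVar y)
    then show ?thesis using NBr.prems(2) by (auto simp: append_eq_Cons_conv)
  qed auto
  have eq: "assoc_word a @ assoc_word b = assoc_word a' @ assoc_word b'" using NBr.prems(2) D by simp
  have p: "plug_na a t = plug_na a' t" "plug_na b t = plug_na b' t" using NBr.prems(3) D by auto
  let ?s = "assoc_word t"
  have pw: "plug (assoc_word a) ?s = plug (assoc_word a') ?s"
    using p assoc_plug_na by metis
  have h: "holes (assoc_word a) + holes (assoc_word b) = 1" "holes (assoc_word a') + holes (assoc_word b') = 1"
    using NBr.prems(1) arg_cong[OF eq, of holes] by simp_all
  consider "holes (assoc_word a) = 1" "holes (assoc_word a') = 1"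
    | "holes (assoc_word a) = 0" "holes (assoc_word a') = 0"
    | "holes (assoc_word a) = 1" "holes (assoc_word a') = 0"
    | "holes (assoc_word a) = 0" "holes (assoc_word a') = 1"
    using h by linarith
  then show ?case
  proof cases
    case 1
    then have "b = b'" using no_hole_inj p h by (metis add_cancel_right_right)
    then show ?thesis using NBr.IH(1)[OF 1(1) _ p(1)] eq D by simp
  next
    case 2
    then have "a = a'" using no_hole_inj p by blast
    then show ?thesis using NBr.IH(2)[OF _ _ p(2)] eq D h 2 by simp
  next
    case 3
    from hole_position[OF eq 3 assoc_nonempty pw] show ?thesis ..
  next
    case 4
    from hole_position[OF eq[symmetric] 4(2,1) assoc_nonempty pw[symmetric]] show ?thesis ..
  qed
qed

lemma star_bracketing_unique:
  assumes "star_bracketing v \<pi> c w C" "holes \<pi> = 1"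
  shows "(THE C. star_bracketing v \<pi> c w C) = C"
proof (rule the_equality[where P = "star_bracketing v \<pi> c w", OF assms(1)])
  fix D assume "star_bracketing v \<pi> c w D"
  then show "D = C"
    using one_hole_inj[of D C "bracket (v @ c)"] assms by (simp add: star_bracketing_def)
qed

lemma eval_bind_na: "eval_na \<rho> (bind_na h C) = eval_na (\<lambda>x. eval_na \<rho> (h x)) C"
  by (induction C) (auto simp: comp_def cong: map_cong)

lemma ev_hole_plug_star_na: "ev_hole f (plug_star_na C D) = ev_hole (ev_hole f D) C"
proof -
  have "(\<lambda>x. ev_hole f (case x of None \<Rightarrow> D | Some x \<Rightarrow> NVar (Some x))) =
      case_option (ev_hole f D) (\<lambda>x. mon [Var x])"
    by (auto simp: fun_eq_iff split: option.split)
  then show ?thesis by (simp add: plug_star_na_def eval_bind_na)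
qed

lemma ev_hole_lift: "ev_hole f (map_naword Some id t) = lie_elem t"
  by (induction t) (auto simp: comp_def cong: map_cong)

lemma ev_hole_foldl:
  "ev_hole f (foldl NBr D (map (\<lambda>d. map_naword Some id (bracket d)) cs)) =
    foldl comm (ev_hole f D) (map (\<lambda>d. lie_elem (bracket d)) cs)"
  by (induction cs arbitrary: D) (auto simp: ev_hole_lift)

lemma plug_plug_star: "plug (plug_star \<pi> \<sigma>) s = plug \<pi> (plug \<sigma> s)"
proof -
  have append: "plug_star (\<pi> @ \<pi>') \<sigma> = plug_star \<pi> \<sigma> @ plug_star \<pi>' \<sigma>" for \<pi> \<pi>' :: "('a option, 'b) oword"
    by (simp add: plug_star_def bind_word_def)
  have concat: "plug (concat ws) s = concat (map (\<lambda>w. plug w s) ws)" for ws :: "('a option, 'b) oword list"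
    by (induction ws) auto
  have p: "plug (plug_star [p] \<sigma>) s = plug [p] (plug \<sigma> s)" for p
  proof (induction p)
    case (Var z)
    then show ?case by (cases z) (simp_all add: plug_star_def bind_word_def)
  next
    case (Op \<omega> us)
    have star: "plug_star u \<sigma> = concat (map (\<lambda>p. plug_star [p] \<sigma>) u)" for u
      by (simp add: plug_star_def bind_word_def)
    have "plug (plug_star u \<sigma>) s = plug u (plug \<sigma> s)" if "u \<in> set us" for u
    proof -
      have "plug (plug_star u \<sigma>) s = concat (map (\<lambda>p. plug (plug_star [p] \<sigma>) s) u)"
        by (subst star) (simp add: concat comp_def)
      also have "map (\<lambda>p. plug (plug_star [p] \<sigma>) s) u = map (\<lambda>p. plug [p] (plug \<sigma> s)) u"
        using Op.IH that by simp
      finally show ?thesis by (simp flip: plug_concat)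
    qed
    moreover have "plug_star [Op \<omega> us] \<sigma> = [Op \<omega> (map (\<lambda>u. plug_star u \<sigma>) us)]"
      by (simp add: plug_star_def bind_word_def comp_def)
    ultimately show ?case by simp
  qed
  show ?thesis
  proof (induction \<pi>)
    case Nil
    then show ?case by (simp add: plug_star_def bind_word_def)
  next
    case (Cons p \<pi>)
    then show ?case using append[of "[p]" \<pi>] p plug_Cons[of p \<pi>] by simp
  qed
qed

section \<open>Special normal words\<close>

context operated
begin

text \<open>Goodness of the plugged tree guarantees that everything beside the hole is well
  formed.\<close>

lemma one_hole_ctx:
  "holes (assoc_word C) = 1 \<Longrightarrow> good (plug_na C t) \<Longrightarrow> ctx (plug (assoc_word C))"
proof (induction C)
  case (NVar z)
  then show ?case using ctx_id by (cases z) auto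
next
  case (NBr a b)
  have g: "good (plug_na a t)" "good (plug_na b t)" using NBr.prems by auto
  then have PR: "set (assoc_word (plug_na a t)) \<subseteq> PR" "set (assoc_word (plug_na b t)) \<subseteq> PR"
    using good_word owords_iff by blast+
  consider "holes (assoc_word a) = 1" "holes (assoc_word b) = 0"
    | "holes (assoc_word a) = 0" "holes (assoc_word b) = 1" using NBr.prems(1) by fastforce
  then show ?case
  proof cases
    case 1
    then have "plug (assoc_word b) s = assoc_word (plug_na b t)" for s using no_hole_plug by blast
    then have "plug (assoc_word (NBr a b)) = (\<lambda>s. [] @ plug (assoc_word a) s @ assoc_word (plug_na b t))"
      by (simp add: fun_eq_iff)
    then show ?thesis using ctx_pad[OF NBr.IH(1)[OF 1(1) g(1)], of "[]"] PR by simp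
  next
    case 2
    then have "plug (assoc_word a) s = assoc_word (plug_na a t)" for s using no_hole_plug by blast
    then have "plug (assoc_word (NBr a b)) = (\<lambda>s. assoc_word (plug_na a t) @ plug (assoc_word b) s @ [])"
      by (simp add: fun_eq_iff)
    then show ?thesis using ctx_pad[OF NBr.IH(2)[OF 2(2) g(2)], of _ "[]"] PR by simp
  qed
next
  case (NOp \<omega> ts)
  obtain as c bs where ts: "ts = as @ c # bs" "holes (assoc_word c) = 1"
    "\<forall>y\<in>set as \<union> set bs. holes (assoc_word y) = 0"
    using sum_list_eq_1_split[of "holes \<circ> assoc_word" ts] NOp.prems(1) by (auto simp: comp_def)
  define us where "us = map (\<lambda>y. assoc_word (plug_na y t)) as"
  define vs where "vs = map (\<lambda>y. assoc_word (plug_na y t)) bs"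
  have "map (\<lambda>x. plug (assoc_word x) s) as = us" "map (\<lambda>x. plug (assoc_word x) s) bs = vs" for s
    unfolding us_def vs_def using ts(3) by (auto intro!: no_hole_plug)
  then have "plug (assoc_word (NOp \<omega> ts)) = (\<lambda>s. [] @ Op \<omega> (us @ plug (assoc_word c) s # vs) # [])"
    using ts(1) by (simp add: fun_eq_iff comp_def)
  moreover have "ctx (plug (assoc_word c))" using NOp ts(1,2) by auto
  moreover have "set us \<subseteq> OW" "set vs \<subseteq> OW" using NOp.prems(2) good_word ts(1) by (auto simp: us_def vs_def)
  ultimately show ?case
    using ctx_Op[of "plug (assoc_word c)" \<omega> us vs "[]" "[]"] NOp.prems(2) ts(1)
    by (simp add: us_def vs_def)
qed

text \<open>Induction towards the hole: the parts beside it are good bracketings, known up to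
  smaller words, and \<open>comm_low\<close> or \<open>multi_low\<close> passes one level. Goodness
  concerns the tree with \<open>t\<close> in the hole although \<open>g\<close> is inserted; this
  suffices since only labels are compared.\<close>

lemma one_hole_low:
  fixes g e :: "('x, 'o, 'k::field) oalg"
  assumes t: "(assoc_word t, e) \<in> SG S" "g - e \<in> low (SG S) (assoc_word t)"
  shows "holes (assoc_word C) = 1 \<Longrightarrow> good (plug_na C t) \<Longrightarrow>
    ev_hole g C - sub (plug (assoc_word C)) e \<in> low (SG S) (assoc_word (plug_na C t))"
proof (induction C)
  case (NVar z)
  have "plug star = (\<lambda>u. u)" by (simp add: fun_eq_iff)
  then show ?case using NVar t by (cases z) simp_all
next
  case (NBr a b)
  have g: "good (plug_na a t)" "good (plug_na b t)" using NBr.prems by auto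
  have gt: "dl_gt (assoc_word (plug_na a t) @ assoc_word (plug_na b t)) (assoc_word (plug_na b t) @ assoc_word (plug_na a t))"
    using NBr.prems by simp
  have label: "(assoc_word (plug_na d t), sub (plug (assoc_word d)) e) \<in> SG S"
    if "holes (assoc_word d) = 1" "good (plug_na d t)" for d
    using SG_ctx[OF one_hole_ctx[OF that] t(1)] by (simp add: assoc_plug_na)
  have MW: "(assoc_word (plug_na d t), mon (assoc_word (plug_na d t))) \<in> MW"
    "ev_hole g d - mon (assoc_word (plug_na d t)) \<in> low (MW :: (_ \<times> ('x, 'o, 'k) oalg) set) (assoc_word (plug_na d t))"
    if "holes (assoc_word d) = 0" "good (plug_na d t)" for d
    using good_word[OF that(2)] good_low[OF that(2)] no_hole_eval[OF that(1), of g t] by auto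
  consider "holes (assoc_word a) = 1" "holes (assoc_word b) = 0"
    | "holes (assoc_word a) = 0" "holes (assoc_word b) = 1" using NBr.prems(1) by fastforce
  then show ?case
  proof cases
    case 1
    have "comm (ev_hole g a) (ev_hole g b) - mul (sub (plug (assoc_word a)) e) (mon (assoc_word (plug_na b t)))
        \<in> low (SG S) (assoc_word (plug_na a t) @ assoc_word (plug_na b t))"
      by (rule comm_low[OF mul_SG_MW label[OF 1(1) g(1)] NBr.IH(1)[OF 1(1) g(1)] MW[OF 1(2) g(2)] gt])
    moreover have "plug (assoc_word (NBr a b)) = (\<lambda>u. plug (assoc_word a) u @ assoc_word (plug_na b t))"
      using 1(2) by (auto simp: fun_eq_iff intro!: no_hole_plug)
    ultimately show ?thesis by (simp add: mul_sub_right)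
  next
    case 2
    have "comm (ev_hole g a) (ev_hole g b) - mul (mon (assoc_word (plug_na a t))) (sub (plug (assoc_word b)) e)
        \<in> low (SG S) (assoc_word (plug_na a t) @ assoc_word (plug_na b t))"
      by (rule comm_low[OF _ MW[OF 2(1) g(1)] label[OF 2(2) g(2)] NBr.IH(2)[OF 2(2) g(2)] gt])
        (use mul_SG_MW in blast)
    moreover have "plug (assoc_word (NBr a b)) = (\<lambda>u. assoc_word (plug_na a t) @ plug (assoc_word b) u)"
      using 2(1) by (auto simp: fun_eq_iff intro!: no_hole_plug)
    ultimately show ?thesis by (simp add: mul_sub_left)
  qed
next
  case (NOp \<omega> ts)
  obtain as c bs where ts: "ts = as @ c # bs" "holes (assoc_word c) = 1"
    "\<forall>y\<in>set as \<union> set bs. holes (assoc_word y) = 0"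
    using sum_list_eq_1_split[of "holes \<circ> assoc_word" ts] NOp.prems(1) by (auto simp: comp_def)
  have good: "good (plug_na y t)" if "y \<in> set ts" for y using NOp.prems(2) that by auto
  let ?MW = "MW :: (('x, 'o) oword \<times> ('x, 'o, 'k) oalg) set"
  let ?w = "\<lambda>y. assoc_word (plug_na y t)"
  let ?f = "\<lambda>y. (?MW, (?w y, mon (?w y) :: ('x, 'o, 'k) oalg), ev_hole g y :: ('x, 'o, 'k) oalg)"
  let ?e = "sub (plug (assoc_word c)) e"
  let ?ts = "map ?f as @ (SG S, (?w c, ?e), ev_hole g c) # map ?f bs"
  have "oper \<omega> (map (snd \<circ> snd) ?ts) - oper \<omega> (map (snd \<circ> fst \<circ> snd) ?ts)
      \<in> low (SG S) [Op \<omega> (map (fst \<circ> fst \<circ> snd) ?ts)]"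
  proof (rule multi_low[where M = "oper \<omega>" and c = "\<lambda>us. [Op \<omega> us]", OF linmap_oper])
    show "dl_gt u v \<Longrightarrow> dl_gt [Op \<omega> (as @ u # bs)] [Op \<omega> (as @ v # bs)]"
      for u v :: "('x, 'o) oword" and as bs by (rule dl_gt_Op)
  next
    fix qs assume qs: "map fst qs = map fst ?ts" and ok: "\<forall>(G, p)\<in>set qs. p \<in> G"
    obtain qa q qb where q: "qs = qa @ q # qb" "map fst qa = map fst (map ?f as)" "fst q = SG S"
      "map fst qb = map fst (map ?f bs)"
      using qs by (auto simp: map_eq_append_conv map_eq_Cons_conv)
    have MW: "map (snd \<circ> snd) l = map mon (map (fst \<circ> snd) l) \<and> set (map (fst \<circ> snd) l) \<subseteq> OW"
      if l: "map fst l = map fst (map ?f zs)" "set l \<subseteq> set qs" for l zs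
    proof -
      have "snd x \<in> MW" if x: "x \<in> set l" for x
      proof -
        have "fst x \<in> set (map fst l)" using x by simp
        then have "fst x = ?MW" unfolding l(1) by auto
        moreover have "snd x \<in> fst x" using ok x l(2) by (cases x) fastforce
        ultimately show ?thesis by simp
      qed
      then show ?thesis by force
    qed
    have "snd q \<in> SG S" using ok q(1,3) by (cases q) auto
    then have qSG: "(fst (snd q), snd (snd q)) \<in> SG S" by simp
    have len: "length qa = length as" "length qb = length bs"
      using arg_cong[OF q(2), of length] arg_cong[OF q(4), of length] by simp_all
    have om: "\<omega> \<in> Om" "length (map (fst \<circ> snd) qa) + Suc (length (map (fst \<circ> snd) qb)) = ar \<omega>"
      using NOp.prems(2) ts(1) len by simp_all
    have "set qa \<subseteq> set qs" "set qb \<subseteq> set qs" using q(1) by auto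
    note a = MW[OF q(2) this(1)] and b = MW[OF q(4) this(2)]
    have "([Op \<omega> (map (fst \<circ> snd) qa @ fst (snd q) # map (fst \<circ> snd) qb)],
        oper \<omega> (map mon (map (fst \<circ> snd) qa) @ snd (snd q) # map mon (map (fst \<circ> snd) qb))) \<in> SG S"
      by (rule oper_SG[OF qSG om]) (use a b in blast)+
    moreover have "map (snd \<circ> snd) qs = map mon (map (fst \<circ> snd) qa) @ snd (snd q) # map mon (map (fst \<circ> snd) qb)"
      using a b unfolding q(1) by simp
    moreover have "map (fst \<circ> snd) qs = map (fst \<circ> snd) qa @ fst (snd q) # map (fst \<circ> snd) qb"
      by (simp add: q(1))
    ultimately show "([Op \<omega> (map (fst \<circ> snd) qs)], oper \<omega> (map (snd \<circ> snd) qs)) \<in> SG S"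
      by (simp only:)
  next
    fix G u e' x assume mem: "(G, (u, e'), x) \<in> set ?ts"
    have "(?w c, ?e) \<in> SG S" using SG_ctx[OF one_hole_ctx[OF ts(2) good] t(1)] ts(1) by (simp add: assoc_plug_na)
    moreover have "ev_hole g c - ?e \<in> low (SG S) (?w c)" using NOp.IH[of c] ts good by auto
    moreover have "(?w y, mon (?w y)) \<in> ?MW \<and> ev_hole g y - mon (?w y) \<in> low ?MW (?w y)"
      if "y \<in> set as \<union> set bs" for y
    proof -
      have "good (plug_na y t)" "holes (assoc_word y) = 0" using that good ts by auto
      then show ?thesis using good_word good_low no_hole_eval[of y g t] by auto
    qed
    ultimately show "(u, e') \<in> G \<and> x - e' \<in> low G u" using mem by auto
  qed
  moreover have "ev_hole g (NOp \<omega> ts) = oper \<omega> (map (snd \<circ> snd) ?ts)"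
    using ts(1) by (simp add: comp_def)
  moreover have "assoc_word (plug_na (NOp \<omega> ts) t) = [Op \<omega> (map (fst \<circ> fst \<circ> snd) ?ts)]"
    using ts(1) by (simp add: comp_def)
  moreover have "sub (plug (assoc_word (NOp \<omega> ts))) e = oper \<omega> (map (snd \<circ> fst \<circ> snd) ?ts)"
  proof -
    define us where "us = map ?w as"
    define vs where "vs = map ?w bs"
    have "map (\<lambda>x. plug (assoc_word x) s) as = us" "map (\<lambda>x. plug (assoc_word x) s) bs = vs" for s
      unfolding us_def vs_def using ts(3) by (auto intro!: no_hole_plug)
    then have "plug (assoc_word (NOp \<omega> ts)) = (\<lambda>s. [Op \<omega> (us @ plug (assoc_word c) s # vs)])"
      using ts(1) by (simp add: fun_eq_iff comp_def)
    then have "sub (plug (assoc_word (NOp \<omega> ts))) e = oper \<omega> (map mon us @ ?e # map mon vs)"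
      by (simp add: oper_sub sub_sub)
    then show ?thesis by (simp add: us_def vs_def comp_def)
  qed
  ultimately show ?case by (simp only:)
qed

lemma ideal_comm: "lie_ideal X Om ar I \<Longrightarrow> f \<in> I \<Longrightarrow> g \<in> LA \<Longrightarrow> comm f g \<in> I \<and> comm g f \<in> I"
  by (simp add: lie_ideal_def)

text \<open>Whatever stands beside the hole evaluates to an element of \<open>LA\<close>, and the
  ideal absorbs it.\<close>

lemma one_hole_ideal:
  assumes I: "lie_ideal X Om ar I" and g: "g \<in> I"
  shows "holes (assoc_word C) = 1 \<Longrightarrow> good (plug_na C t) \<Longrightarrow> ev_hole g C \<in> I"
proof (induction C)
  case (NVar z)
  then show ?case using g by (cases z) auto
next
  case (NBr a b)
  have gd: "good (plug_na a t)" "good (plug_na b t)" using NBr.prems by auto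
  have LA: "ev_hole g d \<in> LA" if "holes (assoc_word d) = 0" "good (plug_na d t)" for d
    using good_LA[OF that(2)] no_hole_eval[OF that(1), of g t] by simp
  consider "holes (assoc_word a) = 1" "holes (assoc_word b) = 0"
    | "holes (assoc_word a) = 0" "holes (assoc_word b) = 1" using NBr.prems(1) by fastforce
  then show ?case
    by cases (use ideal_comm[OF I] LA NBr.IH gd in auto)
next
  case (NOp \<omega> ts)
  obtain as c bs where ts: "ts = as @ c # bs" "holes (assoc_word c) = 1"
    "\<forall>y\<in>set as \<union> set bs. holes (assoc_word y) = 0"
    using sum_list_eq_1_split[of "holes \<circ> assoc_word" ts] NOp.prems(1) by (auto simp: comp_def)
  have good: "good (plug_na y t)" if "y \<in> set ts" for y using NOp.prems(2) that by auto
  have c: "ev_hole g c \<in> I" using NOp.IH[of c] ts good by auto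
  have "ev_hole g y \<in> LA" if "y \<in> set ts" for y
  proof (cases "y = c")
    case True
    then show ?thesis using c I by (auto simp: lie_ideal_def)
  next
    case False
    then have "holes (assoc_word y) = 0" using that ts by auto
    then show ?thesis using good_LA[OF good[OF that]] no_hole_eval[of y g t] by simp
  qed
  then have "set (map (ev_hole g) ts) \<subseteq> LA" by auto
  moreover have "set (map (ev_hole g) ts) \<inter> I \<noteq> {}" using c ts(1) by auto
  moreover have "\<omega> \<in> Om" "length (map (ev_hole g) ts) = ar \<omega>" using NOp.prems(2) by auto
  ultimately show ?case using I unfolding lie_ideal_def eval_na.simps by blast
qed

text \<open>The description in \<open>alsw_factors\<close> denotes the factorization of Chen, Fox
  and Lyndon. The primes of its factors are primes of \<open>c\<close>, so the factors lie in
  \<open>AW\<close>.\<close>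

lemma alsw_factors:
  assumes "set c \<subseteq> AP"
  obtains cs where "alsw_factors X Om ar c = cs" "concat cs = c" "set cs \<subseteq> AW" "lyn.lyndon_factors cs"
proof -
  have PR: "set c \<subseteq> PR" using assms aprimes_oprimes by blast
  obtain cs where cs: "concat cs = c" "lyn.lyndon_factors cs" using lyn.ex_lyndon_factors[OF PR] by blast
  have AW: "set cs \<subseteq> AW"
  proof
    fix d assume d: "d \<in> set cs"
    then have "set d \<subseteq> set c" using cs(1) by auto
    then show "d \<in> AW" using d cs(2) assms by (auto simp: oalsw_iff lyn.lyndon_factors_def)
  qed
  have "alsw_factors X Om ar c = cs"
    unfolding alsw_factors_def
  proof (rule the_equality)
    fix ds assume ds: "concat ds = c \<and> set ds \<subseteq> AW \<and>
      (\<forall>t. Suc t < length ds \<longrightarrow> lex_ge prime_gt (ds ! Suc t) (ds ! t))"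
    then have "lyn.lyndon_factors ds" using AW_alsw by (auto simp: lyn.lyndon_factors_def)
    then show "ds = cs" using lyn.lyndon_factors_unique cs ds PR by metis
  qed (use cs AW in \<open>auto simp: lyn.lyndon_factors_def\<close>)
  then show ?thesis using that cs AW by blast
qed

lemma foldl_low:
  fixes f :: "('x, 'o, 'k::field) oalg"
  assumes f: "f \<in> S" and v: "lead f \<in> AW" and vc: "lead f @ concat cs \<in> AW"
    and cs: "set cs \<subseteq> AW" "lyn.lyndon_factors cs"
  shows "k \<le> length cs \<Longrightarrow> foldl comm f (map LB (take k cs)) - sub (\<lambda>u. u @ concat (take k cs)) f
    \<in> low (SG S) (lead f @ concat (take k cs))"
proof (induction k)
  case 0
  then show ?case by (simp add: low_zero)
next
  case (Suc k)
  let ?C = "concat (take k cs)" and ?d = "cs ! k"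
  have k: "k < length cs" using Suc.prems by simp
  then have d: "?d \<in> AW" using cs by auto
  have take: "take (Suc k) cs = take k cs @ [?d]" using k by (rule take_Suc_conv_app_nth)
  have "set (take k cs) \<subseteq> AW" by (rule order_trans[OF set_take_subset cs(1)])
  then have C: "set ?C \<subseteq> PR" using AW_PR by auto
  have "lex_gt prime_gt (lead f @ ?C @ ?d) (?d @ lead f @ ?C)"
    using lyn.lyndon_factors_rotate[OF AW_alsw[OF vc] AW_nonempty[OF v] AW_PR[OF vc] cs(2) k] .
  then have gt: "dl_gt ((lead f @ ?C) @ ?d) (?d @ lead f @ ?C)"
    using lex_gt_rotate[of "lead f @ ?C" ?d] by simp
  have "ctx (\<lambda>u. u @ ?C)" using ctx_append[of "[]" ?C] C by simp
  then have label: "(lead f @ ?C, sub (\<lambda>u. u @ ?C) f) \<in> SG S" using SG_I[of "\<lambda>u. u @ ?C" f S] f by simp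
  have d_OW: "(?d, mon ?d) \<in> MW" using subsetD[OF oalsw_owords d] by simp
  have "comm (foldl comm f (map LB (take k cs))) (LB ?d) - mul (sub (\<lambda>u. u @ ?C) f) (mon ?d)
      \<in> low (SG S) ((lead f @ ?C) @ ?d)"
    by (rule comm_low[OF mul_SG_MW label _ d_OW LB_low[OF d] gt]) (use Suc in auto)
  then show ?case by (simp add: take mul_sub_right)
qed

lemma lead_AW: "f \<in> LA \<Longrightarrow> monic f \<Longrightarrow> lead f \<in> AW"
  by (simp add: lead_LA monic_def)

text \<open>There are two layers. Inside, the left-normed product of \<open>f\<close> with the
  factors of \<open>c\<close> stands in place of \<open>[vc]\<close>; outside, \<open>C\<close>
  surrounds it as it surrounds \<open>[vc]\<close> in the bracketing of
  \<open>plug \<pi> (lead f)\<close>. Each layer costs only \<open>f\<close>-words with smaller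
  labels and stays inside an ideal.\<close>

lemma special_normal:
  fixes f :: "('x, 'o, 'k::field) oalg"
  assumes ch: "valid_choice X Om ar ch" and f: "f \<in> LA" "monic f"
    and \<pi>: "\<pi> \<in> SW" and w: "plug \<pi> (lead f) \<in> AW"
  shows "special_normal X Om ar ch \<pi> f - sub (plug \<pi>) f \<in> low (SG {f}) (plug \<pi> (lead f))"
    and "lie_ideal X Om ar I \<Longrightarrow> f \<in> I \<Longrightarrow> special_normal X Om ar ch \<pi> f \<in> I"
proof -
  let ?v = "lead f"
  have v: "?v \<in> AW" using lead_AW f by blast
  obtain \<pi>1 c where ch_eq: "ch \<pi> ?v = (\<pi>1, c)" by (metis prod.collapse)
  have adm: "admissible X Om ar \<pi> ?v \<pi>1 c" using ch \<pi> v w ch_eq unfolding valid_choice_def by fastforce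
  then obtain C where \<pi>1: "\<pi>1 \<in> SW" and eq: "\<pi> = plug_star \<pi>1 (star @ lift_word c)"
    and vc: "?v @ c \<in> AW" and C: "star_bracketing ?v \<pi>1 c (plug \<pi> ?v) C"
    unfolding admissible_def by blast
  have hole: "holes \<pi>1 = 1" using \<pi>1 by (simp add: star_words_iff)
  have C1: "assoc_word C = \<pi>1" "plug_na C (bracket (?v @ c)) = bracket (plug \<pi> ?v)"
    using C by (auto simp: star_bracketing_def)
  have the_C: "(THE C. star_bracketing ?v \<pi>1 c (plug \<pi> ?v) C) = C"
    using star_bracketing_unique[OF C hole] .
  have "set c \<subseteq> AP" using vc by (auto simp: oalsw_iff)
  then obtain cs where cs: "alsw_factors X Om ar c = cs" "concat cs = c" "set cs \<subseteq> AW" "lyn.lyndon_factors cs"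
    by (rule alsw_factors)
  let ?g = "foldl comm f (map LB cs)"
  have sn: "special_normal X Om ar ch \<pi> f = ev_hole ?g C"
    unfolding special_normal_def special_bracketing_def
    by (simp add: ch_eq the_C cs(1) ev_hole_plug_star_na ev_hole_foldl)
  have good: "good (plug_na C (bracket (?v @ c)))" using C1(2) good_bracket[OF w] by simp
  have "?g - sub (\<lambda>u. u @ c) f \<in> low (SG {f}) (?v @ c)"
    using foldl_low[of f "{f}" cs "length cs"] v vc cs by simp
  moreover have "ctx (\<lambda>u. u @ c)" using ctx_append[of "[]" c] AW_PR[OF vc] by simp
  then have "(?v @ c, sub (\<lambda>u. u @ c) f) \<in> SG {f}" using SG_I[of "\<lambda>u. u @ c" f "{f}"] by simp
  ultimately have "ev_hole ?g C - sub (plug \<pi>1) (sub (\<lambda>u. u @ c) f) \<in> low (SG {f}) (plug \<pi>1 (?v @ c))"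
    using one_hole_low[of "bracket (?v @ c)" "sub (\<lambda>u. u @ c) f" "{f}" ?g C] assoc_bracket[OF vc]
      C1(1) hole good by (simp add: assoc_plug_na)
  moreover have "plug \<pi> = (\<lambda>s. plug \<pi>1 (s @ c))"
    unfolding eq by (simp add: fun_eq_iff plug_plug_star del: append_Cons)
  ultimately show "special_normal X Om ar ch \<pi> f - sub (plug \<pi>) f \<in> low (SG {f}) (plug \<pi> (lead f))"
    unfolding sn by (simp add: sub_sub)
  assume I: "lie_ideal X Om ar I" and fI: "f \<in> I"
  have "foldl comm f (map LB ds) \<in> I" if "set ds \<subseteq> AW" for ds
    using that fI
  proof (induction ds arbitrary: f)
    case (Cons d ds)
    then show ?case using ideal_comm[OF I Cons.prems(2) LB_LA] by simp
  qed simp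
  then have "?g \<in> I" using cs(3) by blast
  then show "special_normal X Om ar ch \<pi> f \<in> I"
    unfolding sn using one_hole_ideal[OF I] C1(1) hole good by blast
qed

end

section \<open>The Composition-Diamond lemma for the associative algebra\<close>

context operated
begin

text \<open>Triviality of a composition is expressed as membership in \<open>low (SG S)\<close>.
  Since the identity is a context, the second clause also compares two elements with the same
  leading word.\<close>

definition assoc_gsb :: "('x, 'o, 'k::field) oalg set \<Rightarrow> bool" where
  "assoc_gsb S \<longleftrightarrow>
     (\<forall>f\<in>S. \<forall>g\<in>S. \<forall>a b. set a \<subseteq> PR \<and> set b \<subseteq> PR \<and> a \<noteq> [] \<and> b \<noteq> [] \<and> lead f @ a = b @ lead g \<and>
        length (lead f @ a) < length (lead f) + length (lead g) \<longrightarrow>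
        sub (\<lambda>u. u @ a) f - sub (\<lambda>u. b @ u) g \<in> low (SG S) (lead f @ a)) \<and>
     (\<forall>f\<in>S. \<forall>g\<in>S. \<forall>F. ctx F \<and> lead f = F (lead g) \<longrightarrow> f - sub F g \<in> low (SG S) (lead f))"

text \<open>Both terms differ from the bilinear extension of \<open>T\<close> at \<open>(f, g)\<close> by lower \<open>S\<close>-words.\<close>

lemma disjoint_occurrences:
  fixes f g :: "('x, 'o, 'k::field) oalg"
  assumes T: "\<And>v. v \<in> OW \<Longrightarrow> ctx (\<lambda>u. T u v)" "\<And>u. u \<in> OW \<Longrightarrow> ctx (T u)"
    and fg: "f \<in> S" "g \<in> S" "monic f" "f \<in> FA" "monic g" "g \<in> FA"
  shows "sub (\<lambda>u. T u (lead g)) f - sub (T (lead f)) g \<in> low (SG S) (T (lead f) (lead g))"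
proof -
  define B where "B f g = lin (\<lambda>u. lin (\<lambda>v. mon (T u v)) g) f" for f g :: "('x, 'o, 'k) oalg"
  let ?u = "lead f" and ?v = "lead g"
  have B1: "linmap (\<lambda>f. B f g)" for g unfolding B_def by (rule linmap_lin)
  have B2: "linmap (B f)" for f unfolding B_def[abs_def] by (intro linmap_lin_param linmap_lin)
  have Bf: "B f (mon v) = sub (\<lambda>u. T u v) f" for f v by (simp add: B_def sub_def)
  have Bg: "B (mon u) g = sub (T u) g" for g u by (simp add: B_def sub_def)
  have OW: "?u \<in> OW" "?v \<in> OW" using fg by (simp_all add: lead_OW monic_def)
  have 1: "B f (g - mon ?v) \<in> low (SG S) (T ?u ?v)"
  proof (rule linmap_low[OF B2 monic_low[OF fg(5,6)]])
    fix v and e :: "('x, 'o, 'k) oalg" assume v: "(v, e) \<in> MW" "dl_gt ?v v"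
    then show "B f e \<in> low (SG S) (T ?u ?v)"
      using low_base[OF SG_I[OF T(1)[of v] fg(1)] ctx_mono[OF T(2)[OF OW(1)] v(2)]] by (auto simp: Bf)
  qed
  have 2: "B (f - mon ?u) g \<in> low (SG S) (T ?u ?v)"
  proof (rule linmap_low[OF B1 monic_low[OF fg(3,4)]])
    fix u and e :: "('x, 'o, 'k) oalg" assume u: "(u, e) \<in> MW" "dl_gt ?u u"
    then show "B e g \<in> low (SG S) (T ?u ?v)"
      using low_base[OF SG_I[OF T(2)[of u] fg(2)] ctx_mono[OF T(1)[OF OW(2)] u(2)]] by (auto simp: Bg)
  qed
  have "sub (\<lambda>u. T u ?v) f - sub (T ?u) g = B (f - mon ?u) g - B f (g - mon ?v)"
    by (simp add: module_hom.diff[OF B1] module_hom.diff[OF B2] Bf Bg)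
  then show ?thesis using low_diff[OF 2 1] by simp
qed

end

locale assoc_basis = operated X Om ar
  for X :: "'x::wellorder set" and Om :: "'o::wellorder set" and ar +
  fixes S :: "('x, 'o, 'k::field) oalg set"
  assumes gsb: "assoc_gsb S" and S: "s \<in> S \<Longrightarrow> monic s \<and> s \<in> FA"
begin

section \<open>Two occurrences of leading words in one word\<close>

lemma lead_S_OW: "s \<in> S \<Longrightarrow> lead s \<in> OW"
  using S by (simp add: lead_OW monic_def)

lemma lead_S_PR: "s \<in> S \<Longrightarrow> set (lead s) \<subseteq> PR"
  using lead_S_OW by (simp add: owords_iff)

text \<open>Intended for \<open>F (lead f) = G (lead g)\<close>, where it is symmetric: the
  \<open>S\<close>-words attached to two occurrences in the same word are equal modulo smaller
  ones.\<close>

definition agree :: "(('x, 'o) oword \<Rightarrow> ('x, 'o) oword) \<Rightarrow> ('x, 'o, 'k) oalg \<Rightarrow>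
    (('x, 'o) oword \<Rightarrow> ('x, 'o) oword) \<Rightarrow> ('x, 'o, 'k) oalg \<Rightarrow> bool" where
  "agree F f G g \<longleftrightarrow> sub F f - sub G g \<in> low (SG S) (F (lead f))"

lemma agree_sym: "agree F f G g \<Longrightarrow> F (lead f) = G (lead g) \<Longrightarrow> agree G g F f"
  unfolding agree_def using low_neg[of "sub F f - sub G g" "SG S" "F (lead f)"] by simp

lemma agree_ctx: "agree F f G g \<Longrightarrow> ctx H \<Longrightarrow> agree (\<lambda>u. H (F u)) f (\<lambda>u. H (G u)) g"
  unfolding agree_def using sub_low_SG[of H "sub F f - sub G g" S "F (lead f)"]
  by (simp add: module_hom.diff[OF linmap_sub] sub_sub)

lemma agree_inclusion:
  assumes "f \<in> S" "g \<in> S" "ctx H" "lead f = H (lead g)" "set a \<subseteq> PR" "set b \<subseteq> PR"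
  shows "agree (\<lambda>u. a @ u @ b) f (\<lambda>v. a @ H v @ b) g"
proof -
  have "f - sub H g \<in> low (SG S) (lead f)" using gsb assms(1-4) unfolding assoc_gsb_def by blast
  then have "agree (\<lambda>u. u) f H g" by (simp add: agree_def)
  from agree_ctx[OF this ctx_append[OF assms(5,6)]] show ?thesis .
qed

lemma agree_intersection:
  assumes "f \<in> S" "g \<in> S" "set x \<subseteq> PR" "set z \<subseteq> PR" "x \<noteq> []" "z \<noteq> []" "y \<noteq> []"
    and "lead f = z @ y" "lead g = y @ x" "set a \<subseteq> PR" "set b \<subseteq> PR"
  shows "agree (\<lambda>u. a @ u @ x @ b) f (\<lambda>v. a @ z @ v @ b) g"
proof -
  have "length (lead f @ x) < length (lead f) + length (lead g)" "lead f @ x = z @ lead g"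
    using assms by simp_all
  then have "sub (\<lambda>u. u @ x) f - sub (\<lambda>u. z @ u) g \<in> low (SG S) (lead f @ x)"
    using gsb assms(1-6) unfolding assoc_gsb_def by blast
  then have "agree (\<lambda>u. u @ x) f (\<lambda>v. z @ v) g" by (simp add: agree_def)
  from agree_ctx[OF this ctx_append[OF assms(10,11)]] show ?thesis by simp
qed

lemma agree_disjoint:
  assumes "\<And>v. v \<in> OW \<Longrightarrow> ctx (\<lambda>u. T u v)" "\<And>u. u \<in> OW \<Longrightarrow> ctx (T u)" "f \<in> S" "g \<in> S"
  shows "agree (\<lambda>u. T u (lead g)) f (T (lead f)) g"
  unfolding agree_def using disjoint_occurrences[OF assms] S assms(3,4) by blast

text \<open>The occurrence of \<open>lead f\<close> starts no later than that of
  \<open>lead g\<close>. They are disjoint, or overlap properly, or \<open>lead f\<close> contains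
  \<open>lead g\<close>, or both start at the same place, \<open>z = []\<close>, and
  \<open>lead g\<close> contains \<open>lead f\<close>.\<close>

lemma agree_append_append_aux:
  assumes fg: "f \<in> S" "g \<in> S" and A: "set a \<subseteq> PR" "set b \<subseteq> PR" "set a' \<subseteq> PR" "set b' \<subseteq> PR"
    and z: "a' = a @ z" and eq: "lead f @ b = z @ lead g @ b'"
  shows "agree (\<lambda>u. a @ u @ b) f (\<lambda>v. a' @ v @ b') g"
  using eq
proof (cases rule: append_eq_appendE)
  case (right y)
  have y: "set y \<subseteq> PR" using z A(3) right(1) by auto
  have "agree (\<lambda>u. a @ u @ y @ lead g @ b') f (\<lambda>v. a @ lead f @ y @ v @ b') g"
  proof (rule agree_disjoint[where T = "\<lambda>u v. a @ u @ y @ v @ b'", OF _ _ fg])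
    show "v \<in> OW \<Longrightarrow> ctx (\<lambda>u. a @ u @ y @ v @ b')" for v
      using A y by (intro ctx_append) (auto simp: owords_iff)
    show "u \<in> OW \<Longrightarrow> ctx (\<lambda>v. a @ u @ y @ v @ b')" for u
      using ctx_append[of "a @ u @ y" b'] A y by (simp add: owords_iff)
  qed
  then show ?thesis using z right by simp
next
  case (left y)
  have zy: "set z \<subseteq> PR" "set y \<subseteq> PR" using left(1) lead_S_PR[OF fg(1)] by auto
  from left(2) show ?thesis
  proof (cases rule: append_eq_appendE)
    case (left x)
    have x: "set x \<subseteq> PR" using left(1) lead_S_PR[OF fg(2)] by auto
    show ?thesis
    proof (cases "z = []")
      case True
      then have "lead g = [] @ lead f @ x" using left(1) \<open>lead f = z @ y\<close> by simp
      then have "agree (\<lambda>v. a @ v @ b') g (\<lambda>u. a @ ([] @ u @ x) @ b') f"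
        using x A by (intro agree_inclusion[OF fg(2,1)] ctx_append) auto
      from agree_sym[OF this] show ?thesis using True z left \<open>lead f = z @ y\<close> by simp
    next
      case False
      then have "agree (\<lambda>u. a @ u @ x @ b') f (\<lambda>v. a @ z @ v @ b') g"
        using agree_intersection[OF fg x zy(1) \<open>x \<noteq> []\<close> _ \<open>y \<noteq> []\<close> \<open>lead f = z @ y\<close> left(1) A(1,4)] by blast
      then show ?thesis using z left(2) by simp
    qed
  next
    case (right x)
    have x: "set x \<subseteq> PR" using right(1) zy by auto
    have "agree (\<lambda>u. a @ u @ b) f (\<lambda>v. a @ (z @ v @ x) @ b) g"
      using \<open>lead f = z @ y\<close> right(1) zy x A by (intro agree_inclusion[OF fg] ctx_append) auto
    then show ?thesis using z right(2) by simp
  qed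
qed

lemma agree_append_append:
  assumes fg: "f \<in> S" "g \<in> S" and A: "set a \<subseteq> PR" "set b \<subseteq> PR" "set a' \<subseteq> PR" "set b' \<subseteq> PR"
    and eq: "a @ lead f @ b = a' @ lead g @ b'"
  shows "agree (\<lambda>u. a @ u @ b) f (\<lambda>v. a' @ v @ b') g"
  using eq
proof (cases rule: append_eq_appendE)
  case (right z)
  then show ?thesis by (rule agree_append_append_aux[OF fg A])
next
  case (left z)
  have "agree (\<lambda>v. a' @ v @ b') g (\<lambda>u. a @ u @ b) f"
    by (rule agree_append_append_aux[OF fg(2,1) A(3,4,1,2) left(1,2)])
  then show ?thesis by (rule agree_sym) (simp add: eq)
qed

text \<open>The second occurrence lies within a single prime, which is one letter of the word. A
  proper overlap is therefore impossible: the prime belongs to \<open>lead f\<close> or stands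
  beside it.\<close>

lemma agree_append_Op:
  assumes fg: "f \<in> S" "g \<in> S" and A: "set a \<subseteq> PR" "set b \<subseteq> PR"
    and G: "ctx G" "\<omega> \<in> Om" "length us + Suc (length vs) = ar \<omega>" "set us \<subseteq> OW" "set vs \<subseteq> OW"
      "set a' \<subseteq> PR" "set b' \<subseteq> PR"
    and eq: "a @ lead f @ b = a' @ Op \<omega> (us @ G (lead g) # vs) # b'"
  shows "agree (\<lambda>u. a @ u @ b) f (\<lambda>v. a' @ Op \<omega> (us @ G v # vs) # b') g"
proof -
  let ?P = "\<lambda>v. Op \<omega> (us @ G v # vs)"
  have P: "v \<in> OW \<Longrightarrow> ?P v \<in> PR" for v using G ctx_OW by (auto simp: Op_PR)
  from eq show ?thesis
  proof (cases rule: append_eq_appendE)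
    case (left z)
    then obtain z' where z: "z = ?P (lead g) # z'" "b' = z' @ lead f @ b"
      by (cases z) auto
    have z': "set z' \<subseteq> PR" using A left(1) z(1) by auto
    have "agree (\<lambda>u. a' @ ?P (lead g) # z' @ u @ b) f (\<lambda>v. a' @ ?P v # z' @ lead f @ b) g"
    proof (rule agree_disjoint[where T = "\<lambda>u v. a' @ ?P v # z' @ u @ b", OF _ _ fg])
      show "v \<in> OW \<Longrightarrow> ctx (\<lambda>u. a' @ ?P v # z' @ u @ b)" for v
        using ctx_append[of "a' @ ?P v # z'" b] A G z' P[of v] by simp
      show "u \<in> OW \<Longrightarrow> ctx (\<lambda>v. a' @ ?P v # z' @ u @ b)" for u
        using ctx_Op[of G \<omega> us vs a' "z' @ u @ b"] A G z' by (simp add: owords_iff[of u])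
    qed
    then show ?thesis using left z by simp
  next
    case (right z)
    from right(2) show ?thesis
    proof (cases rule: append_eq_appendE)
      case (left y)
      then obtain y' where y: "y = ?P (lead g) # y'" "b' = y' @ b" by (cases y) auto
      have zy: "set z \<subseteq> PR" "set y' \<subseteq> PR" using left(1) y(1) lead_S_PR[OF fg(1)] by auto
      have "agree (\<lambda>u. a @ u @ b) f (\<lambda>v. a @ (z @ ?P v # y') @ b) g"
        using left(1) y(1) zy A G by (intro agree_inclusion[OF fg] ctx_Op) auto
      then show ?thesis using right(1) y(2) by simp
    next
      case y: (right y)
      have yP: "set y \<subseteq> PR" using G(6) right(1) y(1) by auto
      have "agree (\<lambda>u. a @ u @ y @ ?P (lead g) # b') f (\<lambda>v. a @ lead f @ y @ ?P v # b') g"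
      proof (rule agree_disjoint[where T = "\<lambda>u v. a @ u @ y @ ?P v # b'", OF _ _ fg])
        show "v \<in> OW \<Longrightarrow> ctx (\<lambda>u. a @ u @ y @ ?P v # b')" for v
          using ctx_append[of a "y @ ?P v # b'"] A G yP P[of v] by simp
        show "u \<in> OW \<Longrightarrow> ctx (\<lambda>v. a @ u @ y @ ?P v # b')" for u
          using ctx_Op[of G \<omega> us vs "a @ u @ y" b'] A G yP by (simp add: owords_iff[of u])
      qed
      then show ?thesis using right(1) y by simp
    qed
  qed
qed

text \<open>Occurrences inside two different primes are disjoint; \<open>z\<close> begins with the
  first prime and ends before the second.\<close>

lemma agree_Op_Op_aux:
  assumes fg: "f \<in> S" "g \<in> S"
    and F: "ctx F" "\<omega> \<in> Om" "length us + Suc (length vs) = ar \<omega>" "set us \<subseteq> OW" "set vs \<subseteq> OW"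
      "set a \<subseteq> PR" "set b \<subseteq> PR"
    and G: "ctx G" "\<theta> \<in> Om" "length us' + Suc (length vs') = ar \<theta>" "set us' \<subseteq> OW" "set vs' \<subseteq> OW"
      "set a' \<subseteq> PR" "set b' \<subseteq> PR"
    and z: "a' = a @ z" "z \<noteq> []"
      "Op \<omega> (us @ F (lead f) # vs) # b = z @ Op \<theta> (us' @ G (lead g) # vs') # b'"
  shows "agree (\<lambda>u. a @ Op \<omega> (us @ F u # vs) # b) f (\<lambda>v. a' @ Op \<theta> (us' @ G v # vs') # b') g"
proof -
  let ?P = "\<lambda>u. Op \<omega> (us @ F u # vs)" and ?Q = "\<lambda>v. Op \<theta> (us' @ G v # vs')"
  have P: "u \<in> OW \<Longrightarrow> ?P u \<in> PR" and Q: "u \<in> OW \<Longrightarrow> ?Q u \<in> PR" for u using F G ctx_OW by (auto simp: Op_PR)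
  obtain z' where z': "z = ?P (lead f) # z'" "b = z' @ ?Q (lead g) # b'" using z by (cases z) auto
  have zP: "set z' \<subseteq> PR" using z'(1) z(1) G(6) by auto
  have "agree (\<lambda>u. a @ ?P u # z' @ ?Q (lead g) # b') f (\<lambda>v. a @ ?P (lead f) # z' @ ?Q v # b') g"
  proof (rule agree_disjoint[where T = "\<lambda>u v. a @ ?P u # z' @ ?Q v # b'", OF _ _ fg])
    show "v \<in> OW \<Longrightarrow> ctx (\<lambda>u. a @ ?P u # z' @ ?Q v # b')" for v
      using ctx_Op[OF F(1-6), of "z' @ ?Q v # b'"] zP Q[of v] G(7) by simp
    show "u \<in> OW \<Longrightarrow> ctx (\<lambda>v. a @ ?P u # z' @ ?Q v # b')" for u
      using ctx_Op[OF G(1-5), of "a @ ?P u # z'" b'] zP P[of u] F(6) G(7) by simp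
  qed
  then show ?thesis using z' z(1) by simp
qed

text \<open>The same disjointness one level deeper, for two different arguments of one
  prime.\<close>

lemma agree_args_aux:
  assumes fg: "f \<in> S" "g \<in> S" and \<omega>: "\<omega> \<in> Om"
    and F: "ctx F" "length us + Suc (length vs) = ar \<omega>" "set us \<subseteq> OW" "set vs \<subseteq> OW"
    and G: "ctx G" "length us' + Suc (length vs') = ar \<omega>" "set us' \<subseteq> OW" "set vs' \<subseteq> OW"
    and A: "set a \<subseteq> PR" "set b \<subseteq> PR"
    and z: "us' = us @ z" "z \<noteq> []" "F (lead f) # vs = z @ G (lead g) # vs'"
  shows "agree (\<lambda>u. a @ Op \<omega> (us @ F u # vs) # b) f (\<lambda>v. a @ Op \<omega> (us' @ G v # vs') # b) g"
proof -
  obtain z' where z': "z = F (lead f) # z'" "vs = z' @ G (lead g) # vs'" using z by (cases z) auto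
  have zO: "set z' \<subseteq> OW" using z'(1) z(1) G(3) by auto
  have "agree (\<lambda>u. a @ Op \<omega> (us @ F u # z' @ G (lead g) # vs') # b) f
      (\<lambda>v. a @ Op \<omega> (us @ F (lead f) # z' @ G v # vs') # b) g"
  proof (rule agree_disjoint[where T = "\<lambda>u v. a @ Op \<omega> (us @ F u # z' @ G v # vs') # b", OF _ _ fg])
    show "v \<in> OW \<Longrightarrow> ctx (\<lambda>u. a @ Op \<omega> (us @ F u # z' @ G v # vs') # b)" for v
      using ctx_Op[OF F(1) \<omega>, of us "z' @ G v # vs'" a b] F(2,3) G(4) A zO z' ctx_OW[OF G(1)] by simp
    show "u \<in> OW \<Longrightarrow> ctx (\<lambda>v. a @ Op \<omega> (us @ F u # z' @ G v # vs') # b)" for u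
      using ctx_Op[OF G(1) \<omega>, of "us @ F u # z'" vs' a b] F(2,3) G(4) A zO z' ctx_OW[OF F(1)] by simp
  qed
  then show ?thesis using z' z(1) by simp
qed

text \<open>The induction descends only if both occurrences lie in the same argument of the same
  prime. Otherwise they lie in different arguments or primes, or at least one of them is at top
  level.\<close>

lemma equal_leads_agree:
  assumes "ctx F" "ctx G" "f \<in> S" "g \<in> S" "F (lead f) = G (lead g)"
  shows "agree F f G g"
  using assms
proof (induction arbitrary: G rule: ctx.induct)
  case (ctx_append a b)
  note ab = ctx_append.hyps and G = ctx_append.prems(1) and fg = ctx_append.prems(2,3) and eq = ctx_append.prems(4)
  from G show ?case
  proof cases
    case (ctx_append a' b')
    then show ?thesis using agree_append_append[OF fg ab ctx_append(2,3)] eq by simp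
  next
    case (ctx_Op G' \<omega> us vs a' b')
    then show ?thesis using agree_append_Op[OF fg ab ctx_Op(2-8)] eq by simp
  qed
next
  case (ctx_Op F \<omega> us vs a b)
  note F = ctx_Op.hyps and G = ctx_Op.prems(1) and fg = ctx_Op.prems(2,3) and eq = ctx_Op.prems(4)
    and IH = ctx_Op.IH
  let ?F = "\<lambda>u. a @ Op \<omega> (us @ F u # vs) # b"
  from G show ?case
  proof cases
    case (ctx_append a' b')
    have "agree G g ?F f"
      using agree_append_Op[OF fg(2,1) ctx_append(2,3) F(1-7)] eq ctx_append(1) by simp
    then show ?thesis by (rule agree_sym) (use eq in simp)
  next
    case G: (ctx_Op G' \<theta> us' vs' a' b')
    have eq': "a @ Op \<omega> (us @ F (lead f) # vs) # b = a' @ Op \<theta> (us' @ G' (lead g) # vs') # b'"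
      using eq G(1) by simp
    show ?thesis
    proof (cases "length a" "length a'" rule: linorder_cases)
      case less
      from eq' obtain z where "a' = a @ z" "z \<noteq> []"
        "Op \<omega> (us @ F (lead f) # vs) # b = z @ Op \<theta> (us' @ G' (lead g) # vs') # b'"
        by (cases rule: append_eq_appendE) (use less in auto)
      then show ?thesis unfolding G(1) by (rule agree_Op_Op_aux[OF fg F(1-7) G(2-8)])
    next
      case greater
      from eq' obtain z where z: "a = a' @ z" "z \<noteq> []"
        "Op \<theta> (us' @ G' (lead g) # vs') # b' = z @ Op \<omega> (us @ F (lead f) # vs) # b"
        by (cases rule: append_eq_appendE) (use greater in auto)
      have "agree G g ?F f" unfolding G(1) by (rule agree_Op_Op_aux[OF fg(2,1) G(2-8) F(1-7) z])
      then show ?thesis by (rule agree_sym) (use eq in simp)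
    next
      case equal
      then have args: "a = a'" "b = b'" "\<omega> = \<theta>" "us @ F (lead f) # vs = us' @ G' (lead g) # vs'"
        using eq' by simp_all
      show ?thesis
      proof (cases "length us" "length us'" rule: linorder_cases)
        case less
        from args(4) obtain z where z: "us' = us @ z" "z \<noteq> []" "F (lead f) # vs = z @ G' (lead g) # vs'"
          by (cases rule: append_eq_appendE) (use less in auto)
        show ?thesis unfolding G(1) args(1-3)[symmetric]
          by (rule agree_args_aux[OF fg F(2,1,3-5) G(2) _ G(5,6) F(6,7) z]) (use G(4) args(3) in simp)
      next
        case greater
        from args(4) obtain z where z: "us = us' @ z" "z \<noteq> []" "G' (lead g) # vs' = z @ F (lead f) # vs"
          by (cases rule: append_eq_appendE) (use greater in auto)
        have "agree G g ?F f" unfolding G(1) args(1-3)[symmetric]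
          by (rule agree_args_aux[OF fg(2,1) F(2) G(2) _ G(5,6) F(1,3-5) F(6,7) z]) (use G(4) args(3) in simp)
        then show ?thesis by (rule agree_sym) (use eq in simp)
      next
        case equal
        then have "us = us'" "F (lead f) = G' (lead g)" "vs = vs'" using args(4) by simp_all
        moreover from this have "agree F f G' g" using IH[OF G(2) fg] by blast
        from agree_ctx[OF this ctx.ctx_Op[OF ctx_id F(2-7)]]
        have "agree ?F f (\<lambda>u. a @ Op \<omega> (us @ G' u # vs) # b) g" .
        ultimately show ?thesis using G(1) args(1-3) by simp
      qed
    qed
  qed
qed

section \<open>Leading words in the associative ideal\<close>

definition at_most :: "('x, 'o) oword \<Rightarrow> ('x, 'o, 'k) oalg set" where
  "at_most w = V.span {e. \<exists>u. (u, e) \<in> SG S \<and> (u = w \<or> dl_gt w u)}"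

lemma SG_OW: "(u, e) \<in> SG S \<Longrightarrow> u \<in> OW"
  using ctx_OW lead_S_OW by (elim SG_E) blast

lemma at_most_mono: "dl_gt w u \<Longrightarrow> at_most u \<subseteq> at_most w"
  unfolding at_most_def by (rule V.span_mono) (auto intro: dl_gt_trans)

text \<open>Of the finitely many labels in a representation one is greatest. The predicate
  \<open>P\<close> is carried along so that this bound can be kept below a given word.\<close>

lemma span_at_most:
  assumes "h \<in> V.span {e. \<exists>u. (u, e) \<in> SG S \<and> P u}"
  shows "h = 0 \<or> (\<exists>w\<in>OW. P w \<and> h \<in> at_most w)"
  using assms
proof (induction rule: V.span_induct_alt)
  case (step c x y)
  obtain u where u: "(u, x) \<in> SG S" "P u" using step.hyps by blast
  have uO: "u \<in> OW" using SG_OW u(1) .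
  have x: "scl c x \<in> at_most u" unfolding at_most_def using u(1) by (intro V.span_scale V.span_base) blast
  from step.IH show ?case
  proof
    assume "y = 0"
    then show ?thesis using uO u(2) x by auto
  next
    assume "\<exists>w\<in>OW. P w \<and> y \<in> at_most w"
    then obtain w where w: "w \<in> OW" "P w" "y \<in> at_most w" by blast
    have add: "scl c x \<in> at_most v \<Longrightarrow> y \<in> at_most v \<Longrightarrow> scl c x + y \<in> at_most v" for v
      unfolding at_most_def by (rule V.span_add)
    consider "u = w" | "dl_gt u w" | "dl_gt w u"
      using dl_gt_total uO w(1) by (metis owords_iff)
    then show ?thesis
      by cases (use add x w uO u(2) at_most_mono in blast)+
  qed
qed simp

text \<open>All \<open>S\<close>-words with label \<open>w\<close> are equal modulo smaller ones by
  \<open>equal_leads_agree\<close>, so their combination collapses to a multiple of a single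
  \<open>e0\<close>.\<close>

lemma at_most_step:
  assumes e0: "(w, e0) \<in> SG S" and h: "h \<in> at_most w"
  shows "\<exists>\<alpha>. h - scl \<alpha> e0 \<in> low (SG S) w"
  using h unfolding at_most_def
proof (induction rule: V.span_induct_alt)
  case base
  show ?case by (intro exI[of _ 0]) (simp add: low_zero)
next
  case (step c x y)
  obtain \<alpha> where \<alpha>: "y - scl \<alpha> e0 \<in> low (SG S) w" using step.IH by blast
  obtain u where u: "(u, x) \<in> SG S" "u = w \<or> dl_gt w u" using step.hyps by blast
  from u(2) show ?case
  proof
    assume "u = w"
    obtain F f where F: "ctx F" "f \<in> S" "u = F (lead f)" "x = sub F f" using u(1) by (rule SG_E)
    obtain G g where G: "ctx G" "g \<in> S" "w = G (lead g)" "e0 = sub G g" using e0 by (rule SG_E)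
    have "x - e0 \<in> low (SG S) w"
      using equal_leads_agree[OF F(1) G(1) F(2) G(2)] F G \<open>u = w\<close> by (simp add: agree_def)
    from low_add[OF low_scl[OF this, of c] \<alpha>]
    have "scl c x + y - scl (c + \<alpha>) e0 \<in> low (SG S) w" by (simp add: algebra_simps)
    then show ?thesis by blast
  next
    assume "dl_gt w u"
    then have "x \<in> low (SG S) w" using u(1) low_base by blast
    from low_add[OF low_scl[OF this, of c] \<alpha>]
    have "scl c x + y - scl \<alpha> e0 \<in> low (SG S) w" by (simp add: algebra_simps)
    then show ?thesis by blast
  qed
qed

lemma lead_scl: "c \<noteq> 0 \<Longrightarrow> lead (scl c f) = lead f"
proof -
  assume "c \<noteq> 0"
  then have "Poly_Mapping.keys (scl c f) = Poly_Mapping.keys f" by (auto simp: in_keys_iff)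
  then show ?thesis by (simp add: lead_def)
qed

text \<open>If the collapsed coefficient \<open>\<alpha>\<close> is nonzero, nothing cancels at
  \<open>w\<close>, which is then the leading word. Otherwise \<open>h\<close> has a representation
  with smaller labels, and well-foundedness of the order ends the descent.\<close>

lemma lead_at_most: "w \<in> OW \<Longrightarrow> h \<in> at_most w \<Longrightarrow> h \<noteq> 0 \<Longrightarrow> \<exists>F. \<exists>s\<in>S. ctx F \<and> lead h = F (lead s)"
proof (induction w arbitrary: h rule: wf_induct_rule[OF wf_dl_gt])
  case (1 w)
  have low: ?case if h: "h \<in> low (SG S) w"
  proof -
    obtain w' where "w' \<in> OW" "dl_gt w w'" "h \<in> at_most w'"
      using span_at_most[of h "dl_gt w"] h 1(4) unfolding low_def by blast
    then show ?thesis using 1(1)[of w' h] 1(2,4) by blast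
  qed
  show ?case
  proof (cases "\<exists>e0. (w, e0) \<in> SG S")
    case False
    then have "{e. \<exists>u. (u, e) \<in> SG S \<and> (u = w \<or> dl_gt w u)} = {e. \<exists>u. (u, e) \<in> SG S \<and> dl_gt w u}" by blast
    then show ?thesis using low 1(3) unfolding at_most_def low_def by simp
  next
    case True
    then obtain e0 where e0: "(w, e0) \<in> SG S" by blast
    obtain \<alpha> where \<alpha>: "h - scl \<alpha> e0 \<in> low (SG S) w" using at_most_step[OF e0 1(3)] by blast
    show ?thesis
    proof (cases "\<alpha> = 0")
      case True
      then show ?thesis using low \<alpha> by simp
    next
      case False
      obtain F s where F: "ctx F" "s \<in> S" "w = F (lead s)" "e0 = sub F s" using e0 by (rule SG_E)
      have "e0 - mon w \<in> low MW w" using sub_lead[OF F(1), of s] S F by simp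
      \<comment> \<open>Division by \<open>\<alpha>\<close> brings \<open>h\<close> into the monic
        form that \<open>lead_low\<close> expects.\<close>
      moreover have "scl (1 / \<alpha>) (h - scl \<alpha> e0) \<in> low MW w" using low_SG_MW[OF S \<alpha>] by (rule low_scl)
      ultimately have "scl (1 / \<alpha>) (h - scl \<alpha> e0) + (e0 - mon w) \<in> low MW w" by (rule low_add[rotated])
      then have "scl (1 / \<alpha>) h - mon w \<in> low MW w"
        using False by (simp add: V.scale_right_diff_distrib)
      then have "lead (scl (1 / \<alpha>) h) = w" using lead_low(1) 1(2) by blast
      then have "lead h = w" using lead_scl[of "1 / \<alpha>" h] False by simp
      then show ?thesis using F by blast
    qed
  qed
qed

end

context operated
begin

section \<open>The associative ideal and the Lie ideal generated by \<open>S\<close>\<close>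

definition assoc_ideal :: "('x, 'o, 'k::field) oalg set \<Rightarrow> ('x, 'o, 'k) oalg set" where
  "assoc_ideal S = V.span {e. \<exists>u. (u, e) \<in> SG S}"

lemma assoc_lead:
  assumes "assoc_gsb S" "\<And>s. s \<in> S \<Longrightarrow> monic s \<and> s \<in> FA" and h: "h \<in> assoc_ideal S" "h \<noteq> 0"
  shows "\<exists>F. \<exists>s\<in>S. ctx F \<and> lead h = F (lead s)"
proof -
  interpret assoc_basis X Om ar S using assms by unfold_locales
  obtain w where "w \<in> OW" "h \<in> at_most w"
    using span_at_most[of h "\<lambda>_. True"] h unfolding assoc_ideal_def by auto
  then show ?thesis using lead_at_most h(2) by blast
qed

lemma assoc_ideal_mul:
  assumes h: "h \<in> assoc_ideal S" and g: "g \<in> FA"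
  shows "mul h g \<in> assoc_ideal S" "mul g h \<in> assoc_ideal S"
proof -
  let ?B = "{e. \<exists>u. (u, e) \<in> SG S}"
  have g': "g \<in> V.span (mon ` OW)" using g unfolding FA_span .
  have 1: "mul e g \<in> V.span ?B \<and> mul g e \<in> V.span ?B" if e: "e \<in> ?B" for e
  proof -
    obtain u where u: "(u, e) \<in> SG S" using e by blast
    have m: "mul e (mon v) \<in> V.span ?B" "mul (mon v) e \<in> V.span ?B" if "v \<in> OW" for v
      using mul_SG_MW[OF u, of v "mon v"] that by (auto intro!: V.span_base)
    show ?thesis using linmap_span[OF linmap_mul_right g', of e ?B] linmap_span[OF linmap_mul_left g', of e ?B] m
      by blast
  qed
  show "mul h g \<in> assoc_ideal S" "mul g h \<in> assoc_ideal S"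
    using linmap_span[OF linmap_mul_left, of h ?B g ?B] linmap_span[OF linmap_mul_right, of h ?B g ?B] 1 h
    unfolding assoc_ideal_def by blast+
qed

text \<open>One argument is expanded in \<open>S\<close>-words and the others in words; an operator
  applied to such arguments gives an \<open>S\<close>-word again.\<close>

lemma assoc_ideal_oper:
  fixes fs :: "('x, 'o, 'k::field) oalg list"
  assumes \<omega>: "\<omega> \<in> Om" and fs: "length fs = ar \<omega>" "set fs \<subseteq> FA" "set fs \<inter> assoc_ideal S \<noteq> {}"
  shows "oper \<omega> fs \<in> assoc_ideal S"
proof -
  let ?B = "{e. \<exists>u. (u, e) \<in> SG S}" and ?M = "mon ` OW :: ('x, 'o, 'k) oalg set"
  obtain x where "x \<in> set fs" "x \<in> V.span ?B" using fs(3) unfolding assoc_ideal_def by blast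
  then obtain as bs where x: "fs = as @ x # bs" "x \<in> V.span ?B" by (meson split_list)
  have FA: "set as \<subseteq> V.span ?M" "set bs \<subseteq> V.span ?M" using fs(2) x(1) unfolding FA_span by auto
  let ?Bs = "replicate (length as) ?M @ ?B # replicate (length bs) ?M"
  show ?thesis unfolding assoc_ideal_def
  proof (rule multilinear_span[OF linmap_oper])
    have "list_all2 (\<lambda>x B. x \<in> V.span B) l (replicate (length l) ?M)" if "set l \<subseteq> V.span ?M" for l
      using that by (auto simp: list_all2_conv_all_nth)
    then show "list_all2 (\<lambda>x B. x \<in> V.span B) fs ?Bs" using x FA by (auto intro!: list_all2_appendI)
    fix ds assume "list_all2 (\<in>) ds ?Bs"
    then obtain as' e bs' where ds: "ds = as' @ e # bs'" "e \<in> ?B"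
      "list_all2 (\<in>) as' (replicate (length as) ?M)" "list_all2 (\<in>) bs' (replicate (length bs) ?M)"
      by (auto simp: list_all2_append2 list_all2_Cons2)
    have len: "length as' = length as" "length bs' = length bs" using ds(3,4) list_all2_lengthD by fastforce+
    have "set as' \<subseteq> ?M" "set bs' \<subseteq> ?M"
      using ds(3,4) by (auto simp: list_all2_conv_all_nth in_set_conv_nth)
    then obtain us vs where us: "as' = map mon us" "set us \<subseteq> OW" "bs' = map mon vs" "set vs \<subseteq> OW"
      by (metis map_imageE)
    obtain u where u: "(u, e) \<in> SG S" using ds(2) by blast
    have "length us + Suc (length vs) = ar \<omega>" using fs(1) x(1) len us by simp
    from oper_SG[OF u \<omega> this us(2,4)] show "oper \<omega> ds \<in> V.span ?B"
      unfolding ds(1) us(1,3) by (intro V.span_base) blast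
  qed
qed

abbreviation IdL :: "('x, 'o, 'k::field) oalg set \<Rightarrow> ('x, 'o, 'k) oalg set" where
  "IdL S \<equiv> Id_Lie X Om ar S"

lemma Id_iff: "f \<in> IdL S \<longleftrightarrow> (\<forall>I. lie_ideal X Om ar I \<and> S \<subseteq> I \<longrightarrow> f \<in> I)"
  by (auto simp: Id_Lie_def hull_def)

lemma lie_ideal_LA: "lie_ideal X Om ar LA"
  unfolding lie_ideal_def using LA_subspace LA_comm LA_oper by blast

lemma lie_ideal_Id:
  fixes S :: "('x, 'o, 'k::field) oalg set"
  assumes "S \<subseteq> LA"
  shows "lie_ideal X Om ar (IdL S)"
  unfolding lie_ideal_def
proof (intro conjI ballI allI impI)
  show "IdL S \<subseteq> LA" using assms lie_ideal_LA Id_iff by blast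
  have "IdL S = \<Inter>{I. lie_ideal X Om ar I \<and> S \<subseteq> I}" by (simp add: Id_Lie_def hull_def)
  moreover have "V.subspace \<dots>" by (rule V.subspace_Inter) (auto simp: lie_ideal_def)
  ultimately show "V.subspace (IdL S)" by simp
  fix f g :: "('x, 'o, 'k) oalg" assume "f \<in> IdL S" "g \<in> LA"
  then show "comm f g \<in> IdL S" "comm g f \<in> IdL S"
    unfolding Id_iff lie_ideal_def by blast+
next
  fix \<omega> and fs :: "('x, 'o, 'k) oalg list"
  assume \<omega>: "\<omega> \<in> Om" and fs: "length fs = ar \<omega> \<and> set fs \<subseteq> LA \<and> set fs \<inter> IdL S \<noteq> {}"
  show "oper \<omega> fs \<in> IdL S" unfolding Id_iff
  proof (intro allI impI)
    fix I :: "('x, 'o, 'k) oalg set" assume I: "lie_ideal X Om ar I \<and> S \<subseteq> I"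
    then have "set fs \<inter> I \<noteq> {}" using fs Id_iff by blast
    then show "oper \<omega> fs \<in> I" using I \<omega> fs unfolding lie_ideal_def by blast
  qed
qed

text \<open>The associative ideal is intersected with \<open>LA\<close> because an ideal of the Lie
  algebra has to lie in it. Commutators are absorbed since both products are.\<close>

lemma Id_assoc_ideal:
  fixes S :: "('x, 'o, 'k::field) oalg set"
  assumes S: "S \<subseteq> LA"
  shows "IdL S \<subseteq> assoc_ideal S"
proof -
  have "lie_ideal X Om ar (assoc_ideal S \<inter> LA)"
    unfolding lie_ideal_def
  proof (intro conjI ballI allI impI)
    show "assoc_ideal S \<inter> LA \<subseteq> LA" by simp
    show "V.subspace (assoc_ideal S \<inter> LA)"
      unfolding assoc_ideal_def by (intro V.subspace_inter V.subspace_span LA_subspace)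
    fix f g :: "('x, 'o, 'k) oalg" assume f: "f \<in> assoc_ideal S \<inter> LA" and g: "g \<in> LA"
    then have "mul f g \<in> assoc_ideal S" "mul g f \<in> assoc_ideal S"
      using assoc_ideal_mul[of f S g] LA_FA by blast+
    then have "comm f g \<in> assoc_ideal S" "comm g f \<in> assoc_ideal S"
      unfolding comm_def assoc_ideal_def by (auto intro: V.span_diff)
    then show "comm f g \<in> assoc_ideal S \<inter> LA" "comm g f \<in> assoc_ideal S \<inter> LA"
      using f g LA_comm by blast+
  next
    fix \<omega> and fs :: "('x, 'o, 'k) oalg list"
    assume "\<omega> \<in> Om" and "length fs = ar \<omega> \<and> set fs \<subseteq> LA \<and> set fs \<inter> (assoc_ideal S \<inter> LA) \<noteq> {}"
    then show "oper \<omega> fs \<in> assoc_ideal S \<inter> LA"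
      using assoc_ideal_oper[of \<omega> fs S] LA_oper[of \<omega> fs] LA_FA by blast
  qed
  moreover have "S \<subseteq> assoc_ideal S \<inter> LA"
  proof
    fix s assume s: "s \<in> S"
    then have "(lead s, s) \<in> SG S" using SG_I[OF ctx_id s] by simp
    then show "s \<in> assoc_ideal S \<inter> LA" using s S unfolding assoc_ideal_def by (auto intro: V.span_base)
  qed
  ultimately show ?thesis using Id_iff by blast
qed

end

section \<open>The Composition-Diamond lemma for Lie \<open>\<Omega>\<close>-algebras\<close>

text \<open>\<open>linear_basis_quot\<close> indexes coefficients by the elements of the basis, the
  proofs below by words; injectivity of \<open>h\<close> permits the change of index.\<close>

lemma sum_scl_image:
  assumes "inj_on h T"
  obtains e where "(\<Sum>b\<in>h ` T. scl (e b) b) = (\<Sum>w\<in>T. scl (c w) (h w))" "\<And>w. w \<in> T \<Longrightarrow> e (h w) = c w"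
proof
  show e: "(c \<circ> the_inv_into T h) (h w) = c w" if "w \<in> T" for w
    using the_inv_into_f_f[OF assms that] by simp
  show "(\<Sum>b\<in>h ` T. scl ((c \<circ> the_inv_into T h) b) b) = (\<Sum>w\<in>T. scl (c w) (h w))"
    unfolding sum.reindex[OF assms] using e by (intro sum.cong) auto
qed

locale lie_presentation = operated X Om ar
  for X :: "'x::wellorder set" and Om :: "'o::wellorder set" and ar +
  fixes ch :: "('x option, 'o) oword \<Rightarrow> ('x, 'o) oword \<Rightarrow> ('x option, 'o) oword \<times> ('x, 'o) oword"
    and S :: "('x, 'o, 'k::field) oalg set"
  assumes ch: "valid_choice X Om ar ch" and S_LA: "S \<subseteq> LA" and S_monic: "s \<in> S \<Longrightarrow> monic s"
begin

abbreviation "sn \<equiv> special_normal X Om ar ch :: _ \<Rightarrow> _ \<Rightarrow> ('x, 'o, 'k) oalg"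

lemma S_FA: "s \<in> S \<Longrightarrow> monic s \<and> s \<in> FA"
  using S_LA LA_FA S_monic by blast

lemma lead_S: "s \<in> S \<Longrightarrow> lead s \<in> AW"
  using S_LA S_monic lead_AW by blast

lemmas ideal_Id = lie_ideal_Id[OF S_LA]

lemma Id_LA: "IdL S \<subseteq> LA" and Id_subspace: "V.subspace (IdL S)"
  using ideal_Id unfolding lie_ideal_def by blast+

lemma S_Id: "S \<subseteq> IdL S"
  unfolding Id_Lie_def by (rule hull_subset)

lemma sn_SG:
  assumes "s \<in> S" "\<pi> \<in> SW" "plug \<pi> (lead s) \<in> AW"
  shows "sn \<pi> s - sub (plug \<pi>) s \<in> low (SG S) (plug \<pi> (lead s))"
proof -
  have "SG {s} \<subseteq> SG S" using assms(1) by (auto simp: SG_def)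
  then show ?thesis using special_normal(1)[OF ch _ _ assms(2,3)] assms(1) S_LA S_monic low_mono' by blast
qed

lemma sn_MW:
  assumes "s \<in> S" "\<pi> \<in> SW" "plug \<pi> (lead s) \<in> AW"
  shows "sn \<pi> s - mon (plug \<pi> (lead s)) \<in> low MW (plug \<pi> (lead s))"
proof -
  have "sn \<pi> s - sub (plug \<pi>) s \<in> low MW (plug \<pi> (lead s))"
    using low_SG_MW[OF S_FA sn_SG[OF assms]] .
  moreover have "sub (plug \<pi>) s - mon (plug \<pi> (lead s)) \<in> low MW (plug \<pi> (lead s))"
    using sub_lead[OF ctx_plug[OF assms(2)]] S_FA assms(1) by blast
  ultimately show ?thesis using low_add by fastforce
qed

lemma sn_Id: "s \<in> S \<Longrightarrow> \<pi> \<in> SW \<Longrightarrow> plug \<pi> (lead s) \<in> AW \<Longrightarrow> sn \<pi> s \<in> IdL S"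
  using special_normal(2)[OF ch _ _ _ _ ideal_Id] S_LA S_monic S_Id by blast

section \<open>Division by special normal words and irreducible bracketings\<close>

definition reducible :: "('x, 'o) oword \<Rightarrow> bool" where
  "reducible w \<longleftrightarrow> (\<exists>s\<in>S. \<exists>\<pi>\<in>SW. w = plug \<pi> (lead s))"

definition normal_words :: "('x, 'o) oword set" where
  "normal_words = {w \<in> AW. \<not> reducible w}"

lemma Irr_LB: "Irr X Om ar S = LB ` normal_words"
  unfolding Irr_def normal_words_def reducible_def by blast

text \<open>The bounds in \<open>sns\<close> and \<open>lbs\<close> record that division produces no
  words above the leading word, which triviality modulo \<open>(S, w)\<close> requires.\<close>

definition sns :: "('x, 'o) oword \<Rightarrow> ('x, 'o, 'k) oalg set" where
  "sns w = {sn \<pi> s | \<pi> s. s \<in> S \<and> \<pi> \<in> SW \<and> plug \<pi> (lead s) \<in> AW \<and>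
     (plug \<pi> (lead s) = w \<or> dl_gt w (plug \<pi> (lead s)))}"

definition lbs :: "('x, 'o) oword \<Rightarrow> ('x, 'o, 'k) oalg set" where
  "lbs w = LB ` {u \<in> normal_words. u = w \<or> dl_gt w u}"

lemma below_mono: "dl_gt w v \<Longrightarrow> lbs v \<union> sns v \<subseteq> lbs w \<union> sns w"
  unfolding lbs_def sns_def by (auto intro: dl_gt_trans)

lemma lead_below:
  assumes "f \<in> FA" "f \<noteq> 0" "f \<in> low MW w"
  shows "dl_gt w (lead f)"
  using lead_keys(1)[OF assms(2,1)] assms(3) low_MW_iff by blast

lemma cancel_lead:
  assumes f: "f \<in> FA" "f \<noteq> 0" and b: "b - mon (lead f) \<in> low MW (lead f)"
  shows "f - scl (Poly_Mapping.lookup f (lead f)) b \<in> low MW (lead f)"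
proof -
  let ?w = "lead f"
  have "b \<in> FA" "Poly_Mapping.lookup b ?w = 1" using lead_low[OF b] lead_OW f by blast+
  show ?thesis unfolding low_MW_iff
  proof
    fix v assume v: "v \<in> Poly_Mapping.keys (f - scl (Poly_Mapping.lookup f ?w) b)"
    then have "v \<noteq> ?w" using \<open>Poly_Mapping.lookup b ?w = 1\<close> by (auto simp: in_keys_iff lookup_minus)
    have "v \<in> Poly_Mapping.keys f \<or> v \<in> Poly_Mapping.keys (b - mon ?w)"
      using v \<open>v \<noteq> ?w\<close> by (auto simp: in_keys_iff lookup_minus lookup_mon)
    then show "v \<in> {u \<in> OW. dl_gt ?w u}"
    proof
      assume "v \<in> Poly_Mapping.keys f"
      then show ?thesis using lead_keys(2)[OF f(2,1)] \<open>v \<noteq> ?w\<close> f(1) by (auto simp: free_alg_def)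
    next
      assume "v \<in> Poly_Mapping.keys (b - mon ?w)"
      then show ?thesis using b low_MW_iff by blast
    qed
  qed
qed

text \<open>One step cancels the leading term, by a special normal word if \<open>lead f\<close> is
  reducible and by its bracketing otherwise; both are monic elements of \<open>LA\<close> with that
  leading word. The rest has a smaller leading word.\<close>

lemma reduction: "f \<in> LA \<Longrightarrow> f \<noteq> 0 \<Longrightarrow> f \<in> V.span (lbs (lead f) \<union> sns (lead f))"
proof (induction "lead f" arbitrary: f rule: wf_induct_rule[OF wf_dl_gt])
  case 1
  let ?w = "lead f" and ?c = "Poly_Mapping.lookup f (lead f)"
  have FA: "f \<in> FA" using 1(2) LA_FA by blast
  have w: "?w \<in> AW" using lead_LA 1(2,3) by blast
  obtain b where b: "b \<in> lbs ?w \<union> sns ?w" "b - mon ?w \<in> low MW ?w" "b \<in> LA"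
  proof (cases "reducible ?w")
    case True
    then obtain s \<pi> where s: "s \<in> S" "\<pi> \<in> SW" "?w = plug \<pi> (lead s)" unfolding reducible_def by blast
    then have "sn \<pi> s \<in> sns ?w" unfolding sns_def using w by auto
    then show ?thesis using that[of "sn \<pi> s"] s sn_MW[OF s(1,2)] sn_Id[OF s(1,2)] Id_LA w by auto
  next
    case False
    then have "LB ?w \<in> lbs ?w" unfolding lbs_def normal_words_def using w by blast
    then show ?thesis using that[of "LB ?w"] LB_low[OF w] LB_LA[OF w] by blast
  qed
  let ?g = "f - scl ?c b"
  have g: "?g \<in> LA" by (intro V.subspace_diff[OF LA_subspace] V.subspace_scale[OF LA_subspace] 1(2) b(3))
  have g_low: "?g \<in> low MW ?w" using cancel_lead[OF FA 1(3) b(2)] .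
  have "?g \<in> V.span (lbs ?w \<union> sns ?w)"
  proof (cases "?g = 0")
    case True
    then show ?thesis by (simp add: V.span_zero)
  next
    case False
    have gt: "dl_gt ?w (lead ?g)" using lead_below[OF LA_FA[OF g] False g_low] .
    have "lead ?g \<in> OW" "?w \<in> OW" using lead_OW[OF False LA_FA[OF g]] lead_OW[OF 1(3) FA] by auto
    then have "?g \<in> V.span (lbs (lead ?g) \<union> sns (lead ?g))" using 1(1)[OF _ g False] gt by blast
    then show ?thesis using V.span_mono[OF below_mono[OF gt]] by blast
  qed
  moreover have "scl ?c b \<in> V.span (lbs ?w \<union> sns ?w)" using b(1) by (intro V.span_scale V.span_base)
  ultimately have "?g + scl ?c b \<in> V.span (lbs ?w \<union> sns ?w)" by (rule V.span_add)
  then show ?case by simp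
qed

lemma sns_Id: "V.span (sns w) \<subseteq> IdL S"
  using sn_Id by (intro V.span_minimal Id_subspace) (auto simp: sns_def)

lemma reduction_sum:
  assumes "f \<in> LA" "f \<noteq> 0"
  obtains T c h where "finite T" "T \<subseteq> {u \<in> normal_words. u = lead f \<or> dl_gt (lead f) u}" "\<forall>w\<in>T. c w \<noteq> 0"
    "h \<in> V.span (sns (lead f))" "f = (\<Sum>w\<in>T. scl (c w) (LB w)) + h"
proof -
  obtain r h where rh: "r \<in> V.span (lbs (lead f))" "h \<in> V.span (sns (lead f))" "f = r + h"
    using reduction[OF assms] unfolding V.span_Un by blast
  then show ?thesis using span_image_nonzero[OF rh(1)[unfolded lbs_def]] that by blast
qed

lemma normal_AW: "normal_words \<subseteq> AW"
  by (auto simp: normal_words_def)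

abbreviation "reducible_leads \<equiv> \<forall>f\<in>IdL S. f \<noteq> 0 \<longrightarrow> reducible (lead f)"

text \<open>The leading word of a nonempty such combination belongs to \<open>T\<close> and is
  irreducible, which is impossible in the ideal.\<close>

lemma normal_sum_Id:
  assumes red: reducible_leads
    and T: "finite T" "T \<subseteq> normal_words" "\<forall>w\<in>T. c w \<noteq> 0" "(\<Sum>w\<in>T. scl (c w) (LB w)) \<in> IdL S"
  shows "T = {}"
proof (rule ccontr)
  assume ne: "T \<noteq> {}"
  have AW: "T \<subseteq> AW" using T(2) normal_AW by blast
  let ?f = "\<Sum>w\<in>T. scl (c w) (LB w) :: ('x, 'o, 'k) oalg"
  have "?f \<noteq> 0" "lead ?f \<in> T" using lead_LB_sum[OF T(1) ne AW, of c] T(3) by auto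
  then show False using red T(2,4) by (auto simp: normal_words_def)
qed

text \<open>The irreducible part of \<open>f\<close> differs from \<open>f\<close> by special normal
  words, so it lies in the ideal and vanishes by \<open>normal_sum_Id\<close>.\<close>

lemma Id_sns:
  assumes red: reducible_leads and f: "f \<in> IdL S" "f \<noteq> 0"
  shows "f \<in> V.span (sns (lead f))"
proof -
  have LA: "f \<in> LA" using f Id_LA by blast
  obtain T c h where T: "finite T" "T \<subseteq> {u \<in> normal_words. u = lead f \<or> dl_gt (lead f) u}" "\<forall>w\<in>T. c w \<noteq> 0"
    "h \<in> V.span (sns (lead f))" "f = (\<Sum>w\<in>T. scl (c w) (LB w)) + h"
    by (rule reduction_sum[OF LA f(2)])
  have "f - h \<in> IdL S" using f(1) T(4) sns_Id V.subspace_diff[OF Id_subspace] by blast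
  then have "(\<Sum>w\<in>T. scl (c w) (LB w)) \<in> IdL S" using T(5) by simp
  moreover have "T \<subseteq> normal_words" using T(2) by blast
  ultimately have "T = {}" using normal_sum_Id[OF red T(1)] T(3) by blast
  then show ?thesis using T(4,5) by simp
qed

section \<open>Compositions and reducible leading words\<close>

lemma plug_append_star: "plug (lift_word a @ star @ lift_word b) = (\<lambda>u. a @ u @ b)"
  by (simp add: fun_eq_iff del: append_Cons)

text \<open>The length condition makes the leading words overlap in a nonempty \<open>y\<close>, so
  \<open>alsw_overlap\<close> applies to \<open>b @ y @ a\<close>. This puts the facts about special
  normal words at the disposal of both parts of the composition.\<close>

lemma intersection_facts:
  assumes fg: "f \<in> S" "g \<in> S" and ab: "a \<noteq> []" "b \<noteq> []"
    and w: "lead f @ a = b @ lead g" "length (lead f @ a) < length (lead f) + length (lead g)"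
  shows "lead f @ a \<in> AW" "star @ lift_word a \<in> SW" "lift_word b @ star \<in> SW"
    "plug (star @ lift_word a) = (\<lambda>u. u @ a)" "plug (lift_word b @ star) = (\<lambda>u. b @ u)"
proof -
  obtain y where y: "lead f = b @ y" "lead g = y @ a" "y \<noteq> []"
    using w(1) by (cases rule: append_eq_appendE) (use w(2) in auto)
  note AW = lead_S[OF fg(1)] lead_S[OF fg(2)]
  have PR: "set a \<subseteq> PR" "set b \<subseteq> PR" "set y \<subseteq> PR" using AW[THEN AW_PR] y by auto
  have "is_alsw prime_gt (b @ y @ a)"
    using lyn.alsw_overlap[of b y a] AW[THEN AW_alsw] y ab PR by simp
  moreover have "set (b @ y @ a) \<subseteq> AP" using AW y by (auto simp: oalsw_iff)
  ultimately show "lead f @ a \<in> AW" using y by (simp add: oalsw_iff)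
  show "star @ lift_word a \<in> SW" "lift_word b @ star \<in> SW"
    using star_lift_SW[of "[]" a] star_lift_SW[of b "[]"] PR by (simp_all add: lift_word_def)
  show "plug (star @ lift_word a) = (\<lambda>u. u @ a)" "plug (lift_word b @ star) = (\<lambda>u. b @ u)"
    using plug_append_star[of "[]" a] plug_append_star[of b "[]"] by (simp_all add: lift_word_def)
qed

text \<open>Each special normal word in the sum is its associative \<open>S\<close>-word plus
  smaller ones, all with labels below \<open>w\<close>.\<close>

lemma trivial_mod_low: "trivial_mod X Om ar ch S w h \<Longrightarrow> h \<in> low (SG S) w"
proof -
  have "(\<Sum>(\<alpha>, \<pi>, s)\<leftarrow>ts. scl \<alpha> (sn \<pi> s)) \<in> low (SG S) w"
    if "\<forall>(\<alpha>, \<pi>, s)\<in>set ts. s \<in> S \<and> \<pi> \<in> SW \<and> plug \<pi> (lead s) \<in> AW \<and> dl_gt w (plug \<pi> (lead s))" for ts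
    using that
  proof (induction ts)
    case (Cons t ts)
    obtain \<alpha> \<pi> s where t: "t = (\<alpha>, \<pi>, s)" by (cases t)
    then have s: "s \<in> S" "\<pi> \<in> SW" "plug \<pi> (lead s) \<in> AW" and gt: "dl_gt w (plug \<pi> (lead s))"
      using Cons.prems by auto
    have "sn \<pi> s - sub (plug \<pi>) s \<in> low (SG S) w" using sn_SG[OF s] low_mono[OF gt] by blast
    moreover have "sub (plug \<pi>) s \<in> low (SG S) w" using low_base[OF SG_I[OF ctx_plug[OF s(2)] s(1)] gt] .
    ultimately have "sn \<pi> s - sub (plug \<pi>) s + sub (plug \<pi>) s \<in> low (SG S) w" by (rule low_add)
    then have "scl \<alpha> (sn \<pi> s) \<in> low (SG S) w" by (simp add: low_scl)
    then show ?case using Cons t by (simp add: low_add)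
  qed (simp add: low_zero)
  then show "trivial_mod X Om ar ch S w h \<Longrightarrow> h \<in> low (SG S) w" unfolding trivial_mod_def by auto
qed

text \<open>Replacing the special normal words of a Lie composition by the underlying associative
  \<open>S\<close>-words costs only \<open>S\<close>-words with labels below the word of the
  composition.\<close>

lemma assoc_gsb:
  assumes gs: "groebner_shirshov X Om ar ch S"
  shows "assoc_gsb S"
  unfolding assoc_gsb_def
proof (intro conjI ballI allI impI)
  fix f g a b
  assume fg: "f \<in> S" "g \<in> S"
    and *: "set a \<subseteq> PR \<and> set b \<subseteq> PR \<and> a \<noteq> [] \<and> b \<noteq> [] \<and> lead f @ a = b @ lead g \<and>
      length (lead f @ a) < length (lead f) + length (lead g)"
  let ?w = "lead f @ a" and ?\<pi> = "star @ lift_word a" and ?\<rho> = "lift_word b @ star"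
  have ab: "a \<noteq> []" "b \<noteq> []" "lead f @ a = b @ lead g" "length ?w < length (lead f) + length (lead g)"
    "a \<in> OW" "b \<in> OW" using * unfolding owords_iff by blast+
  note facts = intersection_facts[OF fg ab(1-4)]
  have "composition X Om ar ch f g ?w (sn ?\<pi> f - sn ?\<rho> g)"
    by (rule composition.intersection[OF ab(5,6) refl ab(3,4)])
  then have 1: "sn ?\<pi> f - sn ?\<rho> g \<in> low (SG S) ?w"
    using gs fg trivial_mod_low unfolding groebner_shirshov_def by blast
  have 2: "sn ?\<pi> f - sub (\<lambda>u. u @ a) f \<in> low (SG S) ?w" using sn_SG[OF fg(1) facts(2)] facts(1,4) by simp
  have 3: "sn ?\<rho> g - sub (\<lambda>u. b @ u) g \<in> low (SG S) ?w"
    using sn_SG[OF fg(2) facts(3)] facts(1,5) ab(3) by simp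
  show "sub (\<lambda>u. u @ a) f - sub (\<lambda>u. b @ u) g \<in> low (SG S) ?w"
    using low_diff[OF low_add[OF 1 3] 2] by (simp add: algebra_simps)
next
  fix f g F assume fg: "f \<in> S" "g \<in> S" and F: "ctx F \<and> lead f = F (lead g)"
  obtain \<pi> where \<pi>: "\<pi> \<in> SW" "plug \<pi> = F" using ctx_star_word F by blast
  then have "composition X Om ar ch f g (lead f) (f - sn \<pi> g)"
    using F by (intro composition.inclusion) auto
  then have 1: "f - sn \<pi> g \<in> low (SG S) (lead f)"
    using gs fg trivial_mod_low unfolding groebner_shirshov_def by blast
  have "sn \<pi> g - sub F g \<in> low (SG S) (lead f)" using sn_SG[OF fg(2) \<pi>(1)] \<pi>(2) F lead_S[OF fg(1)] by simp
  from low_add[OF 1 this] show "f - sub F g \<in> low (SG S) (lead f)" by simp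
qed

lemma gs_reducible_leads:
  assumes gs: "groebner_shirshov X Om ar ch S"
  shows reducible_leads
proof (intro ballI impI)
  fix f assume f: "f \<in> IdL S" "f \<noteq> 0"
  then have "f \<in> assoc_ideal S" using Id_assoc_ideal[OF S_LA] by blast
  then obtain F s where "s \<in> S" "ctx F" "lead f = F (lead s)"
    using assoc_lead[OF assoc_gsb[OF gs] S_FA _ f(2)] by blast
  then show "reducible (lead f)" using ctx_star_word unfolding reducible_def by blast
qed

text \<open>By \<open>Id_sns\<close>, \<open>h\<close> is a combination of special normal words
  bounded by \<open>lead h\<close>, and \<open>lead h\<close> is below \<open>w\<close>.\<close>

lemma trivial_modI:
  assumes red: reducible_leads and h: "h \<in> IdL S" "h \<in> low MW w"
  shows "trivial_mod X Om ar ch S w h"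
proof -
  let ?ok = "\<lambda>ts. \<forall>(\<alpha>, \<pi>, s)\<in>set ts. s \<in> S \<and> \<pi> \<in> SW \<and> plug \<pi> (lead s) \<in> AW \<and> dl_gt w (plug \<pi> (lead s))"
  have "\<exists>ts. ?ok ts \<and> x = (\<Sum>(\<alpha>, \<pi>, s)\<leftarrow>ts. scl \<alpha> (sn \<pi> s))"
    if "x \<in> V.span (sns v)" "dl_gt w v" for x v
    using that(1)
  proof (induction rule: V.span_induct_alt)
    case base
    show ?case by (intro exI[of _ "[]"]) simp
  next
    case (step c x y)
    obtain ts where ts: "?ok ts" "y = (\<Sum>(\<alpha>, \<pi>, s)\<leftarrow>ts. scl \<alpha> (sn \<pi> s))" using step.IH by blast
    obtain \<pi> s where s: "x = sn \<pi> s" "s \<in> S" "\<pi> \<in> SW" "plug \<pi> (lead s) \<in> AW"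
      "plug \<pi> (lead s) = v \<or> dl_gt v (plug \<pi> (lead s))" using step.hyps unfolding sns_def by blast
    then have "dl_gt w (plug \<pi> (lead s))" using that(2) dl_gt_trans by metis
    then show ?case using ts s by (intro exI[of _ "(c, \<pi>, s) # ts"]) simp
  qed
  note spans = this
  show ?thesis
  proof (cases "h = 0")
    case True
    then show ?thesis unfolding trivial_mod_def by (intro exI[of _ "[]"]) simp
  next
    case False
    have "dl_gt w (lead h)" using lead_below[OF LA_FA False h(2)] h(1) Id_LA by blast
    then show ?thesis using spans[OF Id_sns[OF red h(1) False]] unfolding trivial_mod_def by blast
  qed
qed

text \<open>Both parts of a composition lie in the ideal and are monic with leading word
  \<open>w\<close>; so \<open>w\<close> cancels in their difference and \<open>trivial_modI\<close>
  applies.\<close>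

lemma reducible_leads_gs:
  assumes red: reducible_leads
  shows "groebner_shirshov X Om ar ch S"
  unfolding groebner_shirshov_def
proof (intro conjI ballI allI impI)
  fix f g w h assume fg: "f \<in> S" "g \<in> S" and comp: "composition X Om ar ch f g w h"
  from comp have "h \<in> IdL S \<and> h \<in> low MW w"
  proof cases
    case (intersection a b)
    have "a \<noteq> []" "b \<noteq> []" "lead f @ a = b @ lead g"
      "length (lead f @ a) < length (lead f) + length (lead g)"
      using intersection by (auto simp: owords_iff)
    note facts = intersection_facts[OF fg this] and eq = this(3)
    have p: "plug (star @ lift_word a) (lead f) = w" "plug (lift_word b @ star) (lead g) = w"
      using facts(4,5) intersection eq by simp_all
    have w: "w \<in> AW" using facts(1) intersection by simp
    have "sn (star @ lift_word a) f - mon w \<in> low MW w" "sn (lift_word b @ star) g - mon w \<in> low MW w"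
      using sn_MW[OF fg(1) facts(2)] sn_MW[OF fg(2) facts(3)] p w by simp_all
    from low_diff[OF this] have "h \<in> low MW w" using intersection by simp
    moreover have "sn (star @ lift_word a) f \<in> IdL S" "sn (lift_word b @ star) g \<in> IdL S"
      using sn_Id[OF fg(1) facts(2)] sn_Id[OF fg(2) facts(3)] p w by simp_all
    then have "h \<in> IdL S" using intersection V.subspace_diff[OF Id_subspace] by blast
    ultimately show ?thesis by blast
  next
    case (inclusion \<pi>)
    have w: "w \<in> AW" using inclusion lead_S[OF fg(1)] by simp
    have "sn \<pi> g - mon w \<in> low MW w" "sn \<pi> g \<in> IdL S"
      using sn_MW[OF fg(2) inclusion(2)] sn_Id[OF fg(2) inclusion(2)] inclusion(4) w by simp_all
    moreover have "f - mon w \<in> low MW w" using monic_low S_FA[OF fg(1)] inclusion(3) by blast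
    moreover have "f \<in> IdL S" using fg(1) S_Id by blast
    ultimately show ?thesis
      using inclusion(1) V.subspace_diff[OF Id_subspace] low_diff[of "f - mon w" MW w "sn \<pi> g - mon w"] by simp
  qed
  then show "trivial_mod X Om ar ch S w h" using trivial_modI[OF red] by blast
qed (use S_LA S_monic in auto)

section \<open>Irreducible bracketings as a basis of the quotient\<close>

lemma quot_class_eq:
  assumes "f \<in> LA" "g \<in> LA"
  shows "quot_rel LA (IdL S) `` {f} = quot_rel LA (IdL S) `` {g} \<longleftrightarrow> f - g \<in> IdL S"
proof
  assume eq: "quot_rel LA (IdL S) `` {f} = quot_rel LA (IdL S) `` {g}"
  have "g \<in> quot_rel LA (IdL S) `` {g}"
    using assms V.subspace_0[OF Id_subspace] by (simp add: quot_rel_def)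
  then show "f - g \<in> IdL S" unfolding eq[symmetric] by (simp add: quot_rel_def)
next
  assume d: "f - g \<in> IdL S"
  have "f - h \<in> IdL S \<longleftrightarrow> g - h \<in> IdL S" for h
    using V.subspace_diff[OF Id_subspace _ d, of "f - h"] V.subspace_add[OF Id_subspace d, of "g - h"] by auto
  then show "quot_rel LA (IdL S) `` {f} = quot_rel LA (IdL S) `` {g}"
    using assms by (auto simp: quot_rel_def)
qed

lemma normal_sum_LA: "T \<subseteq> normal_words \<Longrightarrow> (\<Sum>w\<in>T. scl (c w) (LB w)) \<in> (LA :: ('x, 'o, 'k) oalg set)"
  using normal_AW LB_LA by (intro V.subspace_sum[OF LA_subspace] V.subspace_scale[OF LA_subspace]) blast

lemma LB_inj: "inj_on (LB :: _ \<Rightarrow> ('x, 'o, 'k) oalg) AW"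
proof (rule inj_onI)
  fix u v assume u: "u \<in> AW" and v: "v \<in> AW" and eq: "LB u = (LB v :: ('x, 'o, 'k) oalg)"
  have "lead (LB w :: ('x, 'o, 'k) oalg) = w" if "w \<in> AW" for w
    using lead_low(1)[OF LB_low[OF that]] that oalsw_owords by blast
  then show "u = v" using u v eq by metis
qed

lemma reducible_leads_basis:
  assumes red: reducible_leads
  shows "linear_basis_quot LA (IdL S) (Irr X Om ar S)"
  unfolding linear_basis_quot_def Irr_LB
proof (intro conjI ballI allI impI)
  show "LB ` normal_words \<subseteq> LA" using LB_LA normal_AW by blast
next
  fix Q assume "Q \<in> LA // quot_rel LA (IdL S)"
  then obtain f where f: "f \<in> LA" "Q = quot_rel LA (IdL S) `` {f}" by (auto simp: quotient_def)
  show "\<exists>F c. finite F \<and> F \<subseteq> LB ` normal_words \<and> Q = quot_rel LA (IdL S) `` {\<Sum>b\<in>F. scl (c b) b}"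
  proof (cases "f = 0")
    case True
    then show ?thesis using f by (intro exI[of _ "{}"]) simp
  next
    case False
    obtain T c h where T: "finite T" "T \<subseteq> {u \<in> normal_words. u = lead f \<or> dl_gt (lead f) u}"
      "\<forall>w\<in>T. c w \<noteq> 0" "h \<in> V.span (sns (lead f))" "f = (\<Sum>w\<in>T. scl (c w) (LB w)) + h"
      by (rule reduction_sum[OF f(1) False])
    have nT: "T \<subseteq> normal_words" using T(2) by blast
    have inj: "inj_on (LB :: _ \<Rightarrow> ('x, 'o, 'k) oalg) T"
      using inj_on_subset[OF LB_inj] nT normal_AW by blast
    obtain e where e: "(\<Sum>b\<in>LB ` T. scl (e b) b) = (\<Sum>w\<in>T. scl (c w) (LB w) :: ('x, 'o, 'k) oalg)"
      by (rule sum_scl_image[OF inj])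
    have "Q = quot_rel LA (IdL S) `` {\<Sum>w\<in>T. scl (c w) (LB w)}"
      using T(4,5) sns_Id unfolding f(2) quot_class_eq[OF f(1) normal_sum_LA[OF nT]] by auto
    then show ?thesis using T(1) nT e by (intro exI[of _ "LB ` T"] exI[of _ e]) auto
  qed
next
  fix F c b
  assume *: "finite F \<and> F \<subseteq> LB ` normal_words \<and>
    quot_rel LA (IdL S) `` {\<Sum>b\<in>F. scl (c b) b} = quot_rel LA (IdL S) `` {0}" and b: "b \<in> F"
  then obtain T where T: "T \<subseteq> normal_words" "inj_on (LB :: _ \<Rightarrow> ('x, 'o, 'k) oalg) T" "F = LB ` T"
    by (auto simp: subset_image_inj)
  have finT: "finite T" using * T finite_image_iff by blast
  \<comment> \<open>\<open>normal_sum_Id\<close> expects nonzero coefficients, so only the words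
    carrying such are kept; that none remain is the claim.\<close>
  let ?U = "{w \<in> T. c (LB w) \<noteq> 0}"
  have "(\<Sum>b\<in>F. scl (c b) b) = (\<Sum>w\<in>T. scl (c (LB w)) (LB w))" using T by (simp add: sum.reindex)
  also have "\<dots> = (\<Sum>w\<in>?U. scl (c (LB w)) (LB w))"
    using finT by (intro sum.mono_neutral_right) auto
  finally have sum: "(\<Sum>b\<in>F. scl (c b) b) = (\<Sum>w\<in>?U. scl (c (LB w)) (LB w))" .
  have U: "?U \<subseteq> normal_words" using T(1) by blast
  have "(\<Sum>w\<in>?U. scl (c (LB w)) (LB w)) - 0 \<in> IdL S"
    using * quot_class_eq[OF normal_sum_LA[OF U, of "\<lambda>w. c (LB w)"] V.subspace_0[OF LA_subspace]] unfolding sum by blast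
  then have "?U = {}" using finT by (intro normal_sum_Id[OF red _ U, of "\<lambda>w. c (LB w)"]) auto
  then show "c b = 0" using b T(3) by blast
qed

text \<open>For \<open>f\<close> in the ideal with irreducible leading word, division of the
  remaining terms gives a linear relation in the quotient in which the bracketing of
  \<open>lead f\<close> has the nonzero coefficient \<open>?c\<close>.\<close>

lemma basis_reducible_leads:
  assumes basis: "linear_basis_quot LA (IdL S) (Irr X Om ar S)"
  shows reducible_leads
proof (intro ballI impI, rule ccontr)
  fix f assume f: "f \<in> IdL S" "f \<noteq> 0" and irr: "\<not> reducible (lead f)"
  let ?w = "lead f" and ?c = "Poly_Mapping.lookup f (lead f)"
  have LA: "f \<in> LA" using f Id_LA by blast
  have w: "?w \<in> normal_words" using irr lead_LA[OF LA f(2)] by (simp add: normal_words_def)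
  have wA: "?w \<in> AW" using w normal_AW by blast
  have c: "?c \<noteq> 0" using lead_keys(1)[OF f(2) LA_FA[OF LA]] by (simp add: in_keys_iff)
  let ?g = "f - scl ?c (LB ?w)"
  have g: "?g \<in> LA" by (intro V.subspace_diff[OF LA_subspace] V.subspace_scale[OF LA_subspace] LA LB_LA[OF wA])
  have g_low: "?g \<in> low MW ?w" using cancel_lead[OF LA_FA[OF LA] f(2) LB_low[OF wA]] .
  obtain T d h where T: "finite T" "T \<subseteq> normal_words" "?w \<notin> T" "h \<in> IdL S"
    "?g = (\<Sum>w\<in>T. scl (d w) (LB w)) + h"
  proof (cases "?g = 0")
    case True
    then show ?thesis using that[of "{}" 0 "\<lambda>_. 0"] V.subspace_0[OF Id_subspace] by simp
  next
    case False
    have gt: "dl_gt ?w (lead ?g)" using lead_below[OF LA_FA[OF g] False g_low] .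
    obtain T d h where T: "finite T" "T \<subseteq> {u \<in> normal_words. u = lead ?g \<or> dl_gt (lead ?g) u}"
      "\<forall>w\<in>T. d w \<noteq> 0" "h \<in> V.span (sns (lead ?g))" "?g = (\<Sum>w\<in>T. scl (d w) (LB w)) + h"
      by (rule reduction_sum[OF g False])
    \<comment> \<open>The words of \<open>T\<close> are at most \<open>lead ?g\<close>, hence below
      \<open>?w\<close>; so the coefficient of \<open>?w\<close> is not merged with another
      one.\<close>
    have "\<not> (?w = lead ?g \<or> dl_gt (lead ?g) ?w)" using gt dl_gt_trans dl_gt_irrefl by metis
    then have "?w \<notin> T" using T(2) by blast
    then show ?thesis using that[of T h d] T sns_Id by blast
  qed
  let ?T = "insert ?w T" and ?d = "d(?w := ?c)"
  have nT: "?T \<subseteq> normal_words" using T(2) w by blast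
  have "(\<Sum>v\<in>T. scl (?d v) (LB v)) = (\<Sum>v\<in>T. scl (d v) (LB v) :: ('x, 'o, 'k) oalg)"
    using T(3) by (intro sum.cong) auto
  then have "(\<Sum>v\<in>?T. scl (?d v) (LB v)) = f - h" using T(1,3,5) by (simp add: algebra_simps)
  then have sum_Id: "(\<Sum>v\<in>?T. scl (?d v) (LB v)) \<in> IdL S"
    using V.subspace_diff[OF Id_subspace f(1) T(4)] by simp
  have inj: "inj_on (LB :: _ \<Rightarrow> ('x, 'o, 'k) oalg) ?T"
    using inj_on_subset[OF LB_inj] nT normal_AW by blast
  obtain e where sum: "(\<Sum>b\<in>LB ` ?T. scl (e b) b) = (\<Sum>v\<in>?T. scl (?d v) (LB v) :: ('x, 'o, 'k) oalg)"
    and e: "\<And>v. v \<in> ?T \<Longrightarrow> e (LB v) = ?d v" using sum_scl_image[OF inj, of ?d] by blast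
  have "quot_rel LA (IdL S) `` {\<Sum>b\<in>LB ` ?T. scl (e b) b} = quot_rel LA (IdL S) `` {0}"
    unfolding sum using quot_class_eq[OF normal_sum_LA[OF nT] V.subspace_0[OF LA_subspace]] sum_Id by simp
  moreover have "finite (LB ` ?T)" "LB ` ?T \<subseteq> Irr X Om ar S" using T(1) nT unfolding Irr_LB by auto
  ultimately have "\<forall>b\<in>LB ` ?T. e b = 0"
    using basis unfolding linear_basis_quot_def by blast
  then have "e (LB ?w) = 0" by blast
  then show False using c e[of ?w] by simp
qed

lemma composition_diamond:
  "(groebner_shirshov X Om ar ch S \<longleftrightarrow> reducible_leads) \<and>
   (reducible_leads \<longleftrightarrow> linear_basis_quot LA (IdL S) (Irr X Om ar S))"
  using gs_reducible_leads reducible_leads_gs reducible_leads_basis basis_reducible_leads by blast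

end

theorem theorem3p10:
  fixes X :: "'x::wellorder set"
    and Om :: "'o::wellorder set"
    and ar :: "'o \<Rightarrow> nat"
    and ch :: "('x option, 'o) oword \<Rightarrow> ('x, 'o) oword \<Rightarrow> ('x option, 'o) oword \<times> ('x, 'o) oword"
    and S :: "('x, 'o, 'k::field) oalg set"
  assumes "\<forall>\<omega>\<in>Om. 1 \<le> ar \<omega>"
    and "valid_choice X Om ar ch"
    and "S \<noteq> {}"
    and "S \<subseteq> Lie X Om ar"
    and "\<forall>s\<in>S. monic s"
  shows "(groebner_shirshov X Om ar ch S \<longleftrightarrow>
           (\<forall>f\<in>Id_Lie X Om ar S. f \<noteq> 0 \<longrightarrow>
              (\<exists>s\<in>S. \<exists>\<pi>\<in>star_words X Om ar. lead f = plug \<pi> (lead s) \<and> lead f \<in> oalsw X Om ar))) \<and>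
         ((\<forall>f\<in>Id_Lie X Om ar S. f \<noteq> 0 \<longrightarrow>
              (\<exists>s\<in>S. \<exists>\<pi>\<in>star_words X Om ar. lead f = plug \<pi> (lead s) \<and> lead f \<in> oalsw X Om ar)) \<longleftrightarrow>
           linear_basis_quot (Lie X Om ar) (Id_Lie X Om ar S) (Irr X Om ar S))"
proof -
  interpret lie_presentation X Om ar ch S
    using assms by unfold_locales auto
  \<comment> \<open>\<open>lead_LA\<close> supplies the membership in \<open>AW\<close>, which turns
    (ii) into \<open>reducible_leads\<close>.\<close>
  have "(\<exists>s\<in>S. \<exists>\<pi>\<in>SW. lead f = plug \<pi> (lead s) \<and> lead f \<in> AW) \<longleftrightarrow> reducible (lead f)"
    if "f \<in> IdL S" "f \<noteq> 0" for f
    using lead_LA[of f] Id_LA that unfolding reducible_def by blast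
  then have "(\<forall>f\<in>IdL S. f \<noteq> 0 \<longrightarrow> (\<exists>s\<in>S. \<exists>\<pi>\<in>SW. lead f = plug \<pi> (lead s) \<and> lead f \<in> AW)) \<longleftrightarrow> reducible_leads"
    by blast
  then show ?thesis using composition_diamond by simp
qed

end
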